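(* Let $\mathcal{B}$ be the Lie conformal algebra of Block type, i.e. the free $\mathbb{C}[\partial]$-module with basis $\{J_i \mid i\in\mathbb{Z}^+\}$ and $\lambda$-bracket determined by $[J_{i\,\lambda}J_j]=((i+1)\partial+(i+j+2)\lambda)J_{i+j}$ for $i,j\in\mathbb{Z}^+$. Let $\tilde H^\bullet$ denote basic cohomology and $H^\bullet$ reduced cohomology of Lie conformal algebras. Then the following hold. (1) For the trivial module $\mathbb{C}$, $$\dim\tilde H^q(\mathcal{B},\mathbb{C})=\begin{cases}1&\text{if } q=0,\\0&\text{if } q=1 \text{ or } 2,\end{cases}\qquad \dim H^q(\mathcal{B},\mathbb{C})=\begin{cases}1&\text{if } q=0\text{ or }2,\\0&\text{if } q=1.\end{cases}$$ (2) If $a\in\mathbb{C}$, $a\neq0$, then $\dim H^\bullet(\mathcal{B},\mathbb{C}_a)=0$, i.e. $H^q(\mathcal{B},\mathbb{C}_a)=0$ for all $q\ge 0$. (3) If $\alpha\in\mathbb{C}$, $\alpha\neq0$ (and $\Delta\in\mathbb{C}$ is arbitrary), then $\dim H^\bullet(\mathcal{B},M_{\Delta,\alpha})=0$, i.e. $H^q(\mathcal{B},M_{\Delta,\alpha})=0$ for all $q\ge 0$.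
   Context: $\mathbb{Z}^+$ denotes the set of nonnegative integers; all vector spaces are over $\mathbb{C}$. A Lie conformal algebra $\mathcal{R}$ is a $\mathbb{C}[\partial]$-module with a $\mathbb{C}$-bilinear map $\mathcal{R}\otimes\mathcal{R}\to\mathbb{C}[\lambda]\otimes\mathcal{R}$, $a\otimes b\mapsto[a_\lambda b]$, such that for $a,b,c\in\mathcal{R}$: $[\partial a_\lambda b]=-\lambda[a_\lambda b]$, $[a_\lambda\partial b]=(\partial+\lambda)[a_\lambda b]$; $[a_\lambda b]=-[b_{-\lambda-\partial}a]$; $[a_\lambda[b_\mu c]]=[[a_\lambda b]_{\lambda+\mu}c]+[b_\mu[a_\lambda c]]$. The bracket of $\mathcal{B}$ is extended from the basis elements $J_i$ to all of $\mathcal{B}$ by the first pair of identities. A (conformal) module over $\mathcal{R}$ is a $\mathbb{C}[\partial]$-module $M$ with a bilinear map $\mathcal{R}\otimes M\to M[\lambda]$, $a\otimes v\mapsto a_\lambda v$, such that for $a,b\in\mathcal{R}$, $v\in M$: $a_\lambda(b_\mu v)-b_\mu(a_\lambda v)=[a_\lambda b]_{\lambda+\mu}v$, $(\partial a)_\lambda v=-\lambda a_\lambda v$, $a_\lambda(\partial v)=(\partial+\lambda)a_\lambda v$. The modules considered are: the trivial module $\mathbb{C}$ (one-dimensional, with $\partial$ and $\mathcal{B}$ acting by zero); $\mathbb{C}_a$ for $a\ne0$ (one-dimensional, $\partial v=av$, $\mathcal{B}$ acting by zero); and, for $\Delta,\alpha\in\mathbb{C}$, $M_{\Delta,\alpha}=\mathbb{C}[\partial]v$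 (free of rank 1) with $J_{0\,\lambda}v=(\partial+\alpha+\Delta\lambda)v$ and $J_{i\,\lambda}v=0$ for $i>0$. Cohomology. For $n\in\mathbb{Z}^+$, an $n$-cochain of $\mathcal{R}$ with coefficients in an $\mathcal{R}$-module $M$ is a $\mathbb{C}$-linear map $\gamma:\mathcal{R}^{\otimes n}\to M[\lambda_1,\dots,\lambda_n]$, $a_1\otimes\cdots\otimes a_n\mapsto\gamma_{\lambda_1,\dots,\lambda_n}(a_1,\dots,a_n)$, such that $\gamma_{\lambda_1,\dots,\lambda_n}(a_1,\dots,\partial a_i,\dots,a_n)=-\lambda_i\gamma_{\lambda_1,\dots,\lambda_n}(a_1,\dots,a_n)$ for each $i$, and $\gamma$ is skew-symmetric with respect to simultaneous permutations of the $a_i$'s and $\lambda_i$'s. A $0$-cochain is an element of $M$. Let $\tilde C^n(\mathcal{R},M)$ be the space of $n$-cochains. The differential is $$(d\gamma)_{\lambda_1,\dots,\lambda_{n+1}}(a_1,\dots,a_{n+1})=\sum_{i=1}^{n+1}(-1)^{i+1}a_{i\,\lambda_i}\gamma_{\lambda_1,\dots,\widehat{\lambda_i},\dots,\lambda_{n+1}}(a_1,\dots,\widehat{a_i},\dots,a_{n+1})$$ $$+\sum_{1\le i<j\le n+1}(-1)^{i+j}\gamma_{\lambda_i+\lambda_j,\lambda_1,\dots,\widehat{\lambda_i},\dots,\widehat{\lambda_j},\dots,\lambda_{n+1}}([a_{i\,\lambda_i}a_j],a_1,\dots,\widehat{a_i},\dots,\widehat{a_j},\dots,a_{n+1}),$$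 where $\gamma$ is extended linearly over polynomials in the $\lambda_i$; for a $0$-cochain $\gamma\in M$, $(d\gamma)_\lambda(a)=a_\lambda\gamma$. One has $d^2=0$, and $\tilde C^\bullet(\mathcal{R},M)=\bigoplus_n\tilde C^n(\mathcal{R},M)$ is the basic complex. It is a $\mathbb{C}[\partial]$-module via $(\partial\gamma)_{\lambda_1,\dots,\lambda_n}(a_1,\dots,a_n)=(\partial_M+\sum_{i=1}^n\lambda_i)\gamma_{\lambda_1,\dots,\lambda_n}(a_1,\dots,a_n)$, where $\partial_M$ is the action of $\partial$ on $M$; $d\partial=\partial d$, so $\partial\tilde C^\bullet(\mathcal{R},M)$ is a subcomplex, and $C^\bullet(\mathcal{R},M)=\tilde C^\bullet(\mathcal{R},M)/\partial\tilde C^\bullet(\mathcal{R},M)$ is the reduced complex. The basic cohomology $\tilde H^\bullet(\mathcal{R},M)$ is the cohomology of $\tilde C^\bullet(\mathcal{R},M)$; the (reduced) cohomology $H^\bullet(\mathcal{R},M)$ is the cohomology of $C^\bullet(\mathcal{R},M)$. *)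

theory Defs
  imports
    "HOL-Computational_Algebra.Polynomial"
    "HOL-Library.Poly_Mapping"
    "HOL-Combinatorics.Permutations"
    "HOL-Algebra.AbelCoset"
    "Jordan_Normal_Form.VS_Connect"
begin

section \<open>Complex vector spaces, quotients and cohomology of complexes\<close>

text \<open>
  Vector spaces over the complex numbers are records of HOL-Algebra over the field
  \<open>class_ring :: complex ring\<close>; the fields \<open>mult\<close> and \<open>one\<close> of the record play no role.
  Finite-dimensionality has to be required explicitly because \<open>vectorspace.dim\<close> is
  unspecified otherwise.
\<close>

definition has_dim :: "(complex, 'v) module \<Rightarrow> nat \<Rightarrow> bool" where
  "has_dim V n \<longleftrightarrow>
     vectorspace class_ring V \<and> vectorspace.fin_dim class_ring V \<and>
     vectorspace.dim class_ring V = n"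

definition quot_space :: "(complex, 'v) module \<Rightarrow> 'v set \<Rightarrow> (complex, 'v set) module" where
  "quot_space V W =
     \<lparr> carrier = a_rcosets\<^bsub>V\<^esub> W,
       mult = undefined,
       one = undefined,
       zero = W,
       add = set_add V,
       smult = (\<lambda>c X. \<Union>x\<in>X. W +>\<^bsub>V\<^esub> (c \<odot>\<^bsub>V\<^esub> x)) \<rparr>"

definition quot_map ::
  "(complex, 'w) module \<Rightarrow> 'w set \<Rightarrow> ('v \<Rightarrow> 'w) \<Rightarrow> 'v set \<Rightarrow> 'w set" where
  "quot_map V' W' f X = (\<Union>x\<in>X. W' +>\<^bsub>V'\<^esub> f x)"

definition cocycles ::
  "(nat \<Rightarrow> (complex, 'v) module) \<Rightarrow> (nat \<Rightarrow> 'v \<Rightarrow> 'v) \<Rightarrow> nat \<Rightarrow> 'v set" where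
  "cocycles C d q = {x \<in> carrier (C q). d q x = \<zero>\<^bsub>C (Suc q)\<^esub>}"

fun coboundaries ::
  "(nat \<Rightarrow> (complex, 'v) module) \<Rightarrow> (nat \<Rightarrow> 'v \<Rightarrow> 'v) \<Rightarrow> nat \<Rightarrow> 'v set" where
  "coboundaries C d 0 = {\<zero>\<^bsub>C 0\<^esub>}"
| "coboundaries C d (Suc q) = d q ` carrier (C q)"

definition cohomology ::
  "(nat \<Rightarrow> (complex, 'v) module) \<Rightarrow> (nat \<Rightarrow> 'v \<Rightarrow> 'v) \<Rightarrow> nat \<Rightarrow> (complex, 'v set) module" where
  "cohomology C d q =
     quot_space ((C q)\<lparr>carrier := cocycles C d q\<rparr>) (coboundaries C d q)"

section \<open>Cochains of Lie conformal algebras\<close>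

text \<open>
  A \<open>\<complex>[\<partial>]\<close>-module is an abelian group \<open>'m\<close> with a scalar multiplication
  \<open>s :: complex poly \<Rightarrow> 'm \<Rightarrow> 'm\<close> satisfying \<open>Modules.module\<close>. The indeterminate
  \<open>[:0, 1:]\<close> acts as \<open>\<partial>\<close> and \<open>[:c:]\<close> acts as the complex scalar \<open>c\<close>.

  A polynomial in \<open>\<lambda>\<^sub>1, \<dots>, \<lambda>\<^sub>n\<close> with coefficients in \<open>M\<close> is identified with the polynomial
  function on \<open>\<complex>\<^sup>n\<close> that it defines; this loses nothing because \<open>\<complex>\<close> is infinite. A
  \<open>\<lambda>\<close>-bracket is thus given by its values \<open>br \<lambda> a b\<close> and a \<open>\<lambda>\<close>-action by its values
  \<open>act \<lambda> a v\<close>, for complex \<open>\<lambda>\<close>, and the extension of cochains and actions to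
  polynomials in the \<open>\<lambda>\<^sub>i\<close> is pointwise.
\<close>

definition polynomial_fun ::
  "(complex poly \<Rightarrow> 'm \<Rightarrow> 'm) \<Rightarrow> nat \<Rightarrow> (complex list \<Rightarrow> 'm::ab_group_add) \<Rightarrow> bool" where
  "polynomial_fun s n f \<longleftrightarrow>
     (\<exists>E c. finite E \<and> (\<forall>ls. length ls = n \<longrightarrow>
        f ls = (\<Sum>e\<in>E. s [:\<Prod>i<n. (ls ! i) ^ (e i):] (c (e :: nat \<Rightarrow> nat)))))"

text \<open>
  A \<open>\<complex>\<close>-linear map on the \<open>n\<close>-fold tensor power of \<open>R\<close> is a multilinear map on lists of
  length \<open>n\<close>. Cochains vanish on arguments of the wrong length, so that equality of
  cochains is equality of functions.
\<close>

definition cochains ::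
  "(complex poly \<Rightarrow> 'r \<Rightarrow> 'r) \<Rightarrow> (complex poly \<Rightarrow> 'm \<Rightarrow> 'm) \<Rightarrow> nat \<Rightarrow>
   ('r::ab_group_add list \<Rightarrow> complex list \<Rightarrow> 'm::ab_group_add) set" where
  "cochains sR sM n = {\<gamma>.
     (\<forall>as ls. length as \<noteq> n \<or> length ls \<noteq> n \<longrightarrow> \<gamma> as ls = 0) \<and>
     (\<forall>as ls i x y. length as = n \<and> length ls = n \<and> i < n \<longrightarrow>
        \<gamma> (as[i := x + y]) ls = \<gamma> (as[i := x]) ls + \<gamma> (as[i := y]) ls) \<and>
     (\<forall>as ls i c x. length as = n \<and> length ls = n \<and> i < n \<longrightarrow>
        \<gamma> (as[i := sR [:c:] x]) ls = sM [:c:] (\<gamma> (as[i := x]) ls)) \<and>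
     (\<forall>as. length as = n \<longrightarrow> polynomial_fun sM n (\<gamma> as)) \<and>
     (\<forall>as ls i. length as = n \<and> length ls = n \<and> i < n \<longrightarrow>
        \<gamma> (as[i := sR [:0, 1:] (as ! i)]) ls = sM [:- (ls ! i):] (\<gamma> as ls)) \<and>
     (\<forall>as ls p. length as = n \<and> length ls = n \<and> p permutes {..<n} \<longrightarrow>
        \<gamma> (permute_list p as) (permute_list p ls) = sM [:of_int (sign p):] (\<gamma> as ls))}"

definition cochain_space ::
  "(complex poly \<Rightarrow> 'r \<Rightarrow> 'r) \<Rightarrow> (complex poly \<Rightarrow> 'm \<Rightarrow> 'm) \<Rightarrow> nat \<Rightarrow>
   (complex, 'r::ab_group_add list \<Rightarrow> complex list \<Rightarrow> 'm::ab_group_add) module" where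
  "cochain_space sR sM n =
     \<lparr> carrier = cochains sR sM n,
       mult = undefined,
       one = undefined,
       zero = (\<lambda>as ls. 0),
       add = (\<lambda>\<gamma> \<delta> as ls. \<gamma> as ls + \<delta> as ls),
       smult = (\<lambda>c \<gamma> as ls. sM [:c:] (\<gamma> as ls)) \<rparr>"

definition omit :: "nat \<Rightarrow> 'a list \<Rightarrow> 'a list" where
  "omit i xs = take i xs @ drop (Suc i) xs"

text \<open>
  List positions start at \<open>0\<close>, which turns the sign \<open>(-1)\<^bsup>i+1\<^esup>\<close> of the usual formula
  into \<open>(-1)\<^bsup>i\<^esup>\<close> and leaves \<open>(-1)\<^bsup>i+j\<^esup>\<close> unchanged.
\<close>

definition differential ::
  "(complex \<Rightarrow> 'r \<Rightarrow> 'r \<Rightarrow> 'r) \<Rightarrow> (complex poly \<Rightarrow> 'm \<Rightarrow> 'm) \<Rightarrow>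
   (complex \<Rightarrow> 'r \<Rightarrow> 'm \<Rightarrow> 'm) \<Rightarrow> nat \<Rightarrow>
   ('r list \<Rightarrow> complex list \<Rightarrow> 'm) \<Rightarrow> 'r list \<Rightarrow> complex list \<Rightarrow> 'm::ab_group_add" where
  "differential br sM act n \<gamma> as ls =
     (if length as = Suc n \<and> length ls = Suc n then
        (\<Sum>i<Suc n. sM [:(-1) ^ i:] (act (ls ! i) (as ! i) (\<gamma> (omit i as) (omit i ls)))) +
        (\<Sum>j<Suc n. \<Sum>i<j. sM [:(-1) ^ (i + j):]
           (\<gamma> (br (ls ! i) (as ! i) (as ! j) # omit i (omit j as))
              ((ls ! i + ls ! j) # omit i (omit j ls))))
      else 0)"

text \<open>The operator \<open>\<partial>\<^sub>M + \<lambda>\<^sub>1 + \<dots> + \<lambda>\<^sub>n\<close>.\<close>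

definition cochain_partial ::
  "(complex poly \<Rightarrow> 'm \<Rightarrow> 'm) \<Rightarrow>
   ('r list \<Rightarrow> complex list \<Rightarrow> 'm) \<Rightarrow> 'r list \<Rightarrow> complex list \<Rightarrow> 'm" where
  "cochain_partial sM \<gamma> as ls = sM [:sum_list ls, 1:] (\<gamma> as ls)"

definition partial_cochains ::
  "(complex poly \<Rightarrow> 'r \<Rightarrow> 'r) \<Rightarrow> (complex poly \<Rightarrow> 'm \<Rightarrow> 'm) \<Rightarrow> nat \<Rightarrow>
   ('r::ab_group_add list \<Rightarrow> complex list \<Rightarrow> 'm::ab_group_add) set" where
  "partial_cochains sR sM n = cochain_partial sM ` cochains sR sM n"

definition reduced_cochain_space ::
  "(complex poly \<Rightarrow> 'r \<Rightarrow> 'r) \<Rightarrow> (complex poly \<Rightarrow> 'm \<Rightarrow> 'm) \<Rightarrow> nat \<Rightarrow>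
   (complex, ('r::ab_group_add list \<Rightarrow> complex list \<Rightarrow> 'm::ab_group_add) set) module" where
  "reduced_cochain_space sR sM n = quot_space (cochain_space sR sM n) (partial_cochains sR sM n)"

definition reduced_differential ::
  "(complex poly \<Rightarrow> 'r \<Rightarrow> 'r) \<Rightarrow> (complex \<Rightarrow> 'r \<Rightarrow> 'r \<Rightarrow> 'r) \<Rightarrow>
   (complex poly \<Rightarrow> 'm \<Rightarrow> 'm) \<Rightarrow> (complex \<Rightarrow> 'r \<Rightarrow> 'm \<Rightarrow> 'm) \<Rightarrow> nat \<Rightarrow>
   ('r::ab_group_add list \<Rightarrow> complex list \<Rightarrow> 'm::ab_group_add) set \<Rightarrow>
   ('r list \<Rightarrow> complex list \<Rightarrow> 'm) set" where
  "reduced_differential sR br sM act n =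
     quot_map (cochain_space sR sM (Suc n)) (partial_cochains sR sM (Suc n))
       (differential br sM act n)"

definition basic_cohomology where
  "basic_cohomology sR br sM act =
     cohomology (cochain_space sR sM) (differential br sM act)"

definition reduced_cohomology where
  "reduced_cohomology sR br sM act =
     cohomology (reduced_cochain_space sR sM) (reduced_differential sR br sM act)"

section \<open>The Lie conformal algebra of Block type\<close>

text \<open>
  The free \<open>\<complex>[\<partial>]\<close>-module on \<open>J\<^sub>0, J\<^sub>1, \<dots>\<close> consists of the finitely supported functions
  from \<open>nat\<close> to \<open>complex poly\<close>.
\<close>

type_synonym block = "nat \<Rightarrow>\<^sub>0 complex poly"

definition J :: "nat \<Rightarrow> block" where
  "J i = Poly_Mapping.single i 1"

definition block_scale :: "complex poly \<Rightarrow> block \<Rightarrow> block" where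
  "block_scale p a = Poly_Mapping.map ((*) p) a"

text \<open>
  Sesquilinearity forces
  \<open>[f(\<partial>)J\<^sub>i \<^sub>\<lambda> g(\<partial>)J\<^sub>j] = f(-\<lambda>) g(\<partial>+\<lambda>) ((i+1)\<partial> + (i+j+2)\<lambda>) J\<^bsub>i+j\<^esub>\<close>; the lemmas below
  confirm that this defines the biadditive sesquilinear extension of the bracket of
  the \<open>J\<^sub>i\<close>.
\<close>

definition block_bracket :: "complex \<Rightarrow> block \<Rightarrow> block \<Rightarrow> block" where
  "block_bracket l a b =
     (\<Sum>i\<in>Poly_Mapping.keys a. \<Sum>j\<in>Poly_Mapping.keys b.
        block_scale
          ([:poly (Poly_Mapping.lookup a i) (- l):] *
           pcompose (Poly_Mapping.lookup b j) [:l, 1:] *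
           [:of_nat (i + j + 2) * l, of_nat (i + 1):])
          (J (i + j)))"

lemma lookup_block_scale: "Poly_Mapping.lookup (block_scale p a) i = p * Poly_Mapping.lookup a i"
  by (simp add: block_scale_def map.rep_eq when_def)

lemma module_block_scale: "Modules.module block_scale"
  by unfold_locales
    (auto intro!: poly_mapping_eqI simp: lookup_block_scale lookup_add algebra_simps)

lemma block_bracket_superset:
  assumes "finite A" "finite B" "Poly_Mapping.keys a \<subseteq> A" "Poly_Mapping.keys b \<subseteq> B"
  shows "block_bracket l a b =
     (\<Sum>i\<in>A. \<Sum>j\<in>B.
        block_scale
          ([:poly (Poly_Mapping.lookup a i) (- l):] *
           pcompose (Poly_Mapping.lookup b j) [:l, 1:] *
           [:of_nat (i + j + 2) * l, of_nat (i + 1):])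
          (J (i + j)))"
    (is "_ = (\<Sum>i\<in>A. \<Sum>j\<in>B. ?t i j)")
proof -
  interpret Modules.module block_scale by (rule module_block_scale)
  have z: "?t i j = 0" if "i \<notin> Poly_Mapping.keys a \<or> j \<notin> Poly_Mapping.keys b" for i j
    using that by (auto simp: in_keys_iff)
  have "block_bracket l a b = (\<Sum>i\<in>Poly_Mapping.keys a. \<Sum>j\<in>B. ?t i j)"
    unfolding block_bracket_def
    by (intro sum.cong refl sum.mono_neutral_left assms) (use z in blast)
  also have "\<dots> = (\<Sum>i\<in>A. \<Sum>j\<in>B. ?t i j)"
    by (intro sum.mono_neutral_left assms ballI sum.neutral) (use z in blast)
  finally show ?thesis .
qed

lemma block_bracket_J:
  "block_bracket l (J i) (J j) =
     block_scale [:of_nat (i + j + 2) * l, of_nat (i + 1):] (J (i + j))"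
  unfolding block_bracket_def by (simp add: J_def pcompose_1)

lemma block_bracket_add_left:
  "block_bracket l (a + a') b = block_bracket l a b + block_bracket l a' b"
proof -
  interpret Modules.module block_scale by (rule module_block_scale)
  let ?A = "Poly_Mapping.keys a \<union> Poly_Mapping.keys a'" and ?B = "Poly_Mapping.keys b"
  have pc: "[:x + y:] = [:x:] + [:y:]" for x y :: complex by simp
  have A: "finite ?A" "finite ?B" by auto
  note s = block_bracket_superset[OF A _ order_refl, of _ l]
  have k: "Poly_Mapping.keys (a + a') \<subseteq> ?A" "Poly_Mapping.keys a \<subseteq> ?A" "Poly_Mapping.keys a' \<subseteq> ?A"
    by (simp_all add: Poly_Mapping.keys_add)
  show ?thesis
    unfolding s[OF k(1)] s[OF k(2)] s[OF k(3)]
    by (simp only: lookup_add poly_add pc distrib_right scale_left_distrib sum.distrib)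
qed

lemma block_bracket_add_right:
  "block_bracket l a (b + b') = block_bracket l a b + block_bracket l a b'"
proof -
  interpret Modules.module block_scale by (rule module_block_scale)
  let ?A = "Poly_Mapping.keys a" and ?B = "Poly_Mapping.keys b \<union> Poly_Mapping.keys b'"
  have A: "finite ?A" "finite ?B" by auto
  note s = block_bracket_superset[OF A order_refl, of _ l]
  have k: "Poly_Mapping.keys (b + b') \<subseteq> ?B" "Poly_Mapping.keys b \<subseteq> ?B" "Poly_Mapping.keys b' \<subseteq> ?B"
    by (simp_all add: Poly_Mapping.keys_add)
  show ?thesis
    unfolding s[OF k(1)] s[OF k(2)] s[OF k(3)]
    by (simp only: lookup_add pcompose_add distrib_left distrib_right scale_left_distrib sum.distrib)
qed

lemma block_bracket_scale_left:
  "block_bracket l (block_scale p a) b = block_scale [:poly p (- l):] (block_bracket l a b)"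
proof -
  interpret Modules.module block_scale by (rule module_block_scale)
  have k: "Poly_Mapping.keys (block_scale p a) \<subseteq> Poly_Mapping.keys a"
    by (auto simp: in_keys_iff lookup_block_scale)
  have pc: "[:x * y:] = [:x:] * [:y:]" for x y :: complex by simp
  show ?thesis
    unfolding block_bracket_superset[OF finite_keys finite_keys k order_refl]
    unfolding block_bracket_def
    by (simp only: lookup_block_scale poly_mult pc scale_sum_right scale_scale mult.assoc)
qed

lemma block_bracket_scale_right:
  "block_bracket l a (block_scale p b) = block_scale (pcompose p [:l, 1:]) (block_bracket l a b)"
proof -
  interpret Modules.module block_scale by (rule module_block_scale)
  have k: "Poly_Mapping.keys (block_scale p b) \<subseteq> Poly_Mapping.keys b"
    by (auto simp: in_keys_iff lookup_block_scale)
  show ?thesis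
    unfolding block_bracket_superset[OF finite_keys finite_keys order_refl k]
    unfolding block_bracket_def
    by (simp only: lookup_block_scale pcompose_mult scale_sum_right scale_scale mult_ac)
qed

section \<open>Modules over the Block type algebra\<close>

text \<open>
  The one-dimensional \<open>\<complex>[\<partial>]\<close>-module on which \<open>\<partial>\<close> is multiplication by \<open>a\<close>; with the zero
  action this is the trivial module for \<open>a = 0\<close> and \<open>\<complex>\<^sub>a\<close> for \<open>a \<noteq> 0\<close>.
\<close>

definition one_dim_scale :: "complex \<Rightarrow> complex poly \<Rightarrow> complex \<Rightarrow> complex" where
  "one_dim_scale a p z = poly p a * z"

definition zero_act :: "complex \<Rightarrow> block \<Rightarrow> complex \<Rightarrow> complex" where
  "zero_act l b z = 0"

text \<open>
  The module \<open>M\<^bsub>\<Delta>,\<alpha>\<^esub>\<close> is \<open>complex poly\<close> acting on itself by multiplication, with \<open>v = 1\<close>.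
  Sesquilinearity forces
  \<open>(f(\<partial>)J\<^sub>0)\<^sub>\<lambda> (g(\<partial>)v) = f(-\<lambda>) g(\<partial>+\<lambda>) (\<partial> + \<alpha> + \<Delta>\<lambda>) v\<close>.
\<close>

definition M_scale :: "complex poly \<Rightarrow> complex poly \<Rightarrow> complex poly" where
  "M_scale p g = p * g"

definition M_act :: "complex \<Rightarrow> complex \<Rightarrow> complex \<Rightarrow> block \<Rightarrow> complex poly \<Rightarrow> complex poly" where
  "M_act \<Delta> \<alpha> l b g =
     [:poly (Poly_Mapping.lookup b 0) (- l):] * pcompose g [:l, 1:] * [:\<alpha> + \<Delta> * l, 1:]"

lemma module_one_dim_scale: "Modules.module (one_dim_scale a)"
  by unfold_locales (auto simp: one_dim_scale_def algebra_simps)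

lemma module_M_scale: "Modules.module M_scale"
  by unfold_locales (auto simp: M_scale_def algebra_simps)

lemma M_act_J: "M_act \<Delta> \<alpha> l (J i) 1 = (if i = 0 then [:\<alpha> + \<Delta> * l, 1:] else 0)"
  by (simp add: M_act_def J_def lookup_single when_def pcompose_1)

lemma M_act_scale:
  "M_act \<Delta> \<alpha> l (block_scale p b) g = M_scale [:poly p (- l):] (M_act \<Delta> \<alpha> l b g)"
  "M_act \<Delta> \<alpha> l b (M_scale p g) = M_scale (pcompose p [:l, 1:]) (M_act \<Delta> \<alpha> l b g)"
proof -
  have pc: "[:x * y:] = [:x:] * [:y:]" for x y :: complex by simp
  show "M_act \<Delta> \<alpha> l (block_scale p b) g = M_scale [:poly p (- l):] (M_act \<Delta> \<alpha> l b g)"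
    by (simp only: M_act_def M_scale_def lookup_block_scale poly_mult pc mult.assoc)
  show "M_act \<Delta> \<alpha> l b (M_scale p g) = M_scale (pcompose p [:l, 1:]) (M_act \<Delta> \<alpha> l b g)"
    by (simp only: M_act_def M_scale_def pcompose_mult mult_ac)
qed

end

theory Submission
  imports Defs
begin

text \<open>
  The chain complex is controlled by Cartan calculus: for \<open>x\<close> in the algebra and a complex number \<open>\<lambda>\<close>, the
  contraction \<open>\<iota>\<close> with \<open>(x, \<lambda>)\<close> and the Lie derivative \<open>L\<close> along \<open>(x, \<lambda>)\<close> satisfy \<open>\<iota>d + d\<iota> = L\<close>.
  Read as a recursion on the number of arguments, this formula determines \<open>d\<close>, and \<open>d\<^sup>2 = 0\<close>, the skew-symmetry
  and the sesquilinearity of \<open>d\<gamma>\<close> all follow from it by induction.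

  For \<open>x = J\<^sub>0\<close> and \<open>\<lambda> = 0\<close> one has \<open>[J\<^sub>0 \<^sub>\<lambda> y] = \<partial>y\<close>, so \<open>L\<close> is multiplication by \<open>\<Sum>\<lambda>\<^sub>i\<close> plus the action of
  \<open>J\<^sub>0\<close> on the module. On \<open>\<complex>\<^sub>a\<close> and \<open>M\<^bsub>\<Delta>,\<alpha>\<^esub>\<close> this is \<open>\<partial> - a\<close> and \<open>\<partial> + \<alpha>\<close>, which are the invertible scalars
  \<open>-a\<close> and \<open>\<alpha>\<close> on the reduced complex, so the reduced cohomology vanishes.

  For the trivial module, the same homotopy shows that \<open>(\<Sum>\<lambda>\<^sub>i)\<gamma>\<close> is the coboundary of an explicit cochain
  for every cocycle \<open>\<gamma>\<close>, and in degree two this cochain is divisible by \<open>\<lambda>\<close>. A reduced 2-cochain is the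
  family of polynomials \<open>\<phi>\<^sub>i\<^sub>j(\<lambda>) = \<gamma>\<^bsub>\<lambda>,-\<lambda>\<^esub>(J\<^sub>i, J\<^sub>j)\<close>. The cocycle equation forces \<open>\<phi>\<^sub>0\<^sub>k\<close> to be linear up to
  a multiple of \<open>\<lambda>\<^sup>3\<close> that occurs only for \<open>k = 0\<close>; after subtracting a coboundary and a multiple of the
  Virasoro cocycle, \<open>\<phi>\<^sub>0\<^sub>k = 0\<close> for all \<open>k\<close>, and then the cocycle equation gives \<open>\<phi> = 0\<close>.
\<close>

section \<open>Dimension of quotient spaces\<close>

text \<open>With trivial coefficients, a polynomial that vanishes on the hyperplane where the
  variables sum to zero is divisible by their sum. In positive degree a reduced cochain is therefore
  its restriction to that hyperplane, and the reduced cocycle condition becomes an equation between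
  functions of complex numbers. For the trivial module the scalar in the homotopy is 0, so the
  contraction with \<open>J 0\<close> says nothing about the reduced complex; this is why degrees
  one and two need explicit computation. On the basic complex it still expresses the sum of the
  variables times \<gamma> as d\<psi>, and \<psi> is itself divisible by its variable because at
  total parameter 0 the bracket of \<open>J 0\<close> and \<open>J j\<close> has the nonzero
  coefficient (j + 2)\<lambda>; the sum can then be cancelled. The power t^(k+3) survives only for k
  = 0, where 4 * 2^3 = 3^3 + 5. The resulting Virasoro cocycle is not closed in the basic complex:
  its coboundary is the sum of the variables times a Vandermonde product, which vanishes only after
  reduction.\<close>

lemma vectorspace_class_ringI:
  fixes V :: "(complex, 'v) module"
  assumes "module class_ring V"
  shows "vectorspace class_ring V"
  using assms class_field by (simp add: vectorspace_def)

locale vs_quotient =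
  vectorspace "class_ring :: complex ring" V for V :: "(complex, 'v) module" +
  fixes W :: "'v set"
  assumes sub: "submodule class_ring W V"
begin

lemma W_carrier: "x \<in> W \<Longrightarrow> x \<in> carrier V"
  using submodule.subset[OF sub] by auto

lemma W_zero: "\<zero>\<^bsub>V\<^esub> \<in> W"
  using submodule.zero_closed[OF sub] .

lemma W_add: "x \<in> W \<Longrightarrow> y \<in> W \<Longrightarrow> x \<oplus>\<^bsub>V\<^esub> y \<in> W"
  using submodule.m_closed[OF sub] .

lemma W_smult: "x \<in> W \<Longrightarrow> c \<odot>\<^bsub>V\<^esub> x \<in> W"
  using submodule.smult_closed[OF sub] by simp

lemma W_neg: "x \<in> W \<Longrightarrow> \<ominus>\<^bsub>V\<^esub> x \<in> W"
  using W_smult W_carrier smult_minus_1 by metis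

lemma smult_closed': "x \<in> carrier V \<Longrightarrow> c \<odot>\<^bsub>V\<^esub> x \<in> carrier V"
  by (rule smult_closed) auto

lemma abelian_subgroup_W: "abelian_subgroup W V"
proof (rule abelian_subgroupI3)
  show "additive_subgroup W V"
  proof (rule additive_subgroupI, rule M.add.subgroupI)
    show "W \<subseteq> carrier V" using W_carrier by auto
    show "W \<noteq> {}" using W_zero by auto
    show "\<ominus>\<^bsub>V\<^esub> x \<in> W" if "x \<in> W" for x
      using W_neg[OF that] .
    show "x \<oplus>\<^bsub>V\<^esub> y \<in> W" if "x \<in> W" "y \<in> W" for x y
      using W_add that by auto
  qed
  show "abelian_group V" by (rule M.abelian_group_axioms)
qed

sublocale S: abelian_subgroup W V by (rule abelian_subgroup_W)

lemma coset_eq_W_iff: "x \<in> carrier V \<Longrightarrow> W +>\<^bsub>V\<^esub> x = W \<longleftrightarrow> x \<in> W"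
  using S.a_rcos_const S.a_rcos_self by blast

lemma carrier_quot_space: "carrier (quot_space V W) = (\<lambda>x. W +>\<^bsub>V\<^esub> x) ` carrier V"
  by (auto simp: quot_space_def A_RCOSETS_def')

lemma coset_add:
  "x \<in> carrier V \<Longrightarrow> y \<in> carrier V \<Longrightarrow>
    (W +>\<^bsub>V\<^esub> x) \<oplus>\<^bsub>quot_space V W\<^esub> (W +>\<^bsub>V\<^esub> y) = W +>\<^bsub>V\<^esub> (x \<oplus>\<^bsub>V\<^esub> y)"
  by (simp add: quot_space_def S.a_rcos_sum)

lemma mem_coset_iff: "x' \<in> W +>\<^bsub>V\<^esub> x \<longleftrightarrow> (\<exists>w\<in>W. x' = w \<oplus>\<^bsub>V\<^esub> x)"
  by (auto simp: a_r_coset_def')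

text \<open>Scalar multiplication in \<open>quot_space\<close> and the map \<open>quot_map\<close>
  are unions over all representatives, with no representative chosen. Independence of the
  representative collapses such a union to one coset, as \<open>W\<close> is nonempty.\<close>

lemma UN_coset_const:
  assumes x: "x \<in> carrier V" and f: "\<And>w. w \<in> W \<Longrightarrow> f (w \<oplus>\<^bsub>V\<^esub> x) = X"
  shows "(\<Union>x'\<in>W +>\<^bsub>V\<^esub> x. f x') = X"
proof -
  have "(\<Union>x'\<in>W +>\<^bsub>V\<^esub> x. f x') = (\<Union>w\<in>W. f (w \<oplus>\<^bsub>V\<^esub> x))" by (auto simp: a_r_coset_def')
  also have "\<dots> = (\<Union>w\<in>W. X)" using f by simp
  also have "\<dots> = X" using W_zero by blast
  finally show ?thesis .
qed

lemma coset_smult: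
  assumes x: "x \<in> carrier V"
  shows "c \<odot>\<^bsub>quot_space V W\<^esub> (W +>\<^bsub>V\<^esub> x) = W +>\<^bsub>V\<^esub> (c \<odot>\<^bsub>V\<^esub> x)"
proof -
  have "(\<Union>x'\<in>W +>\<^bsub>V\<^esub> x. W +>\<^bsub>V\<^esub> (c \<odot>\<^bsub>V\<^esub> x')) = W +>\<^bsub>V\<^esub> (c \<odot>\<^bsub>V\<^esub> x)"
  proof (rule UN_coset_const[OF x])
    fix w assume w: "w \<in> W"
    have "c \<odot>\<^bsub>V\<^esub> (w \<oplus>\<^bsub>V\<^esub> x) = c \<odot>\<^bsub>V\<^esub> w \<oplus>\<^bsub>V\<^esub> c \<odot>\<^bsub>V\<^esub> x"
      using w x W_carrier by (intro smult_r_distr) auto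
    then have "c \<odot>\<^bsub>V\<^esub> (w \<oplus>\<^bsub>V\<^esub> x) \<in> W +>\<^bsub>V\<^esub> (c \<odot>\<^bsub>V\<^esub> x)"
      using W_smult[OF w] by (auto simp: mem_coset_iff)
    then show "W +>\<^bsub>V\<^esub> (c \<odot>\<^bsub>V\<^esub> (w \<oplus>\<^bsub>V\<^esub> x)) = W +>\<^bsub>V\<^esub> (c \<odot>\<^bsub>V\<^esub> x)"
      using S.a_repr_independence' smult_closed'[OF x] by metis
  qed
  then show ?thesis by (simp add: quot_space_def)
qed

lemma zero_quot_space: "\<zero>\<^bsub>quot_space V W\<^esub> = W"
  by (simp add: quot_space_def)

lemma coset_zero: "W +>\<^bsub>V\<^esub> \<zero>\<^bsub>V\<^esub> = W"
  using coset_eq_W_iff W_zero by auto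

lemma vectorspace_quot_space: "vectorspace class_ring (quot_space V W)"
proof (rule vectorspace_class_ringI, rule module_criteria)
  let ?Q = "quot_space V W"
  note s = carrier_quot_space coset_add coset_smult zero_quot_space smult_closed'
  show "cring (class_ring :: complex ring)" by (rule R.is_cring)
  show "\<zero>\<^bsub>?Q\<^esub> \<in> carrier ?Q"
    using coset_zero by (auto simp: s intro!: image_eqI[of _ _ "\<zero>\<^bsub>V\<^esub>"])
  show "\<forall>v\<in>carrier ?Q. \<exists>nv\<in>carrier ?Q. v \<oplus>\<^bsub>?Q\<^esub> nv = \<zero>\<^bsub>?Q\<^esub>"
  proof
    fix v assume "v \<in> carrier ?Q"
    then obtain x where x: "x \<in> carrier V" "v = W +>\<^bsub>V\<^esub> x" by (auto simp: s)
    then have "v \<oplus>\<^bsub>?Q\<^esub> (W +>\<^bsub>V\<^esub> (\<ominus>\<^bsub>V\<^esub> x)) = \<zero>\<^bsub>?Q\<^esub>"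
      by (simp add: s M.r_neg coset_zero)
    with x show "\<exists>nv\<in>carrier ?Q. v \<oplus>\<^bsub>?Q\<^esub> nv = \<zero>\<^bsub>?Q\<^esub>" by (auto simp: s)
  qed
  show "\<forall>v w. v \<in> carrier ?Q \<and> w \<in> carrier ?Q \<longrightarrow> v \<oplus>\<^bsub>?Q\<^esub> w = w \<oplus>\<^bsub>?Q\<^esub> v"
    by (auto simp: s M.a_comm)
  show "\<forall>v w x. v \<in> carrier ?Q \<and> w \<in> carrier ?Q \<and> x \<in> carrier ?Q \<longrightarrow>
      v \<oplus>\<^bsub>?Q\<^esub> w \<oplus>\<^bsub>?Q\<^esub> x = v \<oplus>\<^bsub>?Q\<^esub> (w \<oplus>\<^bsub>?Q\<^esub> x)"
    by (auto simp: s M.a_assoc)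
  show "\<forall>v\<in>carrier ?Q. v \<oplus>\<^bsub>?Q\<^esub> \<zero>\<^bsub>?Q\<^esub> = v"
  proof
    fix v assume "v \<in> carrier ?Q"
    then obtain x where x: "x \<in> carrier V" "v = W +>\<^bsub>V\<^esub> x" by (auto simp: s)
    then have "v \<oplus>\<^bsub>?Q\<^esub> (W +>\<^bsub>V\<^esub> \<zero>\<^bsub>V\<^esub>) = v" by (simp add: s)
    then show "v \<oplus>\<^bsub>?Q\<^esub> \<zero>\<^bsub>?Q\<^esub> = v" by (simp add: coset_zero s)
  qed
qed (auto simp: carrier_quot_space coset_add coset_smult smult_closed' 
    smult_l_distr[simplified] smult_r_distr[simplified] smult_assoc1[simplified] smult_one[simplified])

lemma has_dim_quot_space_0I:
  assumes "carrier V \<subseteq> W"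
  shows "has_dim (quot_space V W) 0"
proof -
  interpret Q: vectorspace "class_ring :: complex ring" "quot_space V W"
    by (rule vectorspace_quot_space)
  have c: "carrier (quot_space V W) = {\<zero>\<^bsub>quot_space V W\<^esub>}"
    using assms coset_eq_W_iff W_zero M.zero_closed
    by (auto simp: carrier_quot_space zero_quot_space intro!: image_eqI[of _ _ "\<zero>\<^bsub>V\<^esub>"])
  have "Q.span {} = carrier (quot_space V W)"
    using c by (auto simp: Q.span_def Q.lincomb_def)
  then have b: "Q.basis {}"
    by (auto simp: Q.basis_def Q.lin_dep_def)
  then have "Q.fin_dim" by (auto simp: Q.fin_dim_def Q.basis_def)
  with Q.dim_basis[OF _ b] show ?thesis
    by (simp add: has_dim_def Q.vectorspace_axioms)
qed

lemma has_dim_quot_space_1I: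
  assumes z: "z \<in> carrier V" "z \<notin> W"
    and gen: "\<And>x. x \<in> carrier V \<Longrightarrow> \<exists>c. \<exists>w\<in>W. x = w \<oplus>\<^bsub>V\<^esub> c \<odot>\<^bsub>V\<^esub> z"
  shows "has_dim (quot_space V W) 1"
proof -
  interpret Q: vectorspace "class_ring :: complex ring" "quot_space V W"
    by (rule vectorspace_quot_space)
  let ?z = "W +>\<^bsub>V\<^esub> z"
  have zc: "?z \<in> carrier (quot_space V W)" using z by (simp add: carrier_quot_space)
  have z0: "?z \<noteq> \<zero>\<^bsub>quot_space V W\<^esub>" using z coset_eq_W_iff by (simp add: zero_quot_space)
  have "carrier (quot_space V W) \<subseteq> Q.span {?z}"
  proof
    fix X assume "X \<in> carrier (quot_space V W)"
    then obtain x where x: "x \<in> carrier V" "X = W +>\<^bsub>V\<^esub> x" by (auto simp: carrier_quot_space)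
    from gen[OF x(1)] obtain c w where w: "w \<in> W" "x = w \<oplus>\<^bsub>V\<^esub> c \<odot>\<^bsub>V\<^esub> z" by auto
    then have "x \<in> W +>\<^bsub>V\<^esub> (c \<odot>\<^bsub>V\<^esub> z)" by (auto simp: mem_coset_iff)
    then have "X = W +>\<^bsub>V\<^esub> (c \<odot>\<^bsub>V\<^esub> z)"
      using S.a_repr_independence' smult_closed'[OF z(1)] x by metis
    then have "X = c \<odot>\<^bsub>quot_space V W\<^esub> ?z" using z by (simp add: coset_smult)
    also have "\<dots> = Q.lincomb (\<lambda>_. c) {?z}"
      using zc by (simp add: Q.lincomb_def)
    finally show "X \<in> Q.span {?z}" unfolding Q.span_def by auto
  qed
  then have sp: "Q.span {?z} = carrier (quot_space V W)"
    using Q.span_is_subset2[of "{?z}"] zc by auto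
  have fd: "Q.fin_dim" unfolding Q.fin_dim_def using sp zc by (intro exI[of _ "{?z}"]) auto
  have li: "Q.lin_indpt {?z}"
  proof
    assume "Q.lin_dep {?z}"
    then obtain A a v where A: "A \<subseteq> {?z}" "Q.lincomb a A = \<zero>\<^bsub>quot_space V W\<^esub>" "v \<in> A" "a v \<noteq> 0"
      by (auto simp: Q.lin_dep_def)
    then have "A = {?z}" "v = ?z" by auto
    with A zc have az: "a ?z \<odot>\<^bsub>quot_space V W\<^esub> ?z = \<zero>\<^bsub>quot_space V W\<^esub>"
      by (simp add: Q.lincomb_def)
    have "?z = (inverse (a ?z) * a ?z) \<odot>\<^bsub>quot_space V W\<^esub> ?z"
      using A \<open>v = ?z\<close> zc Q.smult_one[of ?z] by simp
    also have "\<dots> = inverse (a ?z) \<odot>\<^bsub>quot_space V W\<^esub> \<zero>\<^bsub>quot_space V W\<^esub>"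
      using Q.smult_assoc1[of "inverse (a ?z)" "a ?z" ?z] zc az by simp
    also have "\<dots> = \<zero>\<^bsub>quot_space V W\<^esub>"
      by (rule Q.smult_r_null) simp
    finally show False using z0 by simp
  qed
  have "Q.basis {?z}" using sp zc li by (simp add: Q.basis_def)
  with Q.dim_basis[of "{?z}"] fd show ?thesis
    by (simp add: has_dim_def Q.vectorspace_axioms)
qed

end

section \<open>Cohomology of complexes and of quotient complexes\<close>

locale vs_complex =
  fixes C :: "nat \<Rightarrow> (complex, 'v) module" and d :: "nat \<Rightarrow> 'v \<Rightarrow> 'v"
  assumes vs: "vectorspace class_ring (C n)"
    and d_closed: "x \<in> carrier (C n) \<Longrightarrow> d n x \<in> carrier (C (Suc n))"
    and d_add: "x \<in> carrier (C n) \<Longrightarrow> y \<in> carrier (C n) \<Longrightarrow>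
      d n (x \<oplus>\<^bsub>C n\<^esub> y) = d n x \<oplus>\<^bsub>C (Suc n)\<^esub> d n y"
    and d_smult: "x \<in> carrier (C n) \<Longrightarrow> d n (c \<odot>\<^bsub>C n\<^esub> x) = c \<odot>\<^bsub>C (Suc n)\<^esub> d n x"
    and d_d: "x \<in> carrier (C n) \<Longrightarrow> d (Suc n) (d n x) = \<zero>\<^bsub>C (Suc (Suc n))\<^esub>"
begin

sublocale C: vectorspace "class_ring :: complex ring" "C n" for n by (rule vs)

lemma C_smult_closed: "x \<in> carrier (C n) \<Longrightarrow> c \<odot>\<^bsub>C n\<^esub> x \<in> carrier (C n)"
  by (rule C.smult_closed) auto

lemma d_zero: "d n \<zero>\<^bsub>C n\<^esub> = \<zero>\<^bsub>C (Suc n)\<^esub>"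
  using d_smult[of "\<zero>\<^bsub>C n\<^esub>" n 0] C.smult_l_null[of "\<zero>\<^bsub>C n\<^esub>" n]
    C.smult_l_null[of "d n \<zero>\<^bsub>C n\<^esub>" "Suc n"] d_closed[of "\<zero>\<^bsub>C n\<^esub>" n] by simp

lemma submodule_cocycles: "submodule class_ring (cocycles C d q) (C q)"
proof
  show "x \<oplus>\<^bsub>C q\<^esub> y \<in> cocycles C d q" if "x \<in> cocycles C d q" "y \<in> cocycles C d q" for x y
    using that by (auto simp: cocycles_def d_add)
  show "c \<odot>\<^bsub>C q\<^esub> x \<in> cocycles C d q"
    if "c \<in> carrier (class_ring :: complex ring)" "x \<in> cocycles C d q" for x c
    using that C.smult_r_null[of c "Suc q"] by (auto simp: cocycles_def d_smult C_smult_closed)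
qed (auto simp: cocycles_def d_zero)

lemma coboundaries_subset_cocycles: "coboundaries C d q \<subseteq> cocycles C d q"
  by (cases q) (auto simp: cocycles_def d_zero d_closed d_d)

lemma coboundaries_closed:
  "\<zero>\<^bsub>C q\<^esub> \<in> coboundaries C d q"
  "x \<in> coboundaries C d q \<Longrightarrow> y \<in> coboundaries C d q \<Longrightarrow> x \<oplus>\<^bsub>C q\<^esub> y \<in> coboundaries C d q"
  "x \<in> coboundaries C d q \<Longrightarrow> c \<odot>\<^bsub>C q\<^esub> x \<in> coboundaries C d q"
proof -
  show "\<zero>\<^bsub>C q\<^esub> \<in> coboundaries C d q"
    by (cases q) (auto intro!: image_eqI[where x = "\<zero>\<^bsub>C _\<^esub>"] simp: d_zero)
  show "x \<in> coboundaries C d q \<Longrightarrow> y \<in> coboundaries C d q \<Longrightarrow> x \<oplus>\<^bsub>C q\<^esub> y \<in> coboundaries C d q"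
    by (cases q) (auto simp: d_add[symmetric])
  show "x \<in> coboundaries C d q \<Longrightarrow> c \<odot>\<^bsub>C q\<^esub> x \<in> coboundaries C d q"
    using C.smult_r_null[of c "q"] by (cases q) (auto simp: d_smult[symmetric] C_smult_closed)
qed

lemma vs_quotient_cocycles:
  "vs_quotient ((C q)\<lparr>carrier := cocycles C d q\<rparr>) (coboundaries C d q)"
proof -
  have m: "module class_ring ((C q)\<lparr>carrier := cocycles C d q\<rparr>)"
    by (rule C.submodule_is_module[OF submodule_cocycles])
  moreover have "submodule class_ring (coboundaries C d q) ((C q)\<lparr>carrier := cocycles C d q\<rparr>)"
    by (intro submodule.intro m) (use coboundaries_subset_cocycles coboundaries_closed in auto)
  ultimately show ?thesis
    using vectorspace_class_ringI by (auto simp: vs_quotient_def vs_quotient_axioms_def)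
qed

lemma has_dim_cohomology_0I:
  assumes "cocycles C d q \<subseteq> coboundaries C d q"
  shows "has_dim (cohomology C d q) 0"
proof -
  interpret vs_quotient "(C q)\<lparr>carrier := cocycles C d q\<rparr>" "coboundaries C d q"
    by (rule vs_quotient_cocycles)
  show ?thesis unfolding cohomology_def
    by (rule has_dim_quot_space_0I) (use assms in simp)
qed

lemma has_dim_cohomology_1I:
  assumes "z \<in> cocycles C d q" "z \<notin> coboundaries C d q"
    and "\<And>x. x \<in> cocycles C d q \<Longrightarrow> \<exists>c. \<exists>w\<in>coboundaries C d q. x = w \<oplus>\<^bsub>C q\<^esub> c \<odot>\<^bsub>C q\<^esub> z"
  shows "has_dim (cohomology C d q) 1"
proof -
  interpret vs_quotient "(C q)\<lparr>carrier := cocycles C d q\<rparr>" "coboundaries C d q"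
    by (rule vs_quotient_cocycles)
  show ?thesis unfolding cohomology_def
    by (rule has_dim_quot_space_1I[of z]) (use assms in auto)
qed

end

locale vs_quotient_complex = vs_complex C d for C :: "nat \<Rightarrow> (complex, 'v) module" and d +
  fixes W :: "nat \<Rightarrow> 'v set"
  assumes W_sub: "submodule class_ring (W n) (C n)"
    and d_W: "x \<in> W n \<Longrightarrow> d n x \<in> W (Suc n)"
begin

abbreviation "Q n \<equiv> quot_space (C n) (W n)"
abbreviation "dQ n \<equiv> quot_map (C (Suc n)) (W (Suc n)) (d n)"
abbreviation "cls n x \<equiv> W n +>\<^bsub>C n\<^esub> x"

sublocale W: vs_quotient "C n" "W n" for n
  using W_sub vs by (auto simp: vs_quotient_def vs_quotient_axioms_def)

lemma quot_map_cls:
  assumes x: "x \<in> carrier (C n)"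
  shows "dQ n (cls n x) = cls (Suc n) (d n x)"
  unfolding quot_map_def
proof (rule W.UN_coset_const[OF x])
  fix w assume w: "w \<in> W n"
  have "d n (w \<oplus>\<^bsub>C n\<^esub> x) = d n w \<oplus>\<^bsub>C (Suc n)\<^esub> d n x"
    using w x W.W_carrier by (simp add: d_add)
  then have "d n (w \<oplus>\<^bsub>C n\<^esub> x) \<in> cls (Suc n) (d n x)"
    using d_W[OF w] by (auto simp: W.mem_coset_iff)
  then show "cls (Suc n) (d n (w \<oplus>\<^bsub>C n\<^esub> x)) = cls (Suc n) (d n x)"
    using W.S.a_repr_independence' d_closed[OF x] by metis
qed

sublocale Q: vs_complex Q dQ
proof (rule vs_complex.intro)
  note s = W.carrier_quot_space W.coset_add W.coset_smult W.zero_quot_space C_smult_closed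
    quot_map_cls d_closed d_add d_smult
  fix n
  show "vectorspace class_ring (Q n)" by (rule W.vectorspace_quot_space)
  show "dQ n x \<in> carrier (Q (Suc n))" if "x \<in> carrier (Q n)" for x
    using that by (auto simp: s)
  show "dQ n (x \<oplus>\<^bsub>Q n\<^esub> y) = dQ n x \<oplus>\<^bsub>Q (Suc n)\<^esub> dQ n y"
    if "x \<in> carrier (Q n)" "y \<in> carrier (Q n)" for x y
    using that by (auto simp: s)
  show "dQ n (c \<odot>\<^bsub>Q n\<^esub> x) = c \<odot>\<^bsub>Q (Suc n)\<^esub> dQ n x" if "x \<in> carrier (Q n)" for x c
    using that by (auto simp: s)
  show "dQ (Suc n) (dQ n x) = \<zero>\<^bsub>Q (Suc (Suc n))\<^esub>" if "x \<in> carrier (Q n)" for x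
    using that by (auto simp: s d_d W.coset_zero)
qed

lemma cocycles_Q:
  "cocycles Q dQ q = {cls q x | x. x \<in> carrier (C q) \<and> d q x \<in> W (Suc q)}"
proof -
  have "dQ q (cls q x) = \<zero>\<^bsub>Q (Suc q)\<^esub> \<longleftrightarrow> d q x \<in> W (Suc q)" if "x \<in> carrier (C q)" for x
    using W.coset_eq_W_iff[OF d_closed[OF that]] quot_map_cls[OF that] W.zero_quot_space by simp
  then show ?thesis unfolding cocycles_def W.carrier_quot_space by blast
qed

lemma coboundaries_Q: "coboundaries Q dQ q = cls q ` coboundaries C d q"
proof (cases q)
  case 0
  then show ?thesis by (simp add: W.zero_quot_space W.coset_zero)
next
  case (Suc n)
  have "dQ n ` carrier (Q n) = (\<lambda>x. cls (Suc n) (d n x)) ` carrier (C n)"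
    unfolding W.carrier_quot_space image_image by (intro image_cong refl quot_map_cls)
  then show ?thesis using Suc by (simp add: image_image)
qed

lemma coboundaries_carrier: "b \<in> coboundaries C d q \<Longrightarrow> b \<in> carrier (C q)"
  using coboundaries_subset_cocycles by (auto simp: cocycles_def)

text \<open>Works with representatives only: x is a cocycle modulo \<open>W\<close> and has to be a
  coboundary modulo \<open>W\<close>. This and the one-dimensional analogue below keep cosets out of
  all later computations.\<close>

lemma has_dim_quotient_cohomology_0I:
  assumes "\<And>x. x \<in> carrier (C q) \<Longrightarrow> d q x \<in> W (Suc q) \<Longrightarrow>
    \<exists>w\<in>W q. \<exists>b\<in>coboundaries C d q. x = w \<oplus>\<^bsub>C q\<^esub> b"
  shows "has_dim (cohomology Q dQ q) 0"
proof (rule Q.has_dim_cohomology_0I, rule subsetI)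
  fix X assume "X \<in> cocycles Q dQ q"
  then obtain x where x: "x \<in> carrier (C q)" "d q x \<in> W (Suc q)" "X = cls q x"
    by (auto simp: cocycles_Q)
  with assms obtain w b where "w \<in> W q" "b \<in> coboundaries C d q" "x = w \<oplus>\<^bsub>C q\<^esub> b" by metis
  then have "X = cls q b"
    using x W.S.a_repr_independence'[of x q b] coboundaries_carrier W.mem_coset_iff by metis
  then show "X \<in> coboundaries Q dQ q" using \<open>b \<in> _\<close> by (simp add: coboundaries_Q)
qed

lemma has_dim_quotient_cohomology_1I:
  assumes z: "z \<in> carrier (C q)" "d q z \<in> W (Suc q)"
    and zb: "\<And>w b. w \<in> W q \<Longrightarrow> b \<in> coboundaries C d q \<Longrightarrow> z \<noteq> w \<oplus>\<^bsub>C q\<^esub> b"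
    and gen: "\<And>x. x \<in> carrier (C q) \<Longrightarrow> d q x \<in> W (Suc q) \<Longrightarrow>
      \<exists>c. \<exists>w\<in>W q. \<exists>b\<in>coboundaries C d q. x = w \<oplus>\<^bsub>C q\<^esub> (b \<oplus>\<^bsub>C q\<^esub> c \<odot>\<^bsub>C q\<^esub> z)"
  shows "has_dim (cohomology Q dQ q) 1"
proof (rule Q.has_dim_cohomology_1I)
  show "cls q z \<in> cocycles Q dQ q" using z by (auto simp: cocycles_Q)
  show "cls q z \<notin> coboundaries Q dQ q"
  proof
    assume "cls q z \<in> coboundaries Q dQ q"
    then obtain b where b: "b \<in> coboundaries C d q" "cls q z = cls q b" by (auto simp: coboundaries_Q)
    then have "z \<in> cls q b" using W.S.a_rcos_self[OF z(1)] by simp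
    with zb b show False by (auto simp: W.mem_coset_iff)
  qed
next
  fix X assume "X \<in> cocycles Q dQ q"
  then obtain x where x: "x \<in> carrier (C q)" "d q x \<in> W (Suc q)" "X = cls q x"
    by (auto simp: cocycles_Q)
  with gen obtain c w b where wb: "w \<in> W q" "b \<in> coboundaries C d q"
    "x = w \<oplus>\<^bsub>C q\<^esub> (b \<oplus>\<^bsub>C q\<^esub> c \<odot>\<^bsub>C q\<^esub> z)" by metis
  have "X = cls q (b \<oplus>\<^bsub>C q\<^esub> c \<odot>\<^bsub>C q\<^esub> z)"
    using x wb W.S.a_repr_independence'[of x q "b \<oplus>\<^bsub>C q\<^esub> c \<odot>\<^bsub>C q\<^esub> z"] coboundaries_carrier
      W.mem_coset_iff C_smult_closed z C.M.a_closed by metis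
  also have "\<dots> = cls q b \<oplus>\<^bsub>Q q\<^esub> c \<odot>\<^bsub>Q q\<^esub> cls q z"
    using z wb coboundaries_carrier by (simp add: W.coset_add W.coset_smult C_smult_closed)
  finally show "\<exists>c. \<exists>w\<in>coboundaries Q dQ q. X = w \<oplus>\<^bsub>Q q\<^esub> c \<odot>\<^bsub>Q q\<^esub> cls q z"
    using wb by (auto simp: coboundaries_Q)
qed

end

section \<open>Polynomial functions\<close>

text \<open>Scalar polynomial functions given by closure rules. They let
  \<open>polynomial_fun\<close> be verified by introduction rules instead of by exhibiting exponents
  and coefficients.\<close>

inductive poly_expr :: "nat \<Rightarrow> (complex list \<Rightarrow> complex) \<Rightarrow> bool" for n where
  poly_expr_const: "poly_expr n (\<lambda>_. c)"
| poly_expr_nth: "i < n \<Longrightarrow> poly_expr n (\<lambda>ls. ls ! i)"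
| poly_expr_add: "poly_expr n p \<Longrightarrow> poly_expr n q \<Longrightarrow> poly_expr n (\<lambda>ls. p ls + q ls)"
| poly_expr_mult: "poly_expr n p \<Longrightarrow> poly_expr n q \<Longrightarrow> poly_expr n (\<lambda>ls. p ls * q ls)"

lemma poly_expr_sum:
  "(\<And>i. i \<in> A \<Longrightarrow> poly_expr n (p i)) \<Longrightarrow> poly_expr n (\<lambda>ls. \<Sum>i\<in>A. p i ls)"
  by (induction A rule: infinite_finite_induct) (auto intro: poly_expr_const poly_expr_add)

lemma poly_expr_prod:
  "(\<And>i. i \<in> A \<Longrightarrow> poly_expr n (p i)) \<Longrightarrow> poly_expr n (\<lambda>ls. \<Prod>i\<in>A. p i ls)"
  by (induction A rule: infinite_finite_induct) (auto intro: poly_expr_const poly_expr_mult)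

lemma poly_expr_power: "poly_expr n p \<Longrightarrow> poly_expr n (\<lambda>ls. p ls ^ k)"
  by (induction k) (auto intro: poly_expr_const poly_expr_mult)

lemma poly_expr_poly:
  assumes "poly_expr n p"
  shows "poly_expr n (\<lambda>ls. poly q (p ls))"
  by (induction q) (auto intro!: poly_expr_const poly_expr_mult poly_expr_add assms)

text \<open>Along a polynomial curve a function of several variables becomes a univariate
  polynomial, so that identities can be settled by counting roots or by comparing
  coefficients.\<close>

lemma poly_expr_line:
  assumes "poly_expr n p" "length qs = n"
  shows "\<exists>r. \<forall>x. p (map (\<lambda>q. poly q x) qs) = poly r x"
  using assms(1)
proof induction
  case (poly_expr_const c)
  show ?case by (rule exI[of _ "[:c:]"]) simp
next
  case (poly_expr_nth i)
  then show ?case using assms(2) by (intro exI[of _ "qs ! i"]) simp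
next
  case (poly_expr_add p q)
  then show ?case by (metis poly_add)
next
  case (poly_expr_mult p q)
  then show ?case by (metis poly_mult)
qed

locale cpoly_module = Modules.module s for s :: "complex poly \<Rightarrow> 'm::ab_group_add \<Rightarrow> 'm"
begin

lemma scale_pCons_mult: "s [:c * c':] v = s [:c:] (s [:c':] v)"
  by (simp add: mult.commute)

lemma scale_pCons_add: "s [:c + c':] v = s [:c:] v + s [:c':] v"
  by (simp flip: scale_left_distrib)

lemma scale_pCons_1: "s [:1:] v = v"
  by (metis one_pCons scale_one)

lemma scale_pCons_minus_1: "s [:- 1:] v = - v"
  using scale_minus_left[of "[:1:]" v] scale_pCons_1 by simp

lemma polynomial_fun_cong:
  "polynomial_fun s n f \<Longrightarrow> (\<And>ls. length ls = n \<Longrightarrow> f ls = g ls) \<Longrightarrow> polynomial_fun s n g"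
  unfolding polynomial_fun_def by metis

lemma polynomial_fun_0: "polynomial_fun s n (\<lambda>_. 0)"
  unfolding polynomial_fun_def by (rule exI[of _ "{}"]) auto

lemma polynomial_fun_const: "polynomial_fun s n (\<lambda>_. v)"
  unfolding polynomial_fun_def
  by (rule exI[of _ "{\<lambda>_. 0}"], rule exI[of _ "\<lambda>_. v"]) (simp add: scale_pCons_1)

lemma polynomial_fun_add:
  assumes "polynomial_fun s n f" "polynomial_fun s n g"
  shows "polynomial_fun s n (\<lambda>ls. f ls + g ls)"
proof -
  from assms(1) obtain E c where E: "finite E"
    "\<And>ls. length ls = n \<Longrightarrow> f ls = (\<Sum>e\<in>E. s [:\<Prod>i<n. (ls ! i) ^ (e i):] (c e))"
    unfolding polynomial_fun_def by auto
  from assms(2) obtain E' c' where E': "finite E'"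
    "\<And>ls. length ls = n \<Longrightarrow> g ls = (\<Sum>e\<in>E'. s [:\<Prod>i<n. (ls ! i) ^ (e i):] (c' e))"
    unfolding polynomial_fun_def by auto
  \<comment> \<open>An exponent may occur in both expansions, so each coefficient family is extended
    by 0 outside its own exponent set before adding.\<close>
  let ?c = "\<lambda>e. (if e \<in> E then c e else 0) + (if e \<in> E' then c' e else 0)"
  have "f ls + g ls = (\<Sum>e\<in>E \<union> E'. s [:\<Prod>i<n. (ls ! i) ^ (e i):] (?c e))"
    if "length ls = n" for ls
  proof -
    let ?m = "\<lambda>e. [:\<Prod>i<n. (ls ! i) ^ (e i):]"
    have "(\<Sum>e\<in>E \<union> E'. s (?m e) (?c e)) =
       (\<Sum>e\<in>E \<union> E'. s (?m e) (if e \<in> E then c e else 0)) +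
       (\<Sum>e\<in>E \<union> E'. s (?m e) (if e \<in> E' then c' e else 0))"
      by (simp only: scale_right_distrib sum.distrib)
    also have "(\<Sum>e\<in>E \<union> E'. s (?m e) (if e \<in> E then c e else 0)) = (\<Sum>e\<in>E. s (?m e) (c e))"
      using E(1) E'(1) by (intro sum.mono_neutral_cong_right) auto
    also have "(\<Sum>e\<in>E \<union> E'. s (?m e) (if e \<in> E' then c' e else 0)) = (\<Sum>e\<in>E'. s (?m e) (c' e))"
      using E(1) E'(1) by (intro sum.mono_neutral_cong_right) auto
    finally show ?thesis using E(2) E'(2) that by simp
  qed
  then show ?thesis unfolding polynomial_fun_def using E(1) E'(1)
    by (intro exI[of _ "E \<union> E'"] exI[of _ ?c]) simp
qed

lemma polynomial_fun_sum:
  "(\<And>i. i \<in> A \<Longrightarrow> polynomial_fun s n (f i)) \<Longrightarrow> polynomial_fun s n (\<lambda>ls. \<Sum>i\<in>A. f i ls)"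
  by (induction A rule: infinite_finite_induct) (auto intro: polynomial_fun_0 polynomial_fun_add)

lemma polynomial_fun_linear:
  assumes f: "polynomial_fun s n f"
    and add: "\<And>v w. T (v + w) = T v + T w" and scale: "\<And>c v. T (s [:c:] v) = s [:c:] (T v)"
  shows "polynomial_fun s n (\<lambda>ls. T (f ls))"
proof -
  from f obtain E c where E: "finite E"
    "\<And>ls. length ls = n \<Longrightarrow> f ls = (\<Sum>e\<in>E. s [:\<Prod>i<n. (ls ! i) ^ (e i):] (c e))"
    unfolding polynomial_fun_def by auto
  have T0: "T 0 = 0" using scale[of 0 0] by simp
  have "T (\<Sum>e\<in>E. g e) = (\<Sum>e\<in>E. T (g e))" for g :: "(nat \<Rightarrow> nat) \<Rightarrow> 'm"
    by (induction E rule: infinite_finite_induct) (auto simp: T0 add)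
  then have "T (f ls) = (\<Sum>e\<in>E. s [:\<Prod>i<n. (ls ! i) ^ (e i):] (T (c e)))"
    if "length ls = n" for ls
    using E(2)[OF that] by (simp add: scale)
  then show ?thesis unfolding polynomial_fun_def using E(1)
    by (intro exI[of _ E] exI[of _ "\<lambda>e. T (c e)"]) simp
qed

lemma polynomial_fun_scale_nth:
  assumes f: "polynomial_fun s n f" and k: "k < n"
  shows "polynomial_fun s n (\<lambda>ls. s [:ls ! k:] (f ls))"
proof -
  from f obtain E c where E: "finite E"
    "\<And>ls. length ls = n \<Longrightarrow> f ls = (\<Sum>e\<in>E. s [:\<Prod>i<n. (ls ! i) ^ (e i):] (c e))"
    unfolding polynomial_fun_def by auto
  let ?u = "\<lambda>e::nat \<Rightarrow> nat. e(k := Suc (e k))"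
  \<comment> \<open>The inverse of the exponent shift \<open>?u\<close>. Truncated subtraction is
    harmless, since on the image of \<open>?u\<close> the k-th exponent is positive.\<close>
  let ?c = "\<lambda>e. c (e(k := e k - 1))"
  have inj: "inj_on ?u E"
  proof (rule inj_onI)
    fix e e' :: "nat \<Rightarrow> nat"
    assume h: "?u e = ?u e'"
    have "e i = e' i" for i using fun_cong[OF h, of i] by (cases "i = k") auto
    then show "e = e'" by auto
  qed
  have "s [:ls ! k:] (f ls) = (\<Sum>e\<in>?u ` E. s [:\<Prod>i<n. (ls ! i) ^ (e i):] (?c e))"
    if l: "length ls = n" for ls
  proof -
    have p: "(\<Prod>i<n. (ls ! i) ^ (?u e i)) = ls ! k * (\<Prod>i<n. (ls ! i) ^ (e i))" for e
    proof -
      have "(\<Prod>i<n. (ls ! i) ^ (?u e i)) = ls ! k ^ Suc (e k) * (\<Prod>i\<in>{..<n}-{k}. (ls ! i) ^ (?u e i))"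
        using k by (subst prod.remove[of _ k]) auto
      also have "(\<Prod>i\<in>{..<n}-{k}. (ls ! i) ^ (?u e i)) = (\<Prod>i\<in>{..<n}-{k}. (ls ! i) ^ (e i))"
        by (intro prod.cong) auto
      also have "ls ! k ^ Suc (e k) * \<dots> = ls ! k * (\<Prod>i<n. (ls ! i) ^ (e i))"
        using k prod.remove[of "{..<n}" k "\<lambda>i. (ls ! i) ^ (e i)"] by auto
      finally show ?thesis .
    qed
    have "(\<Sum>e\<in>?u ` E. s [:\<Prod>i<n. (ls ! i) ^ (e i):] (?c e)) =
        (\<Sum>e\<in>E. s [:\<Prod>i<n. (ls ! i) ^ (?u e i):] (?c (?u e)))"
      by (simp add: sum.reindex[OF inj])
    also have "\<dots> = (\<Sum>e\<in>E. s [:ls ! k:] (s [:\<Prod>i<n. (ls ! i) ^ (e i):] (c e)))"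
      unfolding p scale_pCons_mult by simp
    also have "\<dots> = s [:ls ! k:] (f ls)"
      unfolding E(2)[OF l] scale_sum_right ..
    finally show ?thesis by simp
  qed
  then show ?thesis unfolding polynomial_fun_def using E(1)
    by (intro exI[of _ "?u ` E"] exI[of _ ?c]) simp
qed

lemma polynomial_fun_scale:
  assumes "poly_expr n p" "polynomial_fun s n f"
  shows "polynomial_fun s n (\<lambda>ls. s [:p ls:] (f ls))"
  using assms
proof (induction arbitrary: f)
  case (poly_expr_const c)
  show ?case
    by (rule polynomial_fun_linear[OF poly_expr_const]) (simp_all add: scale_right_distrib mult.commute)
next
  case (poly_expr_nth i)
  then show ?case by (simp add: polynomial_fun_scale_nth)
next
  case (poly_expr_add p q)
  then show ?case unfolding scale_pCons_add by (intro polynomial_fun_add) auto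
next
  case (poly_expr_mult p q)
  then show ?case unfolding scale_pCons_mult by blast
qed

lemma polynomial_fun_compose:
  assumes f: "polynomial_fun s m f"
    and g: "\<And>ls. length ls = n \<Longrightarrow> length (g ls) = m"
    and p: "\<And>i. i < m \<Longrightarrow> poly_expr n (p i)"
    and gp: "\<And>i ls. i < m \<Longrightarrow> length ls = n \<Longrightarrow> g ls ! i = p i ls"
  shows "polynomial_fun s n (\<lambda>ls. f (g ls))"
proof -
  from f obtain E c where E: "finite E"
    "\<And>ls. length ls = m \<Longrightarrow> f ls = (\<Sum>e\<in>E. s [:\<Prod>i<m. (ls ! i) ^ (e i):] (c e))"
    unfolding polynomial_fun_def by auto
  have "polynomial_fun s n (\<lambda>ls. \<Sum>e\<in>E. s [:\<Prod>i<m. (p i ls) ^ (e i):] (c e))"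
    by (intro polynomial_fun_sum polynomial_fun_scale polynomial_fun_const poly_expr_prod
        poly_expr_power p) auto
  then show ?thesis
    by (rule polynomial_fun_cong) (simp add: E(2) g gp)
qed

lemma polynomial_fun_scale_fixed:
  "polynomial_fun s n f \<Longrightarrow> polynomial_fun s n (\<lambda>ls. s q (f ls))"
  by (rule polynomial_fun_linear) (simp_all add: scale_right_distrib mult.commute)

text \<open>Horner's scheme: each step multiplies by \<partial> + p, which splits into the
  polynomial scalar p and the fixed linear operator \<partial>.\<close>

lemma polynomial_fun_pcompose:
  assumes "polynomial_fun s n f" "poly_expr n p"
  shows "polynomial_fun s n (\<lambda>ls. s (pcompose q [:p ls, 1:]) (f ls))"
proof (induction q)
  case 0
  then show ?case by (simp add: polynomial_fun_0)
next
  case (pCons a q)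
  have "polynomial_fun s n (\<lambda>ls. s [:a:] (f ls) + (s [:p ls:] (s (pcompose q [:p ls, 1:]) (f ls)) +
      s [:0, 1:] (s (pcompose q [:p ls, 1:]) (f ls))))"
    by (intro polynomial_fun_add polynomial_fun_scale_fixed polynomial_fun_scale pCons assms)
  moreover have "pcompose (pCons a q) [:c, 1:] =
      [:a:] + ([:c:] * pcompose q [:c, 1:] + [:0, 1:] * pcompose q [:c, 1:])" for c :: complex
    by (simp add: pcompose_pCons algebra_simps)
  ultimately show ?case by (simp only: scale_left_distrib scale_scale)
qed

text \<open>For fixed parameter the operator is linear over the complex numbers, so it passes
  through the monomials of f to the finitely many coefficients; there, dependence on the parameter
  is polynomial by hypothesis.\<close>

lemma polynomial_fun_action:
  assumes f: "polynomial_fun s n f" and p: "poly_expr n p"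
    and add: "\<And>l v w. A l (v + w) = A l v + A l w"
    and scale: "\<And>l c v. A l (s [:c:] v) = s [:c:] (A l v)"
    and poly: "\<And>v. polynomial_fun s 1 (\<lambda>ls. A (ls ! 0) v)"
  shows "polynomial_fun s n (\<lambda>ls. A (p ls) (f ls))"
proof -
  from f obtain E c where E: "finite E"
    "\<And>ls. length ls = n \<Longrightarrow> f ls = (\<Sum>e\<in>E. s [:\<Prod>i<n. (ls ! i) ^ (e i):] (c e))"
    unfolding polynomial_fun_def by auto
  have A0: "A l 0 = 0" for l using scale[of l 0 0] by simp
  have A_sum: "A l (\<Sum>e\<in>E. g e) = (\<Sum>e\<in>E. A l (g e))" for g :: "(nat \<Rightarrow> nat) \<Rightarrow> 'm" and l
    by (induction E rule: infinite_finite_induct) (auto simp: A0 add)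
  have pA: "polynomial_fun s n (\<lambda>ls. A (p ls) v)" for v
    using polynomial_fun_compose[OF poly[of v], of n "\<lambda>ls. [p ls]" "\<lambda>_. p"] p by simp
  have "polynomial_fun s n (\<lambda>ls. \<Sum>e\<in>E. s [:\<Prod>i<n. (ls ! i) ^ (e i):] (A (p ls) (c e)))"
    by (intro polynomial_fun_sum polynomial_fun_scale poly_expr_prod poly_expr_power pA)
      (auto intro: poly_expr_nth)
  then show ?thesis
    by (rule polynomial_fun_cong) (simp add: E(2) A_sum scale)
qed

end

lemma cpoly_module_one_dim: "cpoly_module (one_dim_scale a)"
  unfolding cpoly_module_def by (rule module_one_dim_scale)

lemma polynomial_fun_one_dim_line:
  assumes f: "polynomial_fun (one_dim_scale a) n f" and "length qs = n"
  shows "\<exists>r. \<forall>x. f (map (\<lambda>q. poly q x) qs) = poly r x"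
proof -
  from f obtain E c where E: "finite E"
    "\<And>ls. length ls = n \<Longrightarrow> f ls = (\<Sum>e\<in>E. (\<Prod>i<n. (ls ! i) ^ (e i)) * c e)"
    unfolding polynomial_fun_def one_dim_scale_def by auto
  have "poly_expr n (\<lambda>ls. \<Sum>e\<in>E. (\<Prod>i<n. (ls ! i) ^ (e i)) * c e)"
    by (intro poly_expr_sum poly_expr_mult poly_expr_prod poly_expr_power poly_expr_const poly_expr_nth) auto
  from poly_expr_line[OF this \<open>length qs = n\<close>] show ?thesis
    using E(2) \<open>length qs = n\<close> by simp
qed

lemma polynomial_fun_one_dimI:
  assumes "poly_expr n p" "\<And>ls. length ls = n \<Longrightarrow> f ls = p ls"
  shows "polynomial_fun (one_dim_scale a) n f"
proof -
  interpret cpoly_module "one_dim_scale a" by (rule cpoly_module_one_dim)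
  have "polynomial_fun (one_dim_scale a) n (\<lambda>ls. one_dim_scale a [:p ls:] 1)"
    by (intro polynomial_fun_scale assms polynomial_fun_const)
  then show ?thesis
    by (rule polynomial_fun_cong) (simp add: assms one_dim_scale_def)
qed

section \<open>The basic complex of a Lie conformal algebra\<close>

locale conformal_module =
  R: cpoly_module sR + M: cpoly_module sM
  for sR :: "complex poly \<Rightarrow> 'r::ab_group_add \<Rightarrow> 'r"
    and sM :: "complex poly \<Rightarrow> 'm::ab_group_add \<Rightarrow> 'm" +
  fixes br :: "complex \<Rightarrow> 'r \<Rightarrow> 'r \<Rightarrow> 'r" and act :: "complex \<Rightarrow> 'r \<Rightarrow> 'm \<Rightarrow> 'm"
  assumes br_add_left: "br l (x + y) z = br l x z + br l y z"
    and br_add_right: "br l x (y + z) = br l x y + br l x z"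
    and br_scale_left: "br l (sR p x) y = sR [:poly p (- l):] (br l x y)"
    and br_scale_right: "br l x (sR p y) = sR (pcompose p [:l, 1:]) (br l x y)"
    \<comment> \<open>Skew-symmetry \<open>[x\<^sub>\<lambda> y] = -[y\<^bsub>-\<lambda>-\<partial>\<^esub> x]\<close> without substituting an operator for \<open>\<lambda>\<close>:
      both brackets agree up to sign modulo the ideal generated by \<open>\<partial> + \<lambda> + \<mu>\<close>.\<close>
    and br_skew: "\<exists>z. br l x y + br m y x = sR [:l + m, 1:] z"
    and br_jacobi: "br l x (br m y z) = br (l + m) (br l x y) z + br m y (br l x z)"
    and br_poly: "polynomial_fun sR 1 (\<lambda>ls. br (ls ! 0) x y)"
    and act_add_left: "act l (x + y) v = act l x v + act l y v"
    and act_add_right: "act l x (v + w) = act l x v + act l x w"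
    and act_scale_left: "act l (sR p x) v = sM [:poly p (- l):] (act l x v)"
    and act_scale_right: "act l x (sM p v) = sM (pcompose p [:l, 1:]) (act l x v)"
    and act_br: "act l x (act m y v) - act m y (act l x v) = act (l + m) (br l x y) v"
    and act_poly: "polynomial_fun sM 1 (\<lambda>ls. act (ls ! 0) x v)"
begin

lemma act_0_right [simp]: "act l x 0 = 0"
  using act_add_right[of l x 0 0] by simp

lemma act_minus_right: "act l x (- v) = - act l x v"
  using act_add_right[of l x v "- v"] by (simp add: eq_neg_iff_add_eq_0 add.commute)

lemma act_diff_right: "act l x (v - w) = act l x v - act l x w"
  using act_add_right[of l x v "- w"] by (simp add: act_minus_right)

lemma act_const_right: "act l x (sM [:c:] v) = sM [:c:] (act l x v)"
  by (simp add: act_scale_right)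

subsection \<open>Contractions, Lie derivatives and the recursive form of the differential\<close>

definition contr :: "'r \<Rightarrow> complex \<Rightarrow> ('r list \<Rightarrow> complex list \<Rightarrow> 'm) \<Rightarrow> 'r list \<Rightarrow> complex list \<Rightarrow> 'm"
  where "contr x l \<gamma> = (\<lambda>as ls. \<gamma> (x # as) (l # ls))"

definition lie :: "'r \<Rightarrow> complex \<Rightarrow> ('r list \<Rightarrow> complex list \<Rightarrow> 'm) \<Rightarrow> 'r list \<Rightarrow> complex list \<Rightarrow> 'm"
  where "lie x l \<gamma> = (\<lambda>as ls. act l x (\<gamma> as ls) -
    (\<Sum>j<length as. \<gamma> (as[j := br l x (as ! j)]) (ls[j := l + ls ! j])))"

text \<open>Cartan's formula, read as a recursion on the number of arguments.\<close>

fun dif :: "('r list \<Rightarrow> complex list \<Rightarrow> 'm) \<Rightarrow> 'r list \<Rightarrow> complex list \<Rightarrow> 'm" where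
  "dif \<gamma> (x # as) (l # ls) = lie x l \<gamma> as ls - dif (contr x l \<gamma>) as ls"
| "dif \<gamma> [] ls = 0"
| "dif \<gamma> (x # as) [] = 0"

lemma lie_Nil [simp]: "lie x l \<gamma> [] ls = act l x (\<gamma> [] ls)"
  by (simp add: lie_def)

lemma lie_Cons [simp]:
  "lie x l \<gamma> (y # as) (m # ls) = lie x l (contr y m \<gamma>) as ls - \<gamma> (br l x y # as) ((l + m) # ls)"
  by (simp add: lie_def contr_def sum.lessThan_Suc_shift algebra_simps del: sum.lessThan_Suc)

lemma contr_apply: "contr x l \<gamma> as ls = \<gamma> (x # as) (l # ls)"
  by (simp add: contr_def)

lemma contr_add: "contr x l (\<lambda>as ls. \<gamma> as ls + \<delta> as ls) = (\<lambda>as ls. contr x l \<gamma> as ls + contr x l \<delta> as ls)"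
  by (simp add: contr_def)

lemma contr_diff: "contr x l (\<lambda>as ls. \<gamma> as ls - \<delta> as ls) = (\<lambda>as ls. contr x l \<gamma> as ls - contr x l \<delta> as ls)"
  by (simp add: contr_def)

lemma contr_minus: "contr x l (\<lambda>as ls. - \<gamma> as ls) = (\<lambda>as ls. - contr x l \<gamma> as ls)"
  by (simp add: contr_def)

lemma contr_const: "contr x l (\<lambda>as ls. sM [:c:] (\<gamma> as ls)) = (\<lambda>as ls. sM [:c:] (contr x l \<gamma> as ls))"
  by (simp add: contr_def)

lemma lie_add: "lie x l (\<lambda>as ls. \<gamma> as ls + \<delta> as ls) = (\<lambda>as ls. lie x l \<gamma> as ls + lie x l \<delta> as ls)"
  by (intro ext) (simp add: lie_def act_add_right sum.distrib algebra_simps)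

lemma lie_diff: "lie x l (\<lambda>as ls. \<gamma> as ls - \<delta> as ls) = (\<lambda>as ls. lie x l \<gamma> as ls - lie x l \<delta> as ls)"
  by (intro ext) (simp add: lie_def act_diff_right sum_subtractf algebra_simps)

lemma lie_minus: "lie x l (\<lambda>as ls. - \<gamma> as ls) = (\<lambda>as ls. - lie x l \<gamma> as ls)"
  by (intro ext) (simp add: lie_def act_minus_right sum_negf)

lemma lie_const: "lie x l (\<lambda>as ls. sM [:c:] (\<gamma> as ls)) = (\<lambda>as ls. sM [:c:] (lie x l \<gamma> as ls))"
  by (simp add: lie_def act_const_right M.scale_right_diff_distrib M.scale_sum_right)

lemma dif_add: "dif (\<lambda>as ls. \<gamma> as ls + \<delta> as ls) as ls = dif \<gamma> as ls + dif \<delta> as ls"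
  by (induction \<gamma> as ls arbitrary: \<delta> rule: dif.induct) (simp_all add: lie_add contr_add)

lemma dif_diff: "dif (\<lambda>as ls. \<gamma> as ls - \<delta> as ls) as ls = dif \<gamma> as ls - dif \<delta> as ls"
  by (induction \<gamma> as ls arbitrary: \<delta> rule: dif.induct) (simp_all add: lie_diff contr_diff)

lemma dif_minus: "dif (\<lambda>as ls. - \<gamma> as ls) as ls = - dif \<gamma> as ls"
  by (induction \<gamma> as ls rule: dif.induct) (simp_all add: lie_minus contr_minus)

lemma dif_const: "dif (\<lambda>as ls. sM [:c:] (\<gamma> as ls)) as ls = sM [:c:] (dif \<gamma> as ls)"
  by (induction \<gamma> as ls rule: dif.induct)
    (simp_all add: lie_const contr_const M.scale_right_diff_distrib)

lemma contr_dif: "contr x l (dif \<gamma>) = (\<lambda>as ls. lie x l \<gamma> as ls - dif (contr x l \<gamma>) as ls)"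
  by (simp add: contr_def)

lemma contr_lie:
  "contr y m (lie x l \<gamma>) = (\<lambda>as ls. lie x l (contr y m \<gamma>) as ls - contr (br l x y) (l + m) \<gamma> as ls)"
  by (simp add: contr_apply fun_eq_iff)

section \<open>Additivity, sesquilinearity and skew-symmetry under Lie derivative and
  differential\<close>

definition multiadditive :: "('r list \<Rightarrow> complex list \<Rightarrow> 'm) \<Rightarrow> bool" where
  "multiadditive \<gamma> \<longleftrightarrow> (\<forall>as bs x y ls l ms. length as = length ls \<longrightarrow>
     \<gamma> (as @ (x + y) # bs) (ls @ l # ms) = \<gamma> (as @ x # bs) (ls @ l # ms) + \<gamma> (as @ y # bs) (ls @ l # ms))"

definition sesquilinear :: "('r list \<Rightarrow> complex list \<Rightarrow> 'm) \<Rightarrow> bool" where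
  "sesquilinear \<gamma> \<longleftrightarrow> (\<forall>as bs p x ls l ms. length as = length ls \<longrightarrow>
     \<gamma> (as @ sR p x # bs) (ls @ l # ms) = sM [:poly p (- l):] (\<gamma> (as @ x # bs) (ls @ l # ms)))"

text \<open>Only adjacent swaps are demanded, and the position is marked by a prefix of both lists
  rather than by an index: contracting the first argument shortens the prefix, which suits induction
  on lists. \<open>skew_permute_list\<close> recovers arbitrary permutations.\<close>

definition skew :: "('r list \<Rightarrow> complex list \<Rightarrow> 'm) \<Rightarrow> bool" where
  "skew \<gamma> \<longleftrightarrow> (\<forall>as bs x y ls l m ms. length as = length ls \<longrightarrow>
     \<gamma> (as @ x # y # bs) (ls @ l # m # ms) = - \<gamma> (as @ y # x # bs) (ls @ m # l # ms))"

lemma multiadditiveD: "multiadditive \<gamma> \<Longrightarrow> length as = length ls \<Longrightarrow>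
     \<gamma> (as @ (x + y) # bs) (ls @ l # ms) = \<gamma> (as @ x # bs) (ls @ l # ms) + \<gamma> (as @ y # bs) (ls @ l # ms)"
  by (simp add: multiadditive_def)

lemma sesquilinearD: "sesquilinear \<gamma> \<Longrightarrow> length as = length ls \<Longrightarrow>
     \<gamma> (as @ sR p x # bs) (ls @ l # ms) = sM [:poly p (- l):] (\<gamma> (as @ x # bs) (ls @ l # ms))"
  by (simp add: sesquilinear_def)

lemma skewD: "skew \<gamma> \<Longrightarrow> length as = length ls \<Longrightarrow>
     \<gamma> (as @ x # y # bs) (ls @ l # m # ms) = - \<gamma> (as @ y # x # bs) (ls @ m # l # ms)"
  unfolding skew_def by blast

lemma multiadditive_hd: "multiadditive \<gamma> \<Longrightarrow> \<gamma> ((x + y) # bs) (l # ms) = \<gamma> (x # bs) (l # ms) + \<gamma> (y # bs) (l # ms)"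
  using multiadditiveD[of \<gamma> "[]" "[]"] by simp

lemma sesquilinear_hd: "sesquilinear \<gamma> \<Longrightarrow> \<gamma> (sR p x # bs) (l # ms) = sM [:poly p (- l):] (\<gamma> (x # bs) (l # ms))"
  using sesquilinearD[of \<gamma> "[]" "[]"] by simp

lemma skew_hd: "skew \<gamma> \<Longrightarrow> \<gamma> (x # y # bs) (l # m # ms) = - \<gamma> (y # x # bs) (m # l # ms)"
  using skewD[of \<gamma> "[]" "[]" x y bs l m ms] by simp

lemma multiadditive_contr: "multiadditive \<gamma> \<Longrightarrow> multiadditive (contr x l \<gamma>)"
  unfolding multiadditive_def[of "contr x l \<gamma>"] contr_apply
  using multiadditiveD[of \<gamma> "x # _" "l # _"] by simp

lemma sesquilinear_contr: "sesquilinear \<gamma> \<Longrightarrow> sesquilinear (contr x l \<gamma>)"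
  unfolding sesquilinear_def[of "contr x l \<gamma>"] contr_apply
  using sesquilinearD[of \<gamma> "x # _" "l # _"] by simp

lemma skew_contr:
  assumes "skew \<gamma>"
  shows "skew (contr x l \<gamma>)"
  unfolding skew_def contr_apply
proof (intro allI impI)
  fix as bs :: "'r list" and y z :: 'r and ls ms :: "complex list" and k m :: complex
  assume "length as = length ls"
  then show "\<gamma> (x # as @ y # z # bs) (l # ls @ k # m # ms) = - \<gamma> (x # as @ z # y # bs) (l # ls @ m # k # ms)"
    using skewD[OF assms, of "x # as" "l # ls" y z bs k m ms] by simp
qed

lemma contr_add_left:
  "multiadditive \<gamma> \<Longrightarrow> contr (x + y) l \<gamma> = (\<lambda>as ls. contr x l \<gamma> as ls + contr y l \<gamma> as ls)"
  by (simp add: contr_def multiadditive_hd)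

lemma contr_scale_left:
  "sesquilinear \<gamma> \<Longrightarrow> contr (sR p x) l \<gamma> = (\<lambda>as ls. sM [:poly p (- l):] (contr x l \<gamma> as ls))"
  by (simp add: contr_def sesquilinear_hd)

lemma contr_contr_skew:
  "skew \<gamma> \<Longrightarrow> contr y m (contr x l \<gamma>) = (\<lambda>as ls. - contr x l (contr y m \<gamma>) as ls)"
  by (intro ext) (simp add: contr_apply skew_hd[of \<gamma> x y])

lemma lie_add_left:
  "length as = length ls \<Longrightarrow> multiadditive \<gamma> \<Longrightarrow> lie (x + y) l \<gamma> as ls = lie x l \<gamma> as ls + lie y l \<gamma> as ls"
proof (induction as ls arbitrary: \<gamma> rule: list_induct2)
  case Nil
  then show ?case by (simp add: act_add_left)
next
  case (Cons z as m ls)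
  show ?case using Cons.IH[OF multiadditive_contr[OF Cons.prems]] Cons.prems
    by (simp add: br_add_left multiadditive_hd)
qed

lemma lie_scale_left:
  "length as = length ls \<Longrightarrow> sesquilinear \<gamma> \<Longrightarrow>
    lie (sR p x) l \<gamma> as ls = sM [:poly p (- l):] (lie x l \<gamma> as ls)"
proof (induction as ls arbitrary: \<gamma> rule: list_induct2)
  case Nil
  then show ?case by (simp add: act_scale_left)
next
  case (Cons z as m ls)
  show ?case using Cons.IH[OF sesquilinear_contr[OF Cons.prems]] Cons.prems
    by (simp add: br_scale_left sesquilinear_hd M.scale_right_diff_distrib)
qed


text \<open>The predicates above constrain only the lengths of the prefixes, whereas the inductions
  for \<open>dif\<close> also use suffixes of equal length. For functions that vanish on lists of
  different lengths the remaining case is trivial.\<close>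

definition balanced :: "('r list \<Rightarrow> complex list \<Rightarrow> 'm) \<Rightarrow> bool" where
  "balanced \<gamma> \<longleftrightarrow> (\<forall>as ls. length as \<noteq> length ls \<longrightarrow> \<gamma> as ls = 0)"

lemma balanced_contr: "balanced \<gamma> \<Longrightarrow> balanced (contr x l \<gamma>)"
  by (simp add: balanced_def contr_def)

lemma balanced_lie: "balanced \<gamma> \<Longrightarrow> balanced (lie x l \<gamma>)"
  by (simp add: balanced_def lie_def)

lemma balanced_dif:
  assumes "balanced \<gamma>"
  shows "balanced (dif \<gamma>)"
proof -
  have "length as \<noteq> length ls \<Longrightarrow> dif \<gamma> as ls = 0" for as ls
    using assms
  proof (induction \<gamma> as ls rule: dif.induct)
    case (1 \<gamma> x as l ls)
    then show ?case using balanced_lie[of \<gamma> x l] balanced_contr[of \<gamma> x l]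
      by (simp add: balanced_def)
  qed auto
  then show ?thesis by (simp add: balanced_def)
qed

lemma multiadditive_lie:
  assumes "multiadditive \<gamma>"
  shows "multiadditive (lie x l \<gamma>)"
proof -
  have "length as = length ls \<Longrightarrow> multiadditive \<gamma> \<Longrightarrow>
    lie x l \<gamma> (as @ (y + z) # bs) (ls @ m # ms) =
    lie x l \<gamma> (as @ y # bs) (ls @ m # ms) + lie x l \<gamma> (as @ z # bs) (ls @ m # ms)"
    for as ls y z bs m ms \<gamma>
  proof (induction as ls arbitrary: \<gamma> rule: list_induct2)
    case Nil
    then show ?case
      by (simp add: contr_add_left lie_add br_add_right multiadditive_hd algebra_simps)
  next
    case (Cons a as k ls)
    show ?case
      using Cons.IH[OF multiadditive_contr[OF Cons.prems]] Cons.hyps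
        multiadditiveD[OF Cons.prems, of "br l x a # as" "(l + k) # ls" y z bs m ms]
      by simp
  qed
  with assms show ?thesis unfolding multiadditive_def[of "lie x l \<gamma>"] by blast
qed

text \<open>The bracket with x turns p(\<partial>) into p(\<partial> + l), but the bracketed
  argument now carries the parameter l + m. Evaluation at -(l + m) gives p(-m) again.\<close>

lemma sesquilinear_lie:
  assumes "sesquilinear \<gamma>"
  shows "sesquilinear (lie x l \<gamma>)"
proof -
  have "length as = length ls \<Longrightarrow> sesquilinear \<gamma> \<Longrightarrow>
    lie x l \<gamma> (as @ sR p y # bs) (ls @ m # ms) =
    sM [:poly p (- m):] (lie x l \<gamma> (as @ y # bs) (ls @ m # ms))"
    for as ls p y bs m ms \<gamma>
  proof (induction as ls arbitrary: \<gamma> rule: list_induct2)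
    case Nil
    then show ?case
      by (simp add: contr_scale_left lie_const br_scale_right sesquilinear_hd poly_pcompose
          M.scale_right_diff_distrib)
  next
    case (Cons a as k ls)
    show ?case
      using Cons.IH[OF sesquilinear_contr[OF Cons.prems]] Cons.hyps
        sesquilinearD[OF Cons.prems, of "br l x a # as" "(l + k) # ls" p y bs m ms]
      by (simp add: M.scale_right_diff_distrib)
  qed
  with assms show ?thesis unfolding sesquilinear_def[of "lie x l \<gamma>"] by blast
qed

lemma skew_lie:
  assumes "skew \<gamma>"
  shows "skew (lie x l \<gamma>)"
proof -
  have "length as = length ls \<Longrightarrow> skew \<gamma> \<Longrightarrow>
    lie x l \<gamma> (as @ y # z # bs) (ls @ m # k # ms) =
    - lie x l \<gamma> (as @ z # y # bs) (ls @ k # m # ms)"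
    for as ls y z bs m k ms \<gamma>
  proof (induction as ls arbitrary: \<gamma> rule: list_induct2)
    case Nil
    have "lie x l (contr z k (contr y m \<gamma>)) bs ms = - lie x l (contr y m (contr z k \<gamma>)) bs ms"
      unfolding contr_contr_skew[OF Nil, of z k y m] lie_minus ..
    then show ?case
      using skew_hd[OF Nil, of "br l x y" z bs "l + m" k ms]
        skew_hd[OF Nil, of "br l x z" y bs "l + k" m ms]
      by (simp add: contr_apply)
  next
    case (Cons a as k' ls)
    show ?case
      using Cons.IH[OF skew_contr[OF Cons.prems]] Cons.hyps
        skewD[OF Cons.prems, of "br l x a # as" "(l + k') # ls" y z bs m k ms]
      by simp
  qed
  with assms show ?thesis unfolding skew_def[of "lie x l \<gamma>"] by blast
qed

lemma multiadditive_dif: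
  assumes "multiadditive \<gamma>" "balanced \<gamma>"
  shows "multiadditive (dif \<gamma>)"
proof -
  have "length as = length ls \<Longrightarrow> length bs = length ms \<Longrightarrow> multiadditive \<gamma> \<Longrightarrow>
    dif \<gamma> (as @ (y + z) # bs) (ls @ m # ms) =
    dif \<gamma> (as @ y # bs) (ls @ m # ms) + dif \<gamma> (as @ z # bs) (ls @ m # ms)"
    for as ls y z bs m ms \<gamma>
  proof (induction as ls arbitrary: \<gamma> rule: list_induct2)
    case Nil
    then show ?case
      by (simp add: contr_add_left lie_add_left dif_add)
  next
    case (Cons a as k ls)
    show ?case
      using Cons.IH[OF Cons.prems(1) multiadditive_contr[OF Cons.prems(2)]] Cons.hyps
        multiadditiveD[OF multiadditive_lie[OF Cons.prems(2)], of as ls a k y z bs m ms]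
      by simp
  qed
  moreover have "dif \<gamma> (as @ y # bs) (ls @ m # ms) = 0"
    if "length as = length ls" "length bs \<noteq> length ms" for as y bs ls m ms
    using balanced_dif[OF assms(2)] that by (simp add: balanced_def)
  ultimately show ?thesis using assms unfolding multiadditive_def[of "dif \<gamma>"]
    by (metis add_0)
qed

lemma sesquilinear_dif:
  assumes "sesquilinear \<gamma>" "balanced \<gamma>"
  shows "sesquilinear (dif \<gamma>)"
proof -
  have "length as = length ls \<Longrightarrow> length bs = length ms \<Longrightarrow> sesquilinear \<gamma> \<Longrightarrow>
    dif \<gamma> (as @ sR p y # bs) (ls @ m # ms) =
    sM [:poly p (- m):] (dif \<gamma> (as @ y # bs) (ls @ m # ms))"
    for as ls p y bs m ms \<gamma>
  proof (induction as ls arbitrary: \<gamma> rule: list_induct2)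
    case Nil
    then show ?case
      by (simp add: contr_scale_left lie_scale_left dif_const M.scale_right_diff_distrib)
  next
    case (Cons a as k ls)
    show ?case
      using Cons.IH[OF Cons.prems(1) sesquilinear_contr[OF Cons.prems(2)]] Cons.hyps
        sesquilinearD[OF sesquilinear_lie[OF Cons.prems(2)], of as ls a k p y bs m ms]
      by (simp add: M.scale_right_diff_distrib)
  qed
  moreover have "dif \<gamma> (as @ y # bs) (ls @ m # ms) = 0"
    if "length as = length ls" "length bs \<noteq> length ms" for as y bs ls m ms
    using balanced_dif[OF assms(2)] that by (simp add: balanced_def)
  ultimately show ?thesis using assms unfolding sesquilinear_def[of "dif \<gamma>"]
    by (metis M.scale_zero_right)
qed

text \<open>At parameter l + m, sesquilinearity makes \<partial> + l + m act as zero in the first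
  argument, which kills the correction term in \<open>br_skew\<close>.\<close>

lemma br_skew_apply:
  assumes "multiadditive \<gamma>" "sesquilinear \<gamma>"
  shows "\<gamma> (br m y x # bs) ((l + m) # ms) = - \<gamma> (br l x y # bs) ((l + m) # ms)"
proof -
  obtain z where z: "br l x y + br m y x = sR [:l + m, 1:] z" using br_skew by blast
  have "\<gamma> (br l x y # bs) ((l + m) # ms) + \<gamma> (br m y x # bs) ((l + m) # ms) = 0"
    unfolding multiadditive_hd[OF assms(1), symmetric] z sesquilinear_hd[OF assms(2)] by simp
  then show ?thesis by (simp add: eq_neg_iff_add_eq_0 add.commute)
qed

text \<open>Unfolding Cartan's formula twice leaves the difference of two Lie derivatives of
  contractions, a bracket term, and the differential of a double contraction. Swapping the two
  arguments exchanges the first two, negates the bracket term by \<open>br_skew_apply\<close> and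
  the last term by skew-symmetry.\<close>

lemma skew_dif:
  assumes "multiadditive \<gamma>" "sesquilinear \<gamma>" "skew \<gamma>"
  shows "skew (dif \<gamma>)"
proof -
  have "length as = length ls \<Longrightarrow> multiadditive \<gamma> \<Longrightarrow> sesquilinear \<gamma> \<Longrightarrow> skew \<gamma> \<Longrightarrow>
    dif \<gamma> (as @ y # z # bs) (ls @ m # k # ms) =
    - dif \<gamma> (as @ z # y # bs) (ls @ k # m # ms)"
    for as ls y z bs m k ms \<gamma>
  proof (induction as ls arbitrary: \<gamma> rule: list_induct2)
    case Nil
    show ?case
      using br_skew_apply[OF Nil(1,2), of k z y bs m ms]
      by (simp add: contr_contr_skew[OF Nil(3), of z k y m] dif_minus add.commute[of k m])
  next
    case (Cons a as k' ls)
    show ?case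
      using Cons.IH[OF multiadditive_contr[OF Cons.prems(1)]
          sesquilinear_contr[OF Cons.prems(2)] skew_contr[OF Cons.prems(3)]] Cons.hyps
        skewD[OF skew_lie[OF Cons.prems(3)], of as ls a k' y z bs m k ms]
      by simp
  qed
  with assms show ?thesis unfolding skew_def[of "dif \<gamma>"] by blast
qed

section \<open>Commutation relations and vanishing of the square of the differential\<close>

lemma lie_commutator:
  "length as = length ls \<Longrightarrow> multiadditive \<gamma> \<Longrightarrow>
    lie x l (lie y m \<gamma>) as ls - lie y m (lie x l \<gamma>) as ls = lie (br l x y) (l + m) \<gamma> as ls"
proof (induction as ls arbitrary: \<gamma> rule: list_induct2)
  case Nil
  then show ?case by (simp add: act_br)
next
  case (Cons z as k ls)
  have j: "\<gamma> (br l x (br m y z) # as) ((l + m + k) # ls) =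
      \<gamma> (br (l + m) (br l x y) z # as) ((l + m + k) # ls) +
      \<gamma> (br m y (br l x z) # as) ((l + m + k) # ls)"
    by (simp only: br_jacobi[of l x m y z] multiadditive_hd[OF Cons.prems])
  have c: "l + (m + k) = l + m + k" "m + (l + k) = l + m + k" by simp_all
  show ?case
    using Cons.IH[OF multiadditive_contr[OF Cons.prems], of z k] j
    by (simp add: contr_lie lie_diff c algebra_simps)
qed

text \<open>After contraction with y, the failure to commute is that of
  \<open>contr y m \<gamma>\<close>, which vanishes by induction, plus
  \<open>lie_commutator\<close>. The contractions with the bracket produced by
  \<open>contr_lie\<close> have differentials on both sides, and these cancel.\<close>

lemma lie_dif:
  "length as = length ls \<Longrightarrow> multiadditive \<gamma> \<Longrightarrow> lie x l (dif \<gamma>) as ls = dif (lie x l \<gamma>) as ls"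
proof (induction as ls arbitrary: \<gamma> rule: list_induct2)
  case Nil
  then show ?case by simp
next
  case (Cons y as m ls)
  show ?case
    using Cons.IH[OF multiadditive_contr[OF Cons.prems], of y m]
      lie_commutator[OF Cons.hyps Cons.prems, of x l y m]
    by (simp add: contr_dif contr_lie lie_diff dif_diff) (simp add: algebra_simps)
qed

text \<open>Contracting the first argument leaves the commutator of d with the Lie derivative, zero
  by \<open>lie_dif\<close>, and the square of d on the contracted function, zero by
  induction.\<close>

lemma dif_dif: "length as = length ls \<Longrightarrow> multiadditive \<gamma> \<Longrightarrow> dif (dif \<gamma>) as ls = 0"
proof (induction as ls arbitrary: \<gamma> rule: list_induct2)
  case Nil
  then show ?case by simp
next
  case (Cons x as l ls)
  show ?case
    using Cons.IH[OF multiadditive_contr[OF Cons.prems], of x l] lie_dif[OF Cons.hyps Cons.prems, of x l]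
    by (simp add: contr_dif dif_diff)
qed

text \<open>The shift \<open>c\<close> accounts for the arguments that have been contracted away.\<close>

definition shifted_partial ::
  "complex \<Rightarrow> ('r list \<Rightarrow> complex list \<Rightarrow> 'm) \<Rightarrow> 'r list \<Rightarrow> complex list \<Rightarrow> 'm" where
  "shifted_partial c \<gamma> = (\<lambda>as ls. sM [:sum_list ls + c, 1:] (\<gamma> as ls))"

lemma contr_shifted_partial:
  "contr x l (shifted_partial c \<gamma>) = shifted_partial (l + c) (contr x l \<gamma>)"
  by (simp add: contr_def shifted_partial_def add_ac)

text \<open>The action replaces \<partial> by \<partial> + l, and every bracket term replaces one
  parameter by its sum with l. Either way the operator grows by exactly l.\<close>

lemma lie_shifted_partial:
  "length as = length ls \<Longrightarrow>
    lie x l (shifted_partial c \<gamma>) as ls = shifted_partial (l + c) (lie x l \<gamma>) as ls"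
proof (induction as ls arbitrary: c \<gamma> rule: list_induct2)
  case Nil
  then show ?case by (simp add: shifted_partial_def act_scale_right pcompose_pCons add_ac)
next
  case (Cons y as m ls)
  then show ?case
    by (simp add: contr_shifted_partial) (simp add: shifted_partial_def M.scale_right_diff_distrib add_ac)
qed

lemma dif_shifted_partial:
  "length as = length ls \<Longrightarrow> dif (shifted_partial c \<gamma>) as ls = shifted_partial c (dif \<gamma>) as ls"
proof (induction as ls arbitrary: c \<gamma> rule: list_induct2)
  case Nil
  then show ?case by (simp add: shifted_partial_def)
next
  case (Cons y as m ls)
  then show ?case
    by (simp add: contr_shifted_partial lie_shifted_partial)
      (simp add: shifted_partial_def M.scale_right_diff_distrib add_ac)
qed

lemma cochain_partial_eq: "cochain_partial sM = shifted_partial 0"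
  by (simp add: cochain_partial_def shifted_partial_def fun_eq_iff)

end

lemma permute_list_adjacent:
  "permute_list (Transposition.transpose (length as) (Suc (length as))) (as @ x # y # bs) = as @ y # x # bs"
proof (rule nth_equalityI)
  fix i
  assume "i < length (permute_list (Transposition.transpose (length as) (Suc (length as))) (as @ x # y # bs))"
  then have i: "i < length as + 2 + length bs" by simp
  have p: "Transposition.transpose (length as) (Suc (length as)) permutes {..<length (as @ x # y # bs)}"
    by (rule permutes_swap_id) auto
  have "permute_list (Transposition.transpose (length as) (Suc (length as))) (as @ x # y # bs) ! i =
      (as @ x # y # bs) ! (Transposition.transpose (length as) (Suc (length as)) i)"
    using i by (intro permute_list_nth[OF p]) simp
  also have "\<dots> = (as @ y # x # bs) ! i"
    by (auto simp: Transposition.transpose_def nth_append nth_Cons split: nat.splits)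
  finally show "permute_list (Transposition.transpose (length as) (Suc (length as))) (as @ x # y # bs) ! i =
      (as @ y # x # bs) ! i" .
qed simp

lemma omit_0 [simp]: "omit 0 (x # xs) = xs"
  by (simp add: omit_def)

lemma omit_Suc [simp]: "omit (Suc i) (x # xs) = x # omit i xs"
  by (simp add: omit_def)

lemma length_omit: "i < length xs \<Longrightarrow> length (omit i xs) = length xs - 1"
  by (simp add: omit_def)

lemma nth_omit: "i < length xs \<Longrightarrow> k < length xs - 1 \<Longrightarrow> omit i xs ! k = xs ! (if k < i then k else Suc k)"
  by (auto simp: omit_def nth_append min_def)

context conformal_module
begin

subsection \<open>Cochains\<close>

lemma cochains_eq_0:
  "\<gamma> \<in> cochains sR sM n \<Longrightarrow> length as \<noteq> n \<or> length ls \<noteq> n \<Longrightarrow> \<gamma> as ls = 0"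
  unfolding cochains_def by blast

lemma cochains_balanced: "\<gamma> \<in> cochains sR sM n \<Longrightarrow> balanced \<gamma>"
  unfolding balanced_def by (metis cochains_eq_0)

lemma cochains_polynomial:
  "\<gamma> \<in> cochains sR sM n \<Longrightarrow> length as = n \<Longrightarrow> polynomial_fun sM n (\<gamma> as)"
  unfolding cochains_def by blast

lemma cochains_update:
  assumes "\<gamma> \<in> cochains sR sM n" "length as = n" "length ls = n" "i < n"
  shows "\<gamma> (as[i := x + y]) ls = \<gamma> (as[i := x]) ls + \<gamma> (as[i := y]) ls"
    and "\<gamma> (as[i := sR [:c:] x]) ls = sM [:c:] (\<gamma> (as[i := x]) ls)"
    and "\<gamma> (as[i := sR [:0, 1:] (as ! i)]) ls = sM [:- (ls ! i):] (\<gamma> as ls)"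
  using assms unfolding cochains_def by blast+

lemma cochains_multiadditive:
  assumes "\<gamma> \<in> cochains sR sM n"
  shows "multiadditive \<gamma>"
  unfolding multiadditive_def
proof (intro allI impI)
  fix as bs :: "'r list" and x y and ls ms :: "complex list" and l
  assume l: "length as = length ls"
  show "\<gamma> (as @ (x + y) # bs) (ls @ l # ms) =
      \<gamma> (as @ x # bs) (ls @ l # ms) + \<gamma> (as @ y # bs) (ls @ l # ms)"
  proof (cases "length (as @ x # bs) = n \<and> length (ls @ l # ms) = n")
    case True
    have "\<gamma> ((as @ x # bs)[length as := x + y]) (ls @ l # ms) =
      \<gamma> ((as @ x # bs)[length as := x]) (ls @ l # ms) + \<gamma> ((as @ x # bs)[length as := y]) (ls @ l # ms)"
      by (rule cochains_update[OF assms]) (use True in auto)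
    then show ?thesis by simp
  next
    case False
    then show ?thesis using cochains_eq_0[OF assms] by simp
  qed
qed

lemma cochains_sesquilinear:
  assumes "\<gamma> \<in> cochains sR sM n"
  shows "sesquilinear \<gamma>"
  unfolding sesquilinear_def
proof (intro allI impI)
  fix as bs :: "'r list" and p x and ls ms :: "complex list" and l
  assume l: "length as = length ls"
  show "\<gamma> (as @ sR p x # bs) (ls @ l # ms) = sM [:poly p (- l):] (\<gamma> (as @ x # bs) (ls @ l # ms))"
  proof (cases "length (as @ x # bs) = n \<and> length (ls @ l # ms) = n")
    case True
    have c: "\<gamma> (as @ sR [:a:] y # bs) (ls @ l # ms) = sM [:a:] (\<gamma> (as @ y # bs) (ls @ l # ms))" for a y
    proof -
      have "\<gamma> ((as @ y # bs)[length as := sR [:a:] y]) (ls @ l # ms) =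
          sM [:a:] (\<gamma> ((as @ y # bs)[length as := y]) (ls @ l # ms))"
        by (rule cochains_update[OF assms]) (use True in auto)
      then show ?thesis by simp
    qed
    have d: "\<gamma> (as @ sR [:0, 1:] y # bs) (ls @ l # ms) = sM [:- l:] (\<gamma> (as @ y # bs) (ls @ l # ms))" for y
    proof -
      have "\<gamma> ((as @ y # bs)[length as := sR [:0, 1:] ((as @ y # bs) ! length as)]) (ls @ l # ms) =
          sM [:- ((ls @ l # ms) ! length as):] (\<gamma> (as @ y # bs) (ls @ l # ms))"
        by (rule cochains_update[OF assms]) (use True in auto)
      moreover have "(ls @ l # ms) ! length as = l" using l by simp
      ultimately show ?thesis by simp
    qed
    show ?thesis
    proof (induction p)
      case 0
      show ?case using c[of 0 x] by simp
    next
      case (pCons a p)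
      have "sR (pCons a p) x = sR [:a:] x + sR [:0, 1:] (sR p x)"
        by (simp flip: R.scale_left_distrib)
      then have "\<gamma> (as @ sR (pCons a p) x # bs) (ls @ l # ms) =
          sM [:a:] (\<gamma> (as @ x # bs) (ls @ l # ms)) +
          sM [:- l:] (sM [:poly p (- l):] (\<gamma> (as @ x # bs) (ls @ l # ms)))"
        by (simp only: multiadditiveD[OF cochains_multiadditive[OF assms] l] c d pCons.IH)
      then show ?case by (simp add: mult.commute flip: M.scale_left_distrib)
    qed
  next
    case False
    then show ?thesis using cochains_eq_0[OF assms] by simp
  qed
qed

lemma cochains_skew:
  assumes "\<gamma> \<in> cochains sR sM n"
  shows "skew \<gamma>"
  unfolding skew_def
proof (intro allI impI)
  fix as bs :: "'r list" and x y and ls ms :: "complex list" and l m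
  assume l: "length as = length ls"
  show "\<gamma> (as @ x # y # bs) (ls @ l # m # ms) = - \<gamma> (as @ y # x # bs) (ls @ m # l # ms)"
  proof (cases "length (as @ x # y # bs) = n \<and> length (ls @ l # m # ms) = n")
    case True
    let ?p = "Transposition.transpose (length as) (Suc (length as))"
    have "?p permutes {..<n}" using True by (intro permutes_swap_id) auto
    then have "\<gamma> (permute_list ?p (as @ y # x # bs)) (permute_list ?p (ls @ m # l # ms)) =
        sM [:of_int (sign ?p):] (\<gamma> (as @ y # x # bs) (ls @ m # l # ms))"
      using assms True unfolding cochains_def by auto
    moreover have "permute_list ?p (ls @ m # l # ms) = ls @ l # m # ms"
      unfolding l by (rule permute_list_adjacent)
    ultimately show ?thesis
      by (simp add: permute_list_adjacent sign_swap_id M.scale_pCons_minus_1)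
  next
    case False
    then show ?thesis using cochains_eq_0[OF assms] by simp
  qed
qed

lemma skew_adjacent:
  assumes "skew \<gamma>" "length as = n" "length ls = n" "Suc k < n"
  shows "\<gamma> (permute_list (Transposition.transpose k (Suc k)) as)
      (permute_list (Transposition.transpose k (Suc k)) ls) = - \<gamma> as ls"
proof -
  have split: "xs = take k xs @ xs ! k # xs ! Suc k # drop (Suc (Suc k)) xs" if "length xs = n" for xs :: "'z list"
    using that assms(4) by (metis Cons_nth_drop_Suc Suc_lessD id_take_nth_drop)
  have p: "permute_list (Transposition.transpose k (Suc k)) xs =
      take k xs @ xs ! Suc k # xs ! k # drop (Suc (Suc k)) xs" if "length xs = n" for xs :: "'z list"
  proof -
    have "k = length (take k xs)" using that assms(4) by simp
    then show ?thesis
      using permute_list_adjacent[of "take k xs" "xs ! k" "xs ! Suc k" "drop (Suc (Suc k)) xs"]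
        split[OF that] by metis
  qed
  have "\<gamma> (take k as @ as ! Suc k # as ! k # drop (Suc (Suc k)) as)
      (take k ls @ ls ! Suc k # ls ! k # drop (Suc (Suc k)) ls) =
    - \<gamma> (take k as @ as ! k # as ! Suc k # drop (Suc (Suc k)) as)
      (take k ls @ ls ! k # ls ! Suc k # drop (Suc (Suc k)) ls)"
    by (rule skewD[OF assms(1)]) (use assms in simp)
  then show ?thesis
    using split[OF assms(2)] split[OF assms(3)] p[OF assms(2)] p[OF assms(3)] by simp
qed

text \<open>The transposition of i and j + 1 is that of i and j conjugated by the adjacent
  transposition of j and j + 1; the three sign changes amount to one.\<close>

lemma skew_transpose:
  assumes "skew \<gamma>" "length as = n" "length ls = n" "i < j" "j < n"
  shows "\<gamma> (permute_list (Transposition.transpose i j) as)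
      (permute_list (Transposition.transpose i j) ls) = - \<gamma> as ls"
  using assms(2-5)
proof (induction j arbitrary: as ls)
  case 0
  then show ?case by simp
next
  case (Suc j)
  show ?case
  proof (cases "i = j")
    case True
    then show ?thesis using skew_adjacent[OF assms(1) Suc.prems(1,2)] Suc.prems by simp
  next
    case False
    then have ij: "i < j" "j < n" using Suc.prems by auto
    let ?t = "Transposition.transpose j (Suc j)" and ?u = "Transposition.transpose i j"
    have eq: "Transposition.transpose i (Suc j) = ?t \<circ> ?u \<circ> ?t"
      using transpose_comp_triple[of "Suc j" i j] ij by (simp add: transpose_commute)
    have t: "?t permutes {..<n}" and u: "?u permutes {..<n}"
      using ij Suc.prems by (auto intro!: permutes_swap_id)
    have e: "permute_list (Transposition.transpose i (Suc j)) xs =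
        permute_list ?t (permute_list ?u (permute_list ?t xs))" if "length xs = n" for xs :: "'z list"
      unfolding eq using t u that by (simp add: permute_list_compose)
    show ?thesis
      unfolding e[OF Suc.prems(1)] e[OF Suc.prems(2)]
      using Suc.prems ij by (simp add: skew_adjacent[OF assms(1)] Suc.IH)
  qed
qed

lemma skew_permute_list:
  assumes "skew \<gamma>" "p permutes {..<n}" "length as = n" "length ls = n"
  shows "\<gamma> (permute_list p as) (permute_list p ls) = sM [:of_int (sign p):] (\<gamma> as ls)"
  using assms(2) finite_lessThan assms(3,4)
proof (induction p arbitrary: as ls rule: permutes_induct)
  case id
  then show ?case by (simp add: M.scale_pCons_1)
next
  case (swap a b p)
  let ?t = "Transposition.transpose a b"
  have s: "sign (?t \<circ> p) = - sign p"
    using swap permutes_imp_permutation[OF finite_lessThan swap.hyps(4)]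
    by (simp add: sign_compose permutation_swap_id sign_swap_id)
  have e: "permute_list (?t \<circ> p) xs = permute_list p (permute_list ?t xs)" if "length xs = n" for xs :: "'z list"
    using swap.hyps(4) that by (simp add: permute_list_compose)
  have "\<gamma> (permute_list ?t as) (permute_list ?t ls) = - \<gamma> as ls"
  proof (cases "a < b")
    case True
    then show ?thesis using skew_transpose[OF assms(1) swap.prems] swap.hyps by simp
  next
    case False
    then show ?thesis using skew_transpose[OF assms(1) swap.prems, of b a] swap.hyps
      by (simp add: transpose_commute)
  qed
  then show ?case
    unfolding e[OF swap.prems(1)] e[OF swap.prems(2)] s
    using swap.IH[of "permute_list ?t as" "permute_list ?t ls"] swap.prems
    by (simp flip: M.scale_minus_left)
qed

text \<open>Trades list updates at positions and arbitrary permutations for the prefix-based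
  predicates, the form that contraction, \<open>lie\<close> and \<open>dif\<close> are shown to
  preserve.\<close>

lemma cochains_iff:
  "\<gamma> \<in> cochains sR sM n \<longleftrightarrow>
    (\<forall>as ls. length as \<noteq> n \<or> length ls \<noteq> n \<longrightarrow> \<gamma> as ls = 0) \<and>
    multiadditive \<gamma> \<and> sesquilinear \<gamma> \<and> skew \<gamma> \<and>
    (\<forall>as. length as = n \<longrightarrow> polynomial_fun sM n (\<gamma> as))"
  (is "_ \<longleftrightarrow> ?zero \<and> ?add \<and> ?ses \<and> ?skew \<and> ?poly")
proof
  assume "\<gamma> \<in> cochains sR sM n"
  then show "?zero \<and> ?add \<and> ?ses \<and> ?skew \<and> ?poly"
    using cochains_eq_0 cochains_multiadditive cochains_sesquilinear cochains_skew cochains_polynomial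
    by blast
next
  assume h: "?zero \<and> ?add \<and> ?ses \<and> ?skew \<and> ?poly"
  have upd: "as[i := v] = take i as @ v # drop (Suc i) as" if "length as = n" "i < n" for as :: "'r list" and i v
    using that by (simp add: upd_conv_take_nth_drop)
  have sp: "ls = take i ls @ ls ! i # drop (Suc i) ls" if "length ls = n" "i < n" for ls :: "complex list" and i
    using that id_take_nth_drop by metis
  have add: "\<gamma> (as[i := x + y]) ls = \<gamma> (as[i := x]) ls + \<gamma> (as[i := y]) ls"
    if "length as = n" "length ls = n" "i < n" for as ls i x y
  proof -
    have "\<gamma> (take i as @ (x + y) # drop (Suc i) as) (take i ls @ ls ! i # drop (Suc i) ls) =
      \<gamma> (take i as @ x # drop (Suc i) as) (take i ls @ ls ! i # drop (Suc i) ls) +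
      \<gamma> (take i as @ y # drop (Suc i) as) (take i ls @ ls ! i # drop (Suc i) ls)"
      by (rule multiadditiveD) (use h that in auto)
    then show ?thesis using upd[OF that(1,3)] sp[OF that(2,3)] by simp
  qed
  have ses: "\<gamma> (as[i := sR p x]) ls = sM [:poly p (- (ls ! i)):] (\<gamma> (as[i := x]) ls)"
    if "length as = n" "length ls = n" "i < n" for as ls i x p
  proof -
    have "\<gamma> (take i as @ sR p x # drop (Suc i) as) (take i ls @ ls ! i # drop (Suc i) ls) =
      sM [:poly p (- (ls ! i)):] (\<gamma> (take i as @ x # drop (Suc i) as) (take i ls @ ls ! i # drop (Suc i) ls))"
      by (rule sesquilinearD) (use h that in auto)
    then show ?thesis using upd[OF that(1,3)] sp[OF that(2,3)] by simp
  qed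
  show "\<gamma> \<in> cochains sR sM n"
    unfolding cochains_def using h
    by (auto simp: add ses skew_permute_list)
qed

lemma cochainsI:
  assumes "\<And>as ls. length as \<noteq> n \<or> length ls \<noteq> n \<Longrightarrow> \<gamma> as ls = 0"
    "multiadditive \<gamma>" "sesquilinear \<gamma>" "skew \<gamma>"
    "\<And>as. length as = n \<Longrightarrow> polynomial_fun sM n (\<gamma> as)"
  shows "\<gamma> \<in> cochains sR sM n"
  using assms unfolding cochains_iff by blast

lemma cochains_zero: "(\<lambda>as ls. 0) \<in> cochains sR sM n"
  by (rule cochainsI) (auto simp: multiadditive_def sesquilinear_def skew_def M.polynomial_fun_0)

lemma cochains_add:
  assumes g: "\<gamma> \<in> cochains sR sM n" and d: "\<delta> \<in> cochains sR sM n"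
  shows "(\<lambda>as ls. \<gamma> as ls + \<delta> as ls) \<in> cochains sR sM n"
proof (rule cochainsI)
  note a = multiadditiveD[OF cochains_multiadditive[OF g]] multiadditiveD[OF cochains_multiadditive[OF d]]
  note s = sesquilinearD[OF cochains_sesquilinear[OF g]] sesquilinearD[OF cochains_sesquilinear[OF d]]
  show "multiadditive (\<lambda>as ls. \<gamma> as ls + \<delta> as ls)"
    unfolding multiadditive_def by (simp add: a algebra_simps)
  show "sesquilinear (\<lambda>as ls. \<gamma> as ls + \<delta> as ls)"
    unfolding sesquilinear_def by (simp add: s M.scale_right_distrib)
  show "skew (\<lambda>as ls. \<gamma> as ls + \<delta> as ls)"
    unfolding skew_def
  proof (intro allI impI)
    fix as bs :: "'r list" and x y and ls ms :: "complex list" and l m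
    assume l: "length as = length ls"
    show "\<gamma> (as @ x # y # bs) (ls @ l # m # ms) + \<delta> (as @ x # y # bs) (ls @ l # m # ms) =
      - (\<gamma> (as @ y # x # bs) (ls @ m # l # ms) + \<delta> (as @ y # x # bs) (ls @ m # l # ms))"
      using skewD[OF cochains_skew[OF g] l, of x y bs l m ms]
        skewD[OF cochains_skew[OF d] l, of x y bs l m ms] by simp
  qed
  show "polynomial_fun sM n (\<lambda>ls. \<gamma> as ls + \<delta> as ls)" if "length as = n" for as
    by (intro M.polynomial_fun_add cochains_polynomial[OF g that] cochains_polynomial[OF d that])
qed (auto simp: cochains_eq_0[OF g] cochains_eq_0[OF d])

text \<open>Covers multiplication by scalars and by \<open>\<partial> + \<lambda>\<^sub>1 + \<dots> + \<lambda>\<^sub>n\<close>.\<close>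

lemma cochains_scale:
  assumes g: "\<gamma> \<in> cochains sR sM n"
    and sym: "\<And>ls l m ms. q (ls @ l # m # ms) = q (ls @ m # l # ms)"
    and poly: "\<And>f. polynomial_fun sM n f \<Longrightarrow> polynomial_fun sM n (\<lambda>ls. sM (q ls) (f ls))"
  shows "(\<lambda>as ls. sM (q ls) (\<gamma> as ls)) \<in> cochains sR sM n"
proof (rule cochainsI)
  note a = multiadditiveD[OF cochains_multiadditive[OF g]]
  note s = sesquilinearD[OF cochains_sesquilinear[OF g]]
  show "multiadditive (\<lambda>as ls. sM (q ls) (\<gamma> as ls))"
    unfolding multiadditive_def by (simp add: a M.scale_right_distrib)
  show "sesquilinear (\<lambda>as ls. sM (q ls) (\<gamma> as ls))"
    unfolding sesquilinear_def by (simp add: s mult.commute)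
  show "skew (\<lambda>as ls. sM (q ls) (\<gamma> as ls))"
    unfolding skew_def
  proof (intro allI impI)
    fix as bs :: "'r list" and x y and ls ms :: "complex list" and l m
    assume l: "length as = length ls"
    show "sM (q (ls @ l # m # ms)) (\<gamma> (as @ x # y # bs) (ls @ l # m # ms)) =
      - sM (q (ls @ m # l # ms)) (\<gamma> (as @ y # x # bs) (ls @ m # l # ms))"
      using skewD[OF cochains_skew[OF g] l, of x y bs l m ms] sym[of ls l m ms] by simp
  qed
  show "polynomial_fun sM n (\<lambda>ls. sM (q ls) (\<gamma> as ls))" if "length as = n" for as
    by (intro poly cochains_polynomial[OF g that])
qed (auto simp: cochains_eq_0[OF g])

lemma cochains_const:
  "\<gamma> \<in> cochains sR sM n \<Longrightarrow> (\<lambda>as ls. sM [:c:] (\<gamma> as ls)) \<in> cochains sR sM n"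
  by (rule cochains_scale) (auto intro!: M.polynomial_fun_scale poly_expr_const)

lemma cochains_partial:
  assumes "\<gamma> \<in> cochains sR sM n"
  shows "cochain_partial sM \<gamma> \<in> cochains sR sM n"
  unfolding cochain_partial_def[abs_def] using assms
proof (rule cochains_scale)
  fix f assume f: "polynomial_fun sM n f"
  have "polynomial_fun sM n (\<lambda>ls. sM [:\<Sum>i<n. ls ! i:] (f ls) + sM [:0, 1:] (f ls))"
    by (intro M.polynomial_fun_add M.polynomial_fun_scale poly_expr_sum f
        M.polynomial_fun_linear[where T = "sM [:0, 1:]"])
      (auto intro: poly_expr_nth simp: M.scale_right_distrib mult.commute)
  then show "polynomial_fun sM n (\<lambda>ls. sM [:sum_list ls, 1:] (f ls))"
    by (rule M.polynomial_fun_cong)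
      (simp add: sum_list_sum_nth atLeast0LessThan flip: M.scale_left_distrib)
qed auto

lemma cochains_contr:
  assumes g: "\<gamma> \<in> cochains sR sM (Suc n)"
  shows "contr x l \<gamma> \<in> cochains sR sM n"
proof (rule cochainsI)
  show "polynomial_fun sM n (contr x l \<gamma> as)" if "length as = n" for as
    unfolding contr_def
  proof (rule M.polynomial_fun_compose)
    show "polynomial_fun sM (Suc n) (\<gamma> (x # as))" by (rule cochains_polynomial[OF g]) (simp add: that)
    show "poly_expr n (case i of 0 \<Rightarrow> \<lambda>_. l | Suc j \<Rightarrow> \<lambda>ls. ls ! j)" if "i < Suc n" for i
      using that by (cases i) (auto intro: poly_expr_const poly_expr_nth)
    show "(l # ls) ! i = (case i of 0 \<Rightarrow> \<lambda>_. l | Suc j \<Rightarrow> \<lambda>ls. ls ! j) ls" for i ls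
      by (cases i) auto
  qed auto
qed (auto simp: cochains_eq_0[OF g] contr_apply
    intro: multiadditive_contr sesquilinear_contr skew_contr cochains_multiadditive[OF g]
      cochains_sesquilinear[OF g] cochains_skew[OF g])


subsection \<open>The differential\<close>

lemma skew_move_front:
  "length us = length ks \<Longrightarrow> skew \<gamma> \<Longrightarrow>
    \<gamma> (v # us @ bs) (k # ks @ ms) = sM [:(- 1) ^ length us:] (\<gamma> (us @ v # bs) (ks @ k # ms))"
proof (induction us ks arbitrary: \<gamma> rule: list_induct2)
  case Nil
  then show ?case by (simp add: M.scale_pCons_1)
next
  case (Cons u us k' ks)
  have "\<gamma> (v # u # us @ bs) (k # k' # ks @ ms) = - contr u k' \<gamma> (v # us @ bs) (k # ks @ ms)"
    using skew_hd[OF Cons.prems, of v u "us @ bs" k k' "ks @ ms"] by (simp add: contr_apply)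
  also have "\<dots> = - sM [:(- 1) ^ length us:] (\<gamma> (u # us @ v # bs) (k' # ks @ k # ms))"
    using Cons.IH[OF skew_contr[OF Cons.prems], of u k'] by (simp add: contr_apply)
  finally show ?case by (simp flip: M.scale_minus_left)
qed

text \<open>Links two conventions: \<open>differential\<close> puts a bracket in front and deletes
  its arguments, while \<open>lie\<close> leaves it in position j. Moving it past j arguments costs
  (-1)^j.\<close>

lemma skew_omit:
  assumes "skew \<gamma>" "length as = length ls" "j < length as"
  shows "\<gamma> (v # omit j as) (k # omit j ls) = sM [:(- 1) ^ j:] (\<gamma> (as[j := v]) (ls[j := k]))"
  using skew_move_front[of "take j as" "take j ls" \<gamma> v "drop (Suc j) as" k "drop (Suc j) ls"] assms
  by (simp add: omit_def upd_conv_take_nth_drop min_def)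

text \<open>Cartan's formula for the explicit sums. The terms that involve position 0 through the
  action or the bracket form the Lie derivative. All others are minus the terms of the differential
  of the contraction: for action terms the sign comes from the index shift, for bracket terms from
  moving x in front of the bracket.\<close>

lemma differential_Suc:
  assumes g: "skew \<gamma>" and a: "length as = Suc n" and b: "length ls = Suc n"
  shows "differential br sM act (Suc n) \<gamma> (x # as) (l # ls) =
    lie x l \<gamma> as ls - differential br sM act n (contr x l \<gamma>) as ls"
proof -
  define f where "f i = sM [:(- 1) ^ i:] (act ((l # ls) ! i) ((x # as) ! i)
      (\<gamma> (omit i (x # as)) (omit i (l # ls))))" for i
  define F where "F i j = sM [:(- 1) ^ (i + j):]
      (\<gamma> (br ((l # ls) ! i) ((x # as) ! i) ((x # as) ! j) # omit i (omit j (x # as)))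
         (((l # ls) ! i + (l # ls) ! j) # omit i (omit j (l # ls))))" for i j
  have D: "differential br sM act (Suc n) \<gamma> (x # as) (l # ls) =
      (\<Sum>i<Suc (Suc n). f i) + (\<Sum>j<Suc (Suc n). \<Sum>i<j. F i j)"
    unfolding differential_def f_def F_def using a b by (simp only: length_Cons simp_thms if_True)
  have f0: "f 0 = act l x (\<gamma> as ls)" by (simp add: f_def M.scale_pCons_1)
  have fS: "f (Suc i) = - sM [:(- 1) ^ i:] (act (ls ! i) (as ! i) (contr x l \<gamma> (omit i as) (omit i ls)))" for i
    by (simp add: f_def contr_apply flip: M.scale_minus_left)
  \<comment> \<open>The sign (-1)^(j+1) of the term and (-1)^j from \<open>skew_omit\<close>
    multiply to -1, the sign of the bracket terms in \<open>lie\<close>.\<close>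
  have F0: "F 0 (Suc j) = - \<gamma> (as[j := br l x (as ! j)]) (ls[j := l + ls ! j])" if "j < Suc n" for j
    using skew_omit[OF g, of as ls j "br l x (as ! j)" "l + ls ! j"] that a b
    by (simp add: F_def power_mult_distrib[symmetric] M.scale_pCons_minus_1)
  have FS: "F (Suc i) (Suc j) = - sM [:(- 1) ^ (i + j):]
      (contr x l \<gamma> (br (ls ! i) (as ! i) (as ! j) # omit i (omit j as))
         ((ls ! i + ls ! j) # omit i (omit j ls)))" for i j
    using skew_hd[OF g, of "br (ls ! i) (as ! i) (as ! j)" x "omit i (omit j as)" "ls ! i + ls ! j" l
        "omit i (omit j ls)"]
    by (simp add: F_def contr_apply)
  have "(\<Sum>j<Suc (Suc n). \<Sum>i<j. F i j) = (\<Sum>j<Suc n. \<Sum>i<Suc j. F i (Suc j))"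
    by (subst sum.lessThan_Suc_shift) simp
  also have "\<dots> = (\<Sum>j<Suc n. F 0 (Suc j) + (\<Sum>i<j. F (Suc i) (Suc j)))"
    by (intro sum.cong refl sum.lessThan_Suc_shift)
  also have "\<dots> = (\<Sum>j<Suc n. F 0 (Suc j)) + (\<Sum>j<Suc n. \<Sum>i<j. F (Suc i) (Suc j))"
    by (rule sum.distrib)
  finally have S: "(\<Sum>j<Suc (Suc n). \<Sum>i<j. F i j) =
    (\<Sum>j<Suc n. F 0 (Suc j)) + (\<Sum>j<Suc n. \<Sum>i<j. F (Suc i) (Suc j))" .
  have S0: "(\<Sum>j<Suc n. F 0 (Suc j)) = - (\<Sum>j<Suc n. \<gamma> (as[j := br l x (as ! j)]) (ls[j := l + ls ! j]))"
    unfolding sum_negf[symmetric] by (intro sum.cong refl F0) simp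
  have T: "(\<Sum>i<Suc (Suc n). f i) = f 0 + (\<Sum>i<Suc n. f (Suc i))"
    by (rule sum.lessThan_Suc_shift)
  have E: "differential br sM act n (contr x l \<gamma>) as ls =
      - (\<Sum>i<Suc n. f (Suc i)) - (\<Sum>j<Suc n. \<Sum>i<j. F (Suc i) (Suc j))"
    unfolding differential_def fS FS sum_negf using a b by simp
  have L: "lie x l \<gamma> as ls = f 0 + (\<Sum>j<Suc n. F 0 (Suc j))"
    unfolding lie_def f0 S0 a by simp
  show ?thesis unfolding D S T E L by simp
qed

lemma differential_eq_dif:
  "skew \<gamma> \<Longrightarrow> length as = Suc n \<Longrightarrow> length ls = Suc n \<Longrightarrow>
    differential br sM act n \<gamma> as ls = dif \<gamma> as ls"
proof (induction n arbitrary: \<gamma> as ls)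
  case 0
  then obtain x l where "as = [x]" "ls = [l]" by (auto simp: length_Suc_conv)
  then show ?case by (simp add: differential_def M.scale_pCons_1)
next
  case (Suc n)
  from Suc.prems(2,3) obtain x as' l ls' where "as = x # as'" "ls = l # ls'"
    by (auto simp: length_Suc_conv)
  with Suc show ?case by (simp add: differential_Suc skew_contr)
qed

lemma dif_eq_0:
  assumes "\<gamma> \<in> cochains sR sM n" "\<not> (length as = Suc n \<and> length ls = Suc n)"
  shows "dif \<gamma> as ls = 0"
proof (cases "length as = length ls")
  case False
  then show ?thesis using balanced_dif[OF cochains_balanced[OF assms(1)]] by (simp add: balanced_def)
next
  case True
  then show ?thesis using assms
  proof (induction as ls arbitrary: n \<gamma> rule: list_induct2)
    case Nil
    show ?case by simp
  next
    case (Cons x as l ls)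
    then have n: "length as \<noteq> n" by simp
    then have "lie x l \<gamma> as ls = 0" by (simp add: lie_def cochains_eq_0[OF Cons.prems(1)])
    moreover have "dif (contr x l \<gamma>) as ls = 0"
    proof (cases n)
      case 0
      then have "contr x l \<gamma> = (\<lambda>as ls. 0)"
        using cochains_eq_0[OF Cons.prems(1)] by (simp add: contr_def fun_eq_iff)
      \<comment> \<open>The zero function is a cochain in every degree. Degree
        \<open>length as\<close> is chosen because the arguments then have the wrong length for its
        differential, so the induction hypothesis applies.\<close>
      then have "contr x l \<gamma> \<in> cochains sR sM (length as)" using cochains_zero by simp
      from Cons.IH[OF this] show ?thesis by simp
    next
      case (Suc n')
      with Cons.IH[OF cochains_contr] Cons.prems(1) n show ?thesis by simp
    qed
    ultimately show ?case by simp
  qed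
qed

lemma differential_cochain:
  assumes "\<gamma> \<in> cochains sR sM n"
  shows "differential br sM act n \<gamma> = dif \<gamma>"
proof (intro ext)
  fix as ls
  show "differential br sM act n \<gamma> as ls = dif \<gamma> as ls"
  proof (cases "length as = Suc n \<and> length ls = Suc n")
    case True
    then show ?thesis using differential_eq_dif cochains_skew[OF assms] by blast
  next
    case False
    then show ?thesis unfolding dif_eq_0[OF assms False] differential_def by (rule if_not_P)
  qed
qed

lemma multiadditive_hd_sum:
  "finite E \<Longrightarrow> multiadditive \<gamma> \<Longrightarrow> sesquilinear \<gamma> \<Longrightarrow>
    \<gamma> ((\<Sum>i\<in>E. f i) # as) (l # ls) = (\<Sum>i\<in>E. \<gamma> (f i # as) (l # ls))"
proof (induction E rule: finite_induct)
  case empty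
  then show ?case using sesquilinear_hd[of \<gamma> 0 0 as l ls] by simp
qed (simp add: multiadditive_hd)

lemma polynomial_fun_omit:
  assumes "polynomial_fun sM n f" "i < Suc n"
  shows "polynomial_fun sM (Suc n) (\<lambda>ls. f (omit i ls))"
  using assms
  by (intro M.polynomial_fun_compose[where p = "\<lambda>k ls. ls ! (if k < i then k else Suc k)" and g = "omit i"])
    (auto simp: length_omit nth_omit intro: poly_expr_nth)

lemma polynomial_fun_differential:
  assumes g: "\<gamma> \<in> cochains sR sM n" and a: "length as = Suc n"
  shows "polynomial_fun sM (Suc n) (differential br sM act n \<gamma> as)"
proof -
  have 1: "polynomial_fun sM (Suc n)
     (\<lambda>ls. sM [:(- 1) ^ i:] (act (ls ! i) (as ! i) (\<gamma> (omit i as) (omit i ls))))" if i: "i < Suc n" for i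
  proof (intro M.polynomial_fun_scale poly_expr_const)
    have p: "polynomial_fun sM (Suc n) (\<lambda>ls. \<gamma> (omit i as) (omit i ls))"
      by (intro polynomial_fun_omit cochains_polynomial[OF g]) (use i a in \<open>auto simp: length_omit\<close>)
    show "polynomial_fun sM (Suc n) (\<lambda>ls. act (ls ! i) (as ! i) (\<gamma> (omit i as) (omit i ls)))"
      by (rule M.polynomial_fun_action[where A = "\<lambda>l v. act l (as ! i) v", OF p poly_expr_nth[OF i]
          act_add_right act_const_right act_poly])
  qed
  have 2: "polynomial_fun sM (Suc n) (\<lambda>ls. sM [:(- 1) ^ (i + j):]
           (\<gamma> (br (ls ! i) (as ! i) (as ! j) # omit i (omit j as))
              ((ls ! i + ls ! j) # omit i (omit j ls))))" if ij: "i < j" "j < Suc n" for i j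
  proof (intro M.polynomial_fun_scale poly_expr_const)
    \<comment> \<open>The bracket in the first argument depends on the parameter as well. Expanding
      it in powers of that parameter first leaves finitely many fixed arguments \<open>w r\<close>,
      for which polynomiality of \<gamma> can be used.\<close>
    obtain E w where E: "finite E" and
      w': "\<And>ls. length ls = 1 \<Longrightarrow>
        br (ls ! 0) (as ! i) (as ! j) = (\<Sum>r\<in>E. sR [:\<Prod>k<1. (ls ! k) ^ r k:] (w r))"
      using br_poly[of "as ! i" "as ! j"] unfolding polynomial_fun_def by blast
    have w: "br l (as ! i) (as ! j) = (\<Sum>r\<in>E. sR [:l ^ r 0:] (w r))" for l
      using w'[of "[l]"] by simp
    have p: "polynomial_fun sM (Suc n)
      (\<lambda>ls. \<gamma> (w r # omit i (omit j as)) ((ls ! i + ls ! j) # omit i (omit j ls)))" for r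
    proof (rule M.polynomial_fun_compose)
      show "polynomial_fun sM n (\<gamma> (w r # omit i (omit j as)))"
        by (rule cochains_polynomial[OF g]) (use ij a in \<open>auto simp: length_omit\<close>)
      \<comment> \<open>Entry k + 1 of the new list is entry k after two deletions. Its position in
        \<open>ls\<close> is found by skipping i and then j, the reverse of the order of
        deletion.\<close>
      let ?p = "\<lambda>k. case k of 0 \<Rightarrow> (\<lambda>ls. ls ! i + ls ! j)
         | Suc k \<Rightarrow> (\<lambda>ls. (let k' = (if k < i then k else Suc k) in ls ! (if k' < j then k' else Suc k')))"
      show "length ((ls ! i + ls ! j) # omit i (omit j ls)) = n" if "length ls = Suc n" for ls
        using ij that by (simp add: length_omit)
      show "poly_expr (Suc n) (?p k)" if "k < n" for k
        using ij that by (cases k) (auto simp: Let_def intro!: poly_expr_add poly_expr_nth)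
      show "((ls ! i + ls ! j) # omit i (omit j ls)) ! k = ?p k ls" if "k < n" "length ls = Suc n" for k ls
        using ij that by (cases k) (auto simp: nth_omit length_omit Let_def)
    qed
    have "polynomial_fun sM (Suc n) (\<lambda>ls. \<Sum>r\<in>E. sM [:(ls ! i) ^ r 0:]
       (\<gamma> (w r # omit i (omit j as)) ((ls ! i + ls ! j) # omit i (omit j ls))))"
      using ij by (intro M.polynomial_fun_sum M.polynomial_fun_scale p poly_expr_power poly_expr_nth) auto
    then show "polynomial_fun sM (Suc n) (\<lambda>ls. \<gamma> (br (ls ! i) (as ! i) (as ! j) # omit i (omit j as))
              ((ls ! i + ls ! j) # omit i (omit j ls)))"
      by (rule M.polynomial_fun_cong)
        (simp add: w multiadditive_hd_sum[OF E cochains_multiadditive[OF g] cochains_sesquilinear[OF g]]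
          sesquilinear_hd[OF cochains_sesquilinear[OF g]])
  qed
  have "polynomial_fun sM (Suc n) (\<lambda>ls.
        (\<Sum>i<Suc n. sM [:(-1) ^ i:] (act (ls ! i) (as ! i) (\<gamma> (omit i as) (omit i ls)))) +
        (\<Sum>j<Suc n. \<Sum>i<j. sM [:(-1) ^ (i + j):]
           (\<gamma> (br (ls ! i) (as ! i) (as ! j) # omit i (omit j as))
              ((ls ! i + ls ! j) # omit i (omit j ls)))))"
    by (intro M.polynomial_fun_add M.polynomial_fun_sum 1 2) auto
  then show ?thesis
    by (rule M.polynomial_fun_cong) (simp add: differential_def a)
qed

lemma differential_cochains:
  assumes g: "\<gamma> \<in> cochains sR sM n"
  shows "differential br sM act n \<gamma> \<in> cochains sR sM (Suc n)"
proof (rule cochainsI)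
  show "polynomial_fun sM (Suc n) (differential br sM act n \<gamma> as)" if "length as = Suc n" for as
    by (rule polynomial_fun_differential[OF g that])
  note c = cochains_balanced[OF g] cochains_multiadditive[OF g] cochains_sesquilinear[OF g] cochains_skew[OF g]
  show "multiadditive (differential br sM act n \<gamma>)" "sesquilinear (differential br sM act n \<gamma>)"
    "skew (differential br sM act n \<gamma>)"
    unfolding differential_cochain[OF g]
    using c by (auto intro: multiadditive_dif sesquilinear_dif skew_dif)
qed (auto simp: differential_def)

lemma differential_differential:
  assumes g: "\<gamma> \<in> cochains sR sM n"
  shows "differential br sM act (Suc n) (differential br sM act n \<gamma>) = (\<lambda>as ls. 0)"
proof (intro ext)
  fix as ls
  note d = differential_cochains[OF g]
  show "differential br sM act (Suc n) (differential br sM act n \<gamma>) as ls = 0"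
  proof (cases "length as = length ls")
    case True
    then show ?thesis
      unfolding differential_cochain[OF d] unfolding differential_cochain[OF g]
      by (rule dif_dif[OF _ cochains_multiadditive[OF g]])
  next
    case False
    then show ?thesis by (auto simp: differential_def)
  qed
qed

lemma differential_partial:
  assumes g: "\<gamma> \<in> cochains sR sM n"
  shows "differential br sM act n (cochain_partial sM \<gamma>) =
    cochain_partial sM (differential br sM act n \<gamma>)"
proof (intro ext)
  fix as ls
  show "differential br sM act n (cochain_partial sM \<gamma>) as ls =
    cochain_partial sM (differential br sM act n \<gamma>) as ls"
  proof (cases "length as = length ls")
    case True
    then show ?thesis
      unfolding differential_cochain[OF g] differential_cochain[OF cochains_partial[OF g]]
      unfolding cochain_partial_eq by (rule dif_shifted_partial)
  next
    case False
    then show ?thesis by (auto simp: differential_def cochain_partial_def)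
  qed
qed

section \<open>The basic and reduced complexes as complexes of vector spaces\<close>

lemma vectorspace_cochain_space: "vectorspace class_ring (cochain_space sR sM n)"
proof (rule vectorspace_class_ringI, rule module_criteria)
  show "cring (class_ring :: complex ring)" 
    using class_field[where ?'a = complex] by (simp add: field_def domain_def)
  let ?C = "cochain_space sR sM n"
  show "\<forall>v\<in>carrier ?C. \<exists>w\<in>carrier ?C. v \<oplus>\<^bsub>?C\<^esub> w = \<zero>\<^bsub>?C\<^esub>"
  proof
    fix v assume "v \<in> carrier ?C"
    then show "\<exists>w\<in>carrier ?C. v \<oplus>\<^bsub>?C\<^esub> w = \<zero>\<^bsub>?C\<^esub>"
      using cochains_const[of v n "- 1"]
      by (intro bexI[of _ "\<lambda>as ls. sM [:- 1:] (v as ls)"]) (auto simp: cochain_space_def M.scale_pCons_minus_1)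
  qed
qed (auto simp: cochain_space_def cochains_zero cochains_add cochains_const fun_eq_iff
    add_ac M.scale_pCons_1 M.scale_right_distrib M.scale_pCons_add mult.commute)

lemma partial_cochains_submodule:
  "submodule class_ring (partial_cochains sR sM n) (cochain_space sR sM n)"
proof (intro submodule.intro)
  show "module class_ring (cochain_space sR sM n)"
    using vectorspace_cochain_space by (simp add: vectorspace_def)
  show "partial_cochains sR sM n \<subseteq> carrier (cochain_space sR sM n)"
    by (auto simp: partial_cochains_def cochain_space_def cochains_partial)
  show "\<zero>\<^bsub>cochain_space sR sM n\<^esub> \<in> partial_cochains sR sM n"
    unfolding partial_cochains_def
    by (rule image_eqI[of _ _ "\<lambda>as ls. 0"]) (auto simp: cochain_space_def cochains_zero cochain_partial_def fun_eq_iff)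
  show "v \<oplus>\<^bsub>cochain_space sR sM n\<^esub> w \<in> partial_cochains sR sM n"
    if vw: "v \<in> partial_cochains sR sM n" "w \<in> partial_cochains sR sM n" for v w
  proof -
    obtain v' w' where "v' \<in> cochains sR sM n" "w' \<in> cochains sR sM n"
      "v = cochain_partial sM v'" "w = cochain_partial sM w'"
      using vw by (auto simp: partial_cochains_def)
    then show ?thesis unfolding partial_cochains_def
      by (intro image_eqI[of _ _ "\<lambda>as ls. v' as ls + w' as ls"])
        (auto simp: cochain_space_def cochains_add cochain_partial_def M.scale_right_distrib fun_eq_iff)
  qed
  show "c \<odot>\<^bsub>cochain_space sR sM n\<^esub> v \<in> partial_cochains sR sM n"
    if v: "v \<in> partial_cochains sR sM n" for c v
  proof -
    obtain v' where "v' \<in> cochains sR sM n" "v = cochain_partial sM v'"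
      using v by (auto simp: partial_cochains_def)
    then show ?thesis unfolding partial_cochains_def
      by (intro image_eqI[of _ _ "\<lambda>as ls. sM [:c:] (v' as ls)"])
        (auto simp: cochain_space_def cochains_const cochain_partial_def fun_eq_iff mult.commute)
  qed
qed

sublocale basic: vs_quotient_complex "cochain_space sR sM" "differential br sM act" "partial_cochains sR sM"
proof (intro vs_quotient_complex.intro vs_complex.intro vs_quotient_complex_axioms.intro)
  fix n x y c
  show "vectorspace class_ring (cochain_space sR sM n)" by (rule vectorspace_cochain_space)
  show "submodule class_ring (partial_cochains sR sM n) (cochain_space sR sM n)"
    by (rule partial_cochains_submodule)
  show "x \<in> partial_cochains sR sM n \<Longrightarrow> differential br sM act n x \<in> partial_cochains sR sM (Suc n)"
    by (auto simp: partial_cochains_def differential_partial differential_cochains)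
  assume "x \<in> carrier (cochain_space sR sM n)"
  then have x: "x \<in> cochains sR sM n" by (simp add: cochain_space_def)
  show "differential br sM act n x \<in> carrier (cochain_space sR sM (Suc n))"
    using differential_cochains[OF x] by (simp add: cochain_space_def)
  show "differential br sM act (Suc n) (differential br sM act n x) = \<zero>\<^bsub>cochain_space sR sM (Suc (Suc n))\<^esub>"
    using differential_differential[OF x] by (simp add: cochain_space_def)
  show "differential br sM act n (c \<odot>\<^bsub>cochain_space sR sM n\<^esub> x) =
      c \<odot>\<^bsub>cochain_space sR sM (Suc n)\<^esub> differential br sM act n x"
    using x cochains_const[OF x] by (simp add: cochain_space_def differential_cochain dif_const fun_eq_iff)
  assume "y \<in> carrier (cochain_space sR sM n)"
  then have y: "y \<in> cochains sR sM n" by (simp add: cochain_space_def)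
  show "differential br sM act n (x \<oplus>\<^bsub>cochain_space sR sM n\<^esub> y) =
      differential br sM act n x \<oplus>\<^bsub>cochain_space sR sM (Suc n)\<^esub> differential br sM act n y"
    using x y cochains_add[OF x y] by (simp add: cochain_space_def differential_cochain dif_add fun_eq_iff)
qed

subsection \<open>Vanishing of reduced cohomology\<close>

text \<open>Each bracket is \<partial> applied to the j-th argument, that is, multiplication by
  minus the j-th parameter; since bracket terms enter \<open>lie\<close> with a minus sign, the
  parameters add up with positive sign.\<close>

lemma lie_partial_element:
  assumes x: "\<And>y. br 0 x y = sR [:0, 1:] y" "\<And>v. act 0 x v = sM [:c, 1:] v"
  shows "length as = length ls \<Longrightarrow> sesquilinear \<gamma> \<Longrightarrow>
    lie x 0 \<gamma> as ls = sM [:c + sum_list ls, 1:] (\<gamma> as ls)"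
proof (induction as ls arbitrary: \<gamma> rule: list_induct2)
  case Nil
  then show ?case by (simp add: x)
next
  case (Cons y as m ls)
  then have "lie x 0 \<gamma> (y # as) (m # ls) =
      sM [:c + sum_list ls, 1:] (\<gamma> (y # as) (m # ls)) - sM [:- m:] (\<gamma> (y # as) (m # ls))"
    by (simp add: x Cons.IH[OF sesquilinear_contr] sesquilinear_hd contr_apply)
  then show ?case by (simp add: add_ac flip: M.scale_left_diff_distrib)
qed

lemma cochains_diff:
  assumes "\<gamma> \<in> cochains sR sM n" "\<delta> \<in> cochains sR sM n"
  shows "(\<lambda>as ls. \<gamma> as ls - \<delta> as ls) \<in> cochains sR sM n"
  using cochains_add[OF assms(1) cochains_const[OF assms(2), of "- 1"]] by (simp add: M.scale_pCons_minus_1)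

lemma differential_const:
  assumes "\<gamma> \<in> cochains sR sM n"
  shows "differential br sM act n (\<lambda>as ls. sM [:c:] (\<gamma> as ls)) as ls =
    sM [:c:] (differential br sM act n \<gamma> as ls)"
  by (simp add: differential_cochain[OF assms] differential_cochain[OF cochains_const[OF assms]] dif_const)

lemma reduced_cohomology_eq:
  "reduced_cohomology sR br sM act = cohomology basic.Q basic.dQ"
  unfolding reduced_cohomology_def reduced_cochain_space_def[abs_def] reduced_differential_def[abs_def] ..

text \<open>Contraction with \<open>x\<close> at \<open>\<lambda> = 0\<close> is a homotopy between \<open>0\<close> and \<open>\<partial> + c\<close>, and \<open>\<partial>\<close> acts
  as zero on the reduced complex.\<close>

lemma reduced_cohomology_vanishes:
  assumes x: "\<And>y. br 0 x y = sR [:0, 1:] y" "\<And>v. act 0 x v = sM [:c, 1:] v" and c: "c \<noteq> 0"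
  shows "has_dim (reduced_cohomology sR br sM act q) 0"
  unfolding reduced_cohomology_eq
proof (rule basic.has_dim_quotient_cohomology_0I)
  fix \<gamma> assume "\<gamma> \<in> carrier (cochain_space sR sM q)"
    and d: "differential br sM act q \<gamma> \<in> partial_cochains sR sM (Suc q)"
  then have g: "\<gamma> \<in> cochains sR sM q" by (simp add: cochain_space_def)
  from d obtain \<beta> where b: "\<beta> \<in> cochains sR sM (Suc q)"
    "differential br sM act q \<gamma> = cochain_partial sM \<beta>" by (auto simp: partial_cochains_def)
  \<comment> \<open>Write D for \<partial> plus the sum of the parameters and i for contraction with
    (x, 0). As d\<gamma> = D\<beta>, Cartan's formula reads D(i\<beta>) = (D + c)\<gamma> -
    d(i\<gamma>). Solving for c\<gamma> and dividing by c gives \<gamma> = w + e.\<close>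
  define w where "w = cochain_partial sM (\<lambda>as ls. sM [:inverse c:] (contr x 0 \<beta> as ls - \<gamma> as ls))"
  define e where "e = (\<lambda>as ls. sM [:inverse c:] (dif (contr x 0 \<gamma>) as ls))"
  have w: "w \<in> partial_cochains sR sM q"
    unfolding partial_cochains_def w_def
    by (intro imageI cochains_const cochains_diff cochains_contr b g)
  have e: "e \<in> coboundaries (cochain_space sR sM) (differential br sM act) q"
  proof (cases q)
    case 0
    \<comment> \<open>In degree zero there is no argument to contract, so \<open>e\<close> is zero,
      the only coboundary.\<close>
    then have "contr x 0 \<gamma> = (\<lambda>as ls. 0)"
      using cochains_eq_0[OF g] by (simp add: contr_def fun_eq_iff)
    then have "dif (contr x 0 \<gamma>) as ls = 0" for as ls
      using dif_eq_0[OF cochains_zero[of "length as"], of as ls] by simp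
    then show ?thesis using 0 by (simp add: e_def cochain_space_def)
  next
    case (Suc n)
    then have h: "contr x 0 \<gamma> \<in> cochains sR sM n" using cochains_contr g by simp
    have "e = differential br sM act n (\<lambda>as ls. sM [:inverse c:] (contr x 0 \<gamma> as ls))"
      by (simp add: e_def differential_const[OF h] differential_cochain[OF h] fun_eq_iff)
    then show ?thesis using Suc cochains_const[OF h] by (simp add: cochain_space_def)
  qed
  have "\<gamma> as ls = w as ls + e as ls" for as ls
  proof (cases "length as = length ls")
    case True
    have "sM [:sum_list ls, 1:] (contr x 0 \<beta> as ls) = dif \<gamma> (x # as) (0 # ls)"
      unfolding b(2)[unfolded differential_cochain[OF g]] by (simp add: contr_apply cochain_partial_def)
    also have "\<dots> = sM [:c + sum_list ls, 1:] (\<gamma> as ls) - dif (contr x 0 \<gamma>) as ls"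
      using lie_partial_element[OF x True cochains_sesquilinear[OF g]] by simp
    finally have *: "sM [:sum_list ls, 1:] (contr x 0 \<beta> as ls) + dif (contr x 0 \<gamma>) as ls
        = sM [:c + sum_list ls, 1:] (\<gamma> as ls)" by simp
    have "w as ls + e as ls = sM [:inverse c:] (sM [:sum_list ls, 1:] (contr x 0 \<beta> as ls)
        + dif (contr x 0 \<gamma>) as ls - sM [:sum_list ls, 1:] (\<gamma> as ls))"
      by (simp add: w_def e_def cochain_partial_def M.scale_right_distrib M.scale_right_diff_distrib mult.commute)
    also have "\<dots> = sM [:inverse c:] (sM [:c:] (\<gamma> as ls))"
      unfolding * by (simp flip: M.scale_left_diff_distrib)
    also have "\<dots> = \<gamma> as ls" using c by (simp add: M.scale_pCons_1)
    finally show ?thesis ..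
  next
    case False
    then have "w as ls = 0" "e as ls = 0" "\<gamma> as ls = 0"
      using cochains_eq_0[OF g, of as ls] cochains_eq_0[OF b(1), of "x # as" "0 # ls"]
        balanced_dif[OF balanced_contr[OF cochains_balanced[OF g]], of x 0]
      by (auto simp: w_def e_def cochain_partial_def contr_apply balanced_def)
    then show ?thesis by simp
  qed
  then show "\<exists>w\<in>partial_cochains sR sM q.
      \<exists>b\<in>coboundaries (cochain_space sR sM) (differential br sM act) q.
        \<gamma> = w \<oplus>\<^bsub>cochain_space sR sM q\<^esub> b"
    using w e by (intro bexI[of _ w] bexI[of _ e]) (auto simp: cochain_space_def)
qed

end

section \<open>The Block type algebra\<close>

lemma cpoly_module_block: "cpoly_module block_scale"
  unfolding cpoly_module_def by (rule module_block_scale)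

lemma lookup_J: "Poly_Mapping.lookup (J i) k = (if i = k then 1 else 0)"
  by (simp add: J_def lookup_single when_def)

text \<open>Reduces additive statements to the elements p(\<partial>)J_i with arbitrary p.
  Sesquilinear identities for brackets thereby become identities between univariate
  polynomials.\<close>

lemma block_induct [case_names scale_J add]:
  assumes "\<And>p i. P (block_scale p (J i))" "\<And>a b. P a \<Longrightarrow> P b \<Longrightarrow> P (a + b)"
  shows "P a"
proof -
  interpret cpoly_module block_scale by (rule cpoly_module_block)
  have "P (\<Sum>i\<in>K. block_scale (Poly_Mapping.lookup a i) (J i))" if "finite K" for K
    using that assms(1)[of 0] by (induction K rule: finite_induct) (auto intro: assms)
  moreover have "(\<Sum>i\<in>Poly_Mapping.keys a. block_scale (Poly_Mapping.lookup a i) (J i)) = a"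
  proof (rule poly_mapping_eqI)
    fix k
    have "Poly_Mapping.lookup (\<Sum>i\<in>Poly_Mapping.keys a. block_scale (Poly_Mapping.lookup a i) (J i)) k =
        (\<Sum>i\<in>Poly_Mapping.keys a. if i = k then Poly_Mapping.lookup a i else 0)"
      unfolding lookup_sum by (intro sum.cong refl) (simp add: lookup_block_scale lookup_J)
    also have "\<dots> = Poly_Mapping.lookup a k"
      by (simp add: sum.delta in_keys_iff)
    finally show "Poly_Mapping.lookup (\<Sum>i\<in>Poly_Mapping.keys a. block_scale (Poly_Mapping.lookup a i) (J i)) k =
        Poly_Mapping.lookup a k" .
  qed
  ultimately show ?thesis by (metis finite_keys)
qed

lemma block_bracket_scale_J:
  "block_bracket l (block_scale p (J i)) (block_scale q (J j)) =
    block_scale ([:poly p (- l):] * pcompose q [:l, 1:] * [:of_nat (i + j + 2) * l, of_nat (i + 1):]) (J (i + j))"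
proof -
  interpret cpoly_module block_scale by (rule cpoly_module_block)
  show ?thesis
    unfolding block_bracket_scale_left block_bracket_scale_right block_bracket_J scale_scale
    by (simp only: mult_ac)
qed

lemma complex_poly_eqI: "(\<And>t :: complex. poly p t = poly q t) \<Longrightarrow> p = q"
  using poly_eq_poly_eq_iff by blast

text \<open>For p(\<partial>)J_i and q(\<partial>)J_j both brackets are multiples of J_(i+j). At
  \<partial> = -(l + m) their coefficients are p(-l)q(-m) times (j+1)l - (i+1)m and its negative, so
  the sum is divisible by \<partial> + l + m.\<close>

lemma block_skew: "\<exists>z. block_bracket l x y + block_bracket m y x = block_scale [:l + m, 1:] z"
proof -
  interpret cpoly_module block_scale by (rule cpoly_module_block)
  show ?thesis
  proof (induction x rule: block_induct)
    case (scale_J p i)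
    show ?case
    proof (induction y rule: block_induct)
      case (scale_J q j)
      let ?r = "[:poly p (- l):] * pcompose q [:l, 1:] * [:of_nat (i + j + 2) * l, of_nat (i + 1):] +
        [:poly q (- m):] * pcompose p [:m, 1:] * [:of_nat (j + i + 2) * m, of_nat (j + 1):]"
      have "poly ?r (- (l + m)) = 0"
        by (simp add: poly_pcompose algebra_simps)
      then have "[:l + m, 1:] dvd ?r"
        by (simp only: poly_eq_0_iff_dvd minus_minus)
      then obtain r where r: "?r = [:l + m, 1:] * r" by (auto elim: dvdE)
      show ?case
        unfolding block_bracket_scale_J add.commute[of j i]
        by (rule exI[of _ "block_scale r (J (i + j))"])
          (use r in \<open>simp only: scale_left_distrib[symmetric] scale_scale add.commute[of j i]\<close>)
    next
      case (add a b)
      then obtain z z' where "block_bracket l (block_scale p (J i)) a + block_bracket m a (block_scale p (J i))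
          = block_scale [:l + m, 1:] z"
        "block_bracket l (block_scale p (J i)) b + block_bracket m b (block_scale p (J i))
          = block_scale [:l + m, 1:] z'" by blast
      then show ?case
        by (intro exI[of _ "z + z'"])
          (simp only: block_bracket_add_left block_bracket_add_right scale_right_distrib add_ac, metis add.commute add.left_commute)
    qed
  next
    case (add a b)
    then obtain z z' where "block_bracket l a y + block_bracket m y a = block_scale [:l + m, 1:] z"
      "block_bracket l b y + block_bracket m y b = block_scale [:l + m, 1:] z'" by blast
    then show ?case
      by (intro exI[of _ "z + z'"])
        (simp only: block_bracket_add_left block_bracket_add_right scale_right_distrib add_ac, metis add.commute add.left_commute)
  qed
qed

lemma block_jacobi:
  "block_bracket l x (block_bracket m y z) =
    block_bracket (l + m) (block_bracket l x y) z + block_bracket m y (block_bracket l x z)"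
proof (induction x rule: block_induct)
  case (scale_J p i)
  show ?case
  proof (induction y rule: block_induct)
    case (scale_J q j)
    show ?case
    proof (induction z rule: block_induct)
      case (scale_J r k)
      interpret cpoly_module block_scale by (rule cpoly_module_block)
      have n: "i + (j + k) = i + j + k" "j + (i + k) = i + j + k" by auto
      show ?case
        unfolding block_bracket_scale_J n scale_left_distrib[symmetric]
        by (rule arg_cong[where f = "\<lambda>p. block_scale p (J (i + j + k))"], rule complex_poly_eqI)
          (simp add: poly_pcompose algebra_simps)
    next
      case (add a b)
      then show ?case by (simp add: block_bracket_add_right add_ac)
    qed
  next
    case (add a b)
    then show ?case by (simp add: block_bracket_add_left block_bracket_add_right add_ac)
  qed
next
  case (add a b)
  then show ?case by (simp add: block_bracket_add_left block_bracket_add_right add_ac)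
qed

lemma block_polynomial: "polynomial_fun block_scale 1 (\<lambda>ls. block_bracket (ls ! 0) x y)"
proof -
  interpret cpoly_module block_scale by (rule cpoly_module_block)
  have l: "poly_expr 1 (\<lambda>ls. ls ! 0)" by (rule poly_expr_nth) simp
  have "polynomial_fun block_scale 1 (\<lambda>ls. block_scale
          ([:poly p (- (ls ! 0)):] * pcompose q [:ls ! 0, 1:] *
           [:of_nat (i + j + 2) * ls ! 0, of_nat (i + 1):]) (J (i + j)))" for p q i j
  proof -
    have "poly_expr 1 (\<lambda>ls. poly (pcompose p [:0, - 1:]) (ls ! 0))"
      by (rule poly_expr_poly[OF l])
    then have a: "poly_expr 1 (\<lambda>ls. poly p (- (ls ! 0)))" by (simp add: poly_pcompose)
    have b: "poly_expr 1 (\<lambda>ls. of_nat (i + j + 2) * ls ! 0)"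
      by (intro poly_expr_mult poly_expr_const l)
    have "polynomial_fun block_scale 1 (\<lambda>ls. block_scale [:poly p (- (ls ! 0)):]
       (block_scale (pcompose q [:ls ! 0, 1:])
         (block_scale [:of_nat (i + j + 2) * ls ! 0:] (J (i + j)) + block_scale [:0, of_nat (i + 1):] (J (i + j)))))"
      by (intro polynomial_fun_scale a b polynomial_fun_pcompose polynomial_fun_add polynomial_fun_const l)
    moreover have "[:of_nat (i + j + 2) * c, of_nat (i + 1):] =
        [:of_nat (i + j + 2) * c:] + [:0, of_nat (i + 1):]" for c :: complex by simp
    ultimately show ?thesis
      by (simp only: scale_left_distrib[symmetric] scale_scale mult.assoc)
  qed
  then show ?thesis unfolding block_bracket_def
    by (intro polynomial_fun_sum)
qed

lemma conformal_module_one_dim: "conformal_module block_scale (one_dim_scale a) block_bracket zero_act"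
proof (intro conformal_module.intro conformal_module_axioms.intro)
  interpret cpoly_module "one_dim_scale a" by (rule cpoly_module_one_dim)
  show "polynomial_fun (one_dim_scale a) 1 (\<lambda>ls. zero_act (ls ! 0) x v)" for x v
    by (simp add: zero_act_def polynomial_fun_0)
qed (rule cpoly_module_block cpoly_module_one_dim block_bracket_add_left block_bracket_add_right
    block_bracket_scale_left block_bracket_scale_right block_skew block_jacobi block_polynomial |
    simp add: zero_act_def one_dim_scale_def)+

text \<open>As i + j = 0 forces i = j = 0, taking the coefficient of \<open>J 0\<close> is a
  homomorphism onto the Virasoro conformal algebra. Both the action \<open>M_act\<close> and the
  cocycle \<open>vir_cocycle\<close> factor through it.\<close>

lemma lookup_block_bracket_0:
  "Poly_Mapping.lookup (block_bracket l x y) 0 =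
    [:poly (Poly_Mapping.lookup x 0) (- l):] * pcompose (Poly_Mapping.lookup y 0) [:l, 1:] * [:2 * l, 1:]"
proof (induction x rule: block_induct)
  case (scale_J p i)
  show ?case
  proof (induction y rule: block_induct)
    case (scale_J q j)
    show ?case
      unfolding block_bracket_scale_J
      by (simp add: lookup_block_scale lookup_J)
  next
    case (add a b)
    then show ?case by (simp add: block_bracket_add_right lookup_add pcompose_add algebra_simps)
  qed
next
  case (add a b)
  have "[:c + d:] = [:c:] + [:d:]" for c d :: complex by simp
  with add show ?case by (simp only: block_bracket_add_left lookup_add poly_add distrib_right)
qed

lemma conformal_module_M: "conformal_module block_scale M_scale block_bracket (M_act \<Delta> \<alpha>)"
proof (intro conformal_module.intro conformal_module_axioms.intro)
  show "cpoly_module M_scale" unfolding cpoly_module_def by (rule module_M_scale)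
  then interpret cpoly_module M_scale .
  show "M_act \<Delta> \<alpha> l (x + y) v = M_act \<Delta> \<alpha> l x v + M_act \<Delta> \<alpha> l y v" for l x y v
  proof -
    have "[:c + d:] = [:c:] + [:d:]" for c d :: complex by simp
    then show ?thesis by (simp only: M_act_def lookup_add poly_add distrib_right)
  qed
  show "M_act \<Delta> \<alpha> l x (v + w) = M_act \<Delta> \<alpha> l x v + M_act \<Delta> \<alpha> l x w" for l x v w
    by (simp only: M_act_def pcompose_add distrib_left distrib_right)
  show "M_act \<Delta> \<alpha> l x (M_act \<Delta> \<alpha> m y v) - M_act \<Delta> \<alpha> m y (M_act \<Delta> \<alpha> l x v) =
      M_act \<Delta> \<alpha> (l + m) (block_bracket l x y) v" for l m x y v
    unfolding M_act_def lookup_block_bracket_0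
    by (rule complex_poly_eqI) (simp add: poly_pcompose algebra_simps)
  show "polynomial_fun M_scale 1 (\<lambda>ls. M_act \<Delta> \<alpha> (ls ! 0) x v)" for x v
  proof -
    have l: "poly_expr 1 (\<lambda>ls. ls ! 0)" by (rule poly_expr_nth) simp
    have "poly_expr 1 (\<lambda>ls. poly (pcompose (Poly_Mapping.lookup x 0) [:0, - 1:]) (ls ! 0))"
      by (rule poly_expr_poly[OF l])
    then have a: "poly_expr 1 (\<lambda>ls. poly (Poly_Mapping.lookup x 0) (- (ls ! 0)))"
      by (simp add: poly_pcompose)
    have "polynomial_fun M_scale 1 (\<lambda>ls. M_scale [:poly (Poly_Mapping.lookup x 0) (- (ls ! 0)):]
       (M_scale (pcompose v [:ls ! 0, 1:]) (M_scale [:\<Delta> * ls ! 0:] 1 + [:\<alpha>, 1:])))"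
      by (intro polynomial_fun_scale a polynomial_fun_pcompose polynomial_fun_add polynomial_fun_const
          poly_expr_mult poly_expr_const l)
    then show ?thesis
      by (rule polynomial_fun_cong) (rule complex_poly_eqI, simp add: M_scale_def M_act_def algebra_simps)
  qed
qed (rule cpoly_module_block block_bracket_add_left block_bracket_add_right
    block_bracket_scale_left block_bracket_scale_right block_skew block_jacobi block_polynomial M_act_scale)+

lemma block_bracket_J_0: "block_bracket 0 (J 0) y = block_scale [:0, 1:] y"
proof (induction y rule: block_induct)
  case (scale_J q j)
  interpret cpoly_module block_scale by (rule cpoly_module_block)
  have "block_bracket 0 (J 0) (block_scale q (J j)) = block_scale (pcompose q [:0, 1:] * [:0, 1:]) (J j)"
    by (simp add: block_bracket_scale_right block_bracket_J)
  then show ?case by (simp add: pcompose_idR mult.commute)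
next
  case (add a b)
  interpret cpoly_module block_scale by (rule cpoly_module_block)
  from add show ?case by (simp add: block_bracket_add_right scale_right_distrib)
qed

lemma reduced_cohomology_one_dim:
  assumes "a \<noteq> 0"
  shows "has_dim (reduced_cohomology block_scale block_bracket (one_dim_scale a) zero_act q) 0"
proof -
  interpret conformal_module block_scale "one_dim_scale a" block_bracket zero_act
    by (rule conformal_module_one_dim)
  show ?thesis
    by (rule reduced_cohomology_vanishes[of "J 0" "- a"])
      (use assms in \<open>simp_all add: block_bracket_J_0 zero_act_def one_dim_scale_def\<close>)
qed

lemma reduced_cohomology_M:
  assumes "\<alpha> \<noteq> 0"
  shows "has_dim (reduced_cohomology block_scale block_bracket M_scale (M_act \<Delta> \<alpha>) q) 0"
proof -
  interpret conformal_module block_scale M_scale block_bracket "M_act \<Delta> \<alpha>"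
    by (rule conformal_module_M)
  show ?thesis
    by (rule reduced_cohomology_vanishes[of "J 0" \<alpha>])
      (use assms in \<open>simp_all add: block_bracket_J_0 M_act_def M_scale_def lookup_J pcompose_idR mult.commute\<close>)
qed

section \<open>Division by the sum of the variables\<close>

text \<open>Shifting the first variable by t turns both functions into polynomials in t that agree
  except possibly at t = \<open>- sum_list ls\<close>. Infinitely many common values make them
  equal, in particular at t = 0.\<close>

lemma polynomial_fun_one_dim_unique:
  assumes f: "polynomial_fun (one_dim_scale a) (Suc n) f"
    and g: "polynomial_fun (one_dim_scale a) (Suc n) g"
    and eq: "\<And>ls. length ls = Suc n \<Longrightarrow> sum_list ls * f ls = sum_list ls * g ls"
    and ls: "length ls = Suc n"
  shows "f ls = g ls"
proof -
  from ls obtain l ls' where ll: "ls = l # ls'" "length ls' = n" by (auto simp: length_Suc_conv)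
  let ?qs = "[:l, 1:] # map (\<lambda>c. [:c:]) ls'"
  have m: "map (\<lambda>q. poly q t) ?qs = (l + t) # ls'" for t by (simp add: o_def)
  obtain r1 where r1: "\<And>t. f ((l + t) # ls') = poly r1 t"
    using polynomial_fun_one_dim_line[OF f, of ?qs] ll m by auto
  obtain r2 where r2: "\<And>t. g ((l + t) # ls') = poly r2 t"
    using polynomial_fun_one_dim_line[OF g, of ?qs] ll m by auto
  have z: "poly (r1 - r2) t = 0" if "t \<noteq> - sum_list ls" for t
  proof -
    have "l + t + sum_list ls' \<noteq> 0"
    proof
      assume "l + t + sum_list ls' = 0"
      then have "t + sum_list ls = 0" using ll by (simp add: algebra_simps)
      with that show False by (simp add: eq_neg_iff_add_eq_0)
    qed
    then show ?thesis using eq[of "(l + t) # ls'"] ll r1 r2 by simp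
  qed
  have "r1 - r2 = 0"
  proof (rule ccontr)
    assume "r1 - r2 \<noteq> 0"
    then have "finite {t. poly (r1 - r2) t = 0}" by (rule poly_roots_finite)
    moreover have "UNIV - {- sum_list ls} \<subseteq> {t. poly (r1 - r2) t = 0}" using z by auto
    ultimately have "finite (UNIV - {- sum_list ls})" by (rule finite_subset[rotated])
    then show False using infinite_UNIV_char_0[where ?'a = complex] by simp
  qed
  then show ?thesis using r1[of 0] r2[of 0] ll by simp
qed

text \<open>The factor theorem in the first variable: f vanishes when that variable equals minus the
  sum S of the others, and subtracting this zero value makes every monomial a multiple of the
  difference.\<close>

lemma polynomial_fun_one_dim_div:
  assumes f: "polynomial_fun (one_dim_scale a) (Suc n) f"
    and zero: "\<And>ls. length ls = Suc n \<Longrightarrow> sum_list ls = 0 \<Longrightarrow> f ls = 0"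
  shows "\<exists>g. polynomial_fun (one_dim_scale a) (Suc n) g \<and>
    (\<forall>ls. length ls = Suc n \<longrightarrow> f ls = sum_list ls * g ls)"
proof -
  from f obtain E c where E: "finite E"
    and fE: "\<And>ls. length ls = Suc n \<Longrightarrow> f ls = (\<Sum>e\<in>E. (\<Prod>i<Suc n. (ls ! i) ^ (e i)) * c e)"
    unfolding polynomial_fun_def one_dim_scale_def by auto
  define S :: "complex list \<Rightarrow> complex" where "S ls = (\<Sum>i<n. ls ! Suc i)" for ls
  define Q :: "(nat \<Rightarrow> nat) \<Rightarrow> complex list \<Rightarrow> complex" where "Q e ls = (\<Prod>i<n. (ls ! Suc i) ^ (e (Suc i)))" for e ls
  \<comment> \<open>The inner sum is the quotient of x^n - y^n by x - y, for x the first variable, y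
    = -S and n the exponent of x.\<close>
  define g where "g ls = (\<Sum>e\<in>E. (\<Sum>t<e 0. (- 1 * S ls) ^ (e 0 - Suc t) * (ls ! 0) ^ t) * Q e ls * c e)" for ls
  have "poly_expr (Suc n) g"
    unfolding g_def S_def Q_def
    by (intro poly_expr_sum poly_expr_mult poly_expr_power poly_expr_prod poly_expr_const poly_expr_nth) auto
  then have g: "polynomial_fun (one_dim_scale a) (Suc n) g"
    by (rule polynomial_fun_one_dimI) simp
  have "f ls = sum_list ls * g ls" if l: "length ls = Suc n" for ls
  proof -
    from l obtain l0 ls' where ll: "ls = l0 # ls'" "length ls' = n" by (auto simp: length_Suc_conv)
    have S: "S ls = sum_list ls'"
      using ll by (simp add: S_def sum_list_sum_nth atLeast0LessThan)
    then have sum: "sum_list ls = ls ! 0 - - S ls" using ll by simp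
    have fe: "f ks = (\<Sum>e\<in>E. (ks ! 0) ^ e 0 * Q e ks * c e)" if "length ks = Suc n" for ks
      unfolding fE[OF that] Q_def prod.lessThan_Suc_shift by simp
    let ?k = "- S ls # ls'"
    have Qk: "Q e ?k = Q e ls" for e by (simp add: Q_def ll)
    have "sum_list ?k = 0" by (simp add: S)
    then have "f ?k = 0" using zero ll by simp
    then have "f ls = f ls - f ?k" by simp
    also have "\<dots> = (\<Sum>e\<in>E. (ls ! 0) ^ e 0 * Q e ls * c e) - (\<Sum>e\<in>E. (- S ls) ^ e 0 * Q e ls * c e)"
      using fe[of ?k] ll(2) by (simp add: Qk fe[OF l])
    also have "\<dots> = (\<Sum>e\<in>E. ((ls ! 0) ^ e 0 - (- S ls) ^ e 0) * Q e ls * c e)"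
      by (simp only: sum_subtractf[symmetric] left_diff_distrib)
    also have "\<dots> = sum_list ls * g ls"
      unfolding power_diff_sumr2 sum g_def by (simp add: mult.assoc flip: sum_distrib_left)
    finally show ?thesis .
  qed
  with g show ?thesis by blast
qed

section \<open>Cohomology with trivial coefficients\<close>

interpretation triv: conformal_module block_scale "one_dim_scale 0" block_bracket zero_act
  by (rule conformal_module_one_dim)

abbreviation "triv_cochains \<equiv> cochains block_scale (one_dim_scale 0)"
abbreviation "triv_partials \<equiv> partial_cochains block_scale (one_dim_scale 0)"
abbreviation "triv_d \<equiv> differential block_bracket (one_dim_scale 0) zero_act"

lemma triv_partial_apply: "cochain_partial (one_dim_scale 0) \<gamma> as ls = sum_list ls * \<gamma> as ls"
  by (simp add: cochain_partial_def one_dim_scale_def)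

text \<open>The value of \<gamma> at each argument list is divided by the sum of the variables
  separately, which gives no relation between the quotients. The cochain axioms for the quotients
  come from those for \<gamma> by uniqueness of division.\<close>

lemma triv_partialsI:
  assumes g: "\<gamma> \<in> triv_cochains (Suc n)"
    and zero: "\<And>as ls. length as = Suc n \<Longrightarrow> length ls = Suc n \<Longrightarrow> sum_list ls = 0 \<Longrightarrow> \<gamma> as ls = 0"
  shows "\<gamma> \<in> triv_partials (Suc n)"
proof -
  define G where "G as = (SOME g. polynomial_fun (one_dim_scale 0) (Suc n) g \<and>
    (\<forall>ls. length ls = Suc n \<longrightarrow> \<gamma> as ls = sum_list ls * g ls))" for as
  define \<delta> where "\<delta> as ls = (if length as = Suc n \<and> length ls = Suc n then G as ls else 0)" for as ls
  have G: "polynomial_fun (one_dim_scale 0) (Suc n) (G as) \<and>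
    (\<forall>ls. length ls = Suc n \<longrightarrow> \<gamma> as ls = sum_list ls * G as ls)" if "length as = Suc n" for as
    unfolding G_def
    by (rule someI_ex[OF polynomial_fun_one_dim_div[OF triv.cochains_polynomial[OF g that] zero[OF that]]])
  have dp: "polynomial_fun (one_dim_scale 0) (Suc n) (\<delta> as)" if "length as = Suc n" for as
    by (rule triv.M.polynomial_fun_cong[of _ "G as"]) (use G[OF that] that in \<open>auto simp: \<delta>_def\<close>)
  have dg: "\<gamma> as ls = sum_list ls * \<delta> as ls" for as ls
    using G[of as] triv.cochains_eq_0[OF g, of as ls] by (auto simp: \<delta>_def)
  \<comment> \<open>Each axiom for \<delta> is proved by naming the expected right-hand side h,
    showing it polynomial, and checking that its product with the sum of the variables is
    \<gamma>.\<close>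
  have uniq: "\<delta> as ls = h ls" if "length as = Suc n" "length ls = Suc n"
    "polynomial_fun (one_dim_scale 0) (Suc n) h"
    "\<And>ls. length ls = Suc n \<Longrightarrow> \<gamma> as ls = sum_list ls * h ls" for as ls h
    by (rule polynomial_fun_one_dim_unique[OF dp[OF that(1)] that(3) _ that(2)])
      (use that(4) dg[of as] in simp)
  have scale: "polynomial_fun (one_dim_scale 0) (Suc n) (\<lambda>ls. p ls * f ls)"
    if "poly_expr (Suc n) p" "polynomial_fun (one_dim_scale 0) (Suc n) f" for p f
    using triv.M.polynomial_fun_scale[OF that] by (simp add: one_dim_scale_def)
  have "\<delta> \<in> triv_cochains (Suc n)"
    unfolding cochains_def mem_Collect_eq
  proof (intro conjI allI impI; (elim conjE)?)
    fix as :: "block list" and ls :: "complex list" and i x y c p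
    show "length as \<noteq> Suc n \<or> length ls \<noteq> Suc n \<Longrightarrow> \<delta> as ls = 0"
      by (auto simp: \<delta>_def)
    assume as: "length as = Suc n"
    show "polynomial_fun (one_dim_scale 0) (Suc n) (\<delta> as)" by (rule dp[OF as])
    assume ls: "length ls = Suc n"
    {
      assume i: "i < Suc n"
      note u = triv.cochains_update[OF g as _ i]
      show "\<delta> (as[i := x + y]) ls = \<delta> (as[i := x]) ls + \<delta> (as[i := y]) ls"
      proof (rule uniq[OF _ ls])
        show "polynomial_fun (one_dim_scale 0) (Suc n) (\<lambda>ls. \<delta> (as[i := x]) ls + \<delta> (as[i := y]) ls)"
          by (intro triv.M.polynomial_fun_add dp) (simp_all add: as)
        show "\<gamma> (as[i := x + y]) ls = sum_list ls * (\<delta> (as[i := x]) ls + \<delta> (as[i := y]) ls)"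
          if "length ls = Suc n" for ls
          unfolding u(1)[OF that] by (simp add: dg distrib_left)
      qed (simp add: as)
      show "\<delta> (as[i := block_scale [:c:] x]) ls = one_dim_scale 0 [:c:] (\<delta> (as[i := x]) ls)"
      proof (rule uniq[OF _ ls])
        show "polynomial_fun (one_dim_scale 0) (Suc n) (\<lambda>ls. one_dim_scale 0 [:c:] (\<delta> (as[i := x]) ls))"
          by (intro triv.M.polynomial_fun_scale_fixed dp) (simp add: as)
        show "\<gamma> (as[i := block_scale [:c:] x]) ls = sum_list ls * one_dim_scale 0 [:c:] (\<delta> (as[i := x]) ls)"
          if "length ls = Suc n" for ls
          unfolding u(2)[OF that] by (simp add: dg one_dim_scale_def)
      qed (simp add: as)
      show "\<delta> (as[i := block_scale [:0, 1:] (as ! i)]) ls = one_dim_scale 0 [:- (ls ! i):] (\<delta> as ls)"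
      proof (rule uniq[OF _ ls])
        have "polynomial_fun (one_dim_scale 0) (Suc n) (\<lambda>ls. (- 1 * (ls ! i)) * \<delta> as ls)"
          by (intro scale dp poly_expr_mult poly_expr_const poly_expr_nth i as)
        then show "polynomial_fun (one_dim_scale 0) (Suc n) (\<lambda>ls. one_dim_scale 0 [:- (ls ! i):] (\<delta> as ls))"
          by (simp add: one_dim_scale_def)
        show "\<gamma> (as[i := block_scale [:0, 1:] (as ! i)]) ls =
            sum_list ls * one_dim_scale 0 [:- (ls ! i):] (\<delta> as ls)"
          if "length ls = Suc n" for ls
          unfolding u(3)[OF that] by (simp add: dg one_dim_scale_def)
      qed (simp add: as)
    }
    assume p: "p permutes {..<Suc n}"
    have sgn: "of_int (sign p) * of_int (sign p) = (1 :: complex)"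
      by (simp flip: of_int_mult)
    have "\<delta> as ls = of_int (sign p) * \<delta> (permute_list p as) (permute_list p ls)"
    proof (rule uniq[OF as ls])
      have "polynomial_fun (one_dim_scale 0) (Suc n) (\<lambda>ls. \<delta> (permute_list p as) (permute_list p ls))"
      proof (rule triv.M.polynomial_fun_compose)
        show "polynomial_fun (one_dim_scale 0) (Suc n) (\<delta> (permute_list p as))"
          by (rule dp) (simp add: as)
        show "poly_expr (Suc n) (\<lambda>ls. ls ! p i)" if "i < Suc n" for i
          using permutes_in_image[OF p, of i] that by (intro poly_expr_nth) simp
        show "permute_list p ls ! i = ls ! p i" if "i < Suc n" "length ls = Suc n" for i and ls :: "complex list"
          using permute_list_nth[of p ls i] p that by simp
      qed simp
      then show "polynomial_fun (one_dim_scale 0) (Suc n)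
          (\<lambda>ls. of_int (sign p) * \<delta> (permute_list p as) (permute_list p ls))"
        by (intro scale poly_expr_const)
      show "\<gamma> as ls = sum_list ls * (of_int (sign p) * \<delta> (permute_list p as) (permute_list p ls))"
        if l: "length ls = Suc n" for ls
      proof -
        have "sum_list (permute_list p ls) = sum_list ls"
          using mset_permute_list[of p ls] p l by (metis sum_mset_sum_list)
        then have "sum_list ls * (of_int (sign p) * \<delta> (permute_list p as) (permute_list p ls)) =
            of_int (sign p) * \<gamma> (permute_list p as) (permute_list p ls)"
          using dg[of "permute_list p as" "permute_list p ls"] by simp
        also have "\<dots> = of_int (sign p) * (of_int (sign p) * \<gamma> as ls)"
          using triv.skew_permute_list[OF triv.cochains_skew[OF g] p as l] by (simp add: one_dim_scale_def)
        finally show ?thesis using sgn by (simp flip: mult.assoc)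
      qed
    qed
    then show "\<delta> (permute_list p as) (permute_list p ls) = one_dim_scale 0 [:of_int (sign p):] (\<delta> as ls)"
      using sgn by (simp add: one_dim_scale_def flip: mult.assoc)
  qed
  moreover have "\<gamma> = cochain_partial (one_dim_scale 0) \<delta>"
    by (simp add: fun_eq_iff triv_partial_apply dg)
  ultimately show ?thesis by (simp add: partial_cochains_def)
qed

text \<open>At a fixed point \<open>ls\<close>, a coefficient p(\<partial>) in an argument
  contributes only a scalar. Basis elements therefore suffice pointwise, so the criterion also
  applies on the hyperplane alone.\<close>

lemma triv_cochain_eq_0:
  assumes "\<gamma> \<in> triv_cochains n" "\<And>is. length is = n \<Longrightarrow> \<gamma> (map J is) ls = 0"
  shows "\<gamma> as ls = 0"
  using assms
proof (induction n arbitrary: \<gamma> as ls)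
  case 0
  show ?case
  proof (cases as)
    case Nil
    then show ?thesis using 0(2)[of "[]"] by simp
  next
    case (Cons x as')
    then show ?thesis using triv.cochains_eq_0[OF 0(1)] by simp
  qed
next
  case (Suc n)
  show ?case
  proof (cases "length as = Suc n \<and> length ls = Suc n")
    case False
    then show ?thesis using triv.cochains_eq_0[OF Suc.prems(1)] by blast
  next
    case True
    then obtain x as' l ls' where s: "as = x # as'" "ls = l # ls'" by (auto simp: length_Suc_conv)
    have J: "\<gamma> (J i # as') (l # ls') = 0" for i
    proof -
      have "triv.contr (J i) l \<gamma> as' ls' = 0"
      proof (rule Suc.IH)
        show "triv.contr (J i) l \<gamma> \<in> triv_cochains n" by (rule triv.cochains_contr[OF Suc.prems(1)])
        show "triv.contr (J i) l \<gamma> (map J is) ls' = 0" if "length is = n" for "is"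
          using Suc.prems(2)[of "i # is"] that s by (simp add: triv.contr_apply)
      qed
      then show ?thesis by (simp add: triv.contr_apply)
    qed
    have "\<gamma> (x # as') (l # ls') = 0"
    proof (induction x rule: block_induct)
      case (scale_J p i)
      then show ?case
        using triv.sesquilinear_hd[OF triv.cochains_sesquilinear[OF Suc.prems(1)]] J
        by (simp add: one_dim_scale_def)
    next
      case (add a b)
      then show ?case
        using triv.multiadditive_hd[OF triv.cochains_multiadditive[OF Suc.prems(1)]] by simp
    qed
    then show ?thesis using s by simp
  qed
qed

lemma triv_dif_1: "triv.dif \<gamma> [x, y] [l, m] = - \<gamma> [block_bracket l x y] [l + m]"
  by (simp add: zero_act_def triv.contr_apply)

lemma triv_dif_2: "triv.dif \<gamma> [x, y, z] [l, m, k] =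
    - \<gamma> [block_bracket l x y, z] [l + m, k] - \<gamma> [y, block_bracket l x z] [m, l + k]
    + \<gamma> [x, block_bracket m y z] [l, m + k]"
  by (simp add: zero_act_def triv.contr_apply)

text \<open>Sesquilinearity substitutes \<partial> = -(l + m) into (i+1)\<partial> +
  (i+j+2)l.\<close>

lemma triv_bracket_hd:
  assumes "\<gamma> \<in> triv_cochains n"
  shows "\<gamma> (block_bracket l (J i) (J j) # as) ((l + m) # ls) =
    ((of_nat j + 1) * l - (of_nat i + 1) * m) * \<gamma> (J (i + j) # as) ((l + m) # ls)"
  unfolding block_bracket_J triv.sesquilinear_hd[OF triv.cochains_sesquilinear[OF assms]]
  by (simp add: one_dim_scale_def algebra_simps)

lemma triv_bracket_snd:
  assumes "\<gamma> \<in> triv_cochains n"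
  shows "\<gamma> [y, block_bracket l (J i) (J j)] [m, k] =
    ((of_nat (i + j) + 2) * l - (of_nat i + 1) * k) * \<gamma> [y, J (i + j)] [m, k]"
  using triv.sesquilinearD[OF triv.cochains_sesquilinear[OF assms], of "[y]" "[m]"
      "[:of_nat (i + j + 2) * l, of_nat (i + 1):]" "J (i + j)" "[]" k "[]"]
  by (simp add: block_bracket_J one_dim_scale_def algebra_simps)

subsection \<open>Degrees zero and one\<close>

definition unit_cochain :: "block list \<Rightarrow> complex list \<Rightarrow> complex" where
  "unit_cochain as ls = (if as = [] \<and> ls = [] then 1 else 0)"

lemma unit_cochain: "unit_cochain \<in> triv_cochains 0"
proof (rule triv.cochainsI)
  show "polynomial_fun (one_dim_scale 0) 0 (unit_cochain as)" if "length as = 0" for as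
    by (rule polynomial_fun_one_dimI[OF poly_expr_const[of _ 1]]) (use that in \<open>simp add: unit_cochain_def\<close>)
qed (auto simp: unit_cochain_def triv.multiadditive_def triv.sesquilinear_def triv.skew_def)

lemma unit_cochain_nonzero: "unit_cochain \<noteq> (\<lambda>as ls. 0)"
proof
  assume "unit_cochain = (\<lambda>as ls. 0)"
  from fun_cong[OF fun_cong[OF this, of "[]"], of "[]"] have "unit_cochain [] [] = 0" .
  then show False by (simp add: unit_cochain_def)
qed

lemma triv_d_0:
  assumes "\<gamma> \<in> triv_cochains 0"
  shows "triv_d 0 \<gamma> = (\<lambda>as ls. 0)"
proof (intro ext)
  fix as ls
  show "triv_d 0 \<gamma> as ls = 0"
  proof (cases "length as = 1 \<and> length ls = 1")
    case True
    then show ?thesis by (simp add: differential_def zero_act_def one_dim_scale_def)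
  next
    case False
    then show ?thesis unfolding differential_def by (intro if_not_P) simp
  qed
qed

lemma triv_cochain_0_eq:
  assumes "\<gamma> \<in> triv_cochains 0"
  obtains c where "\<gamma> = (\<lambda>as ls. c * unit_cochain as ls)"
proof
  show "\<gamma> = (\<lambda>as ls. \<gamma> [] [] * unit_cochain as ls)"
  proof (intro ext)
    fix as ls
    show "\<gamma> as ls = \<gamma> [] [] * unit_cochain as ls"
      using triv.cochains_eq_0[OF assms, of as ls] by (cases "as = [] \<and> ls = []") (auto simp: unit_cochain_def)
  qed
qed

lemma triv_basic_cohomology_0:
  "has_dim (basic_cohomology block_scale block_bracket (one_dim_scale 0) zero_act 0) 1"
  unfolding basic_cohomology_def
proof (rule triv.basic.has_dim_cohomology_1I[of unit_cochain])
  show "unit_cochain \<in> cocycles (cochain_space block_scale (one_dim_scale 0)) triv_d 0"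
    using unit_cochain triv_d_0[OF unit_cochain] by (simp add: cocycles_def cochain_space_def)
  show "unit_cochain \<notin> coboundaries (cochain_space block_scale (one_dim_scale 0)) triv_d 0"
    using unit_cochain_nonzero by (simp add: cochain_space_def)
  fix \<gamma> assume "\<gamma> \<in> cocycles (cochain_space block_scale (one_dim_scale 0)) triv_d 0"
  then have "\<gamma> \<in> triv_cochains 0" by (simp add: cocycles_def cochain_space_def)
  then obtain c where "\<gamma> = (\<lambda>as ls. c * unit_cochain as ls)" by (rule triv_cochain_0_eq)
  then show "\<exists>c. \<exists>w\<in>coboundaries (cochain_space block_scale (one_dim_scale 0)) triv_d 0.
      \<gamma> = w \<oplus>\<^bsub>cochain_space block_scale (one_dim_scale 0) 0\<^esub>
        c \<odot>\<^bsub>cochain_space block_scale (one_dim_scale 0) 0\<^esub> unit_cochain"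
    by (intro exI[of _ c]) (simp add: cochain_space_def one_dim_scale_def)
qed

text \<open>On 0-cochains with trivial coefficients \<partial> acts as an empty sum, so reduction
  does not change degree zero.\<close>

lemma triv_partials_0:
  assumes "w \<in> triv_partials 0"
  shows "w = (\<lambda>as ls. 0)"
proof -
  from assms obtain \<beta> where b: "\<beta> \<in> triv_cochains 0" "w = cochain_partial (one_dim_scale 0) \<beta>"
    by (auto simp: partial_cochains_def)
  have "sum_list ls * \<beta> as ls = 0" for as ls
    using triv.cochains_eq_0[OF b(1), of as ls] by (cases ls) auto
  then show ?thesis unfolding b(2) triv_partial_apply[abs_def] by (intro ext)
qed

lemma triv_zero_partial: "(\<lambda>as ls. 0) \<in> triv_partials n"
  using triv.basic.W.W_zero[of n] by (simp add: cochain_space_def)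

lemma triv_reduced_cohomology_0:
  "has_dim (reduced_cohomology block_scale block_bracket (one_dim_scale 0) zero_act 0) 1"
  unfolding triv.reduced_cohomology_eq
proof (rule triv.basic.has_dim_quotient_cohomology_1I[of unit_cochain])
  show "unit_cochain \<in> carrier (cochain_space block_scale (one_dim_scale 0) 0)"
    using unit_cochain by (simp add: cochain_space_def)
  show "triv_d 0 unit_cochain \<in> triv_partials (Suc 0)"
    unfolding triv_d_0[OF unit_cochain] by (rule triv_zero_partial)
  fix w b assume "w \<in> triv_partials 0"
    and b: "b \<in> coboundaries (cochain_space block_scale (one_dim_scale 0)) triv_d 0"
  then have "w = (\<lambda>as ls. 0)" "b = (\<lambda>as ls. 0)" using triv_partials_0 by (auto simp: cochain_space_def)
  then show "unit_cochain \<noteq> w \<oplus>\<^bsub>cochain_space block_scale (one_dim_scale 0) 0\<^esub> b"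
    using unit_cochain_nonzero by (simp add: cochain_space_def)
next
  fix \<gamma> assume "\<gamma> \<in> carrier (cochain_space block_scale (one_dim_scale 0) 0)"
  then have "\<gamma> \<in> triv_cochains 0" by (simp add: cochain_space_def)
  then obtain c where "\<gamma> = (\<lambda>as ls. c * unit_cochain as ls)" by (rule triv_cochain_0_eq)
  then show "\<exists>c. \<exists>w\<in>triv_partials 0. \<exists>b\<in>coboundaries (cochain_space block_scale (one_dim_scale 0)) triv_d 0.
      \<gamma> = w \<oplus>\<^bsub>cochain_space block_scale (one_dim_scale 0) 0\<^esub>
        (b \<oplus>\<^bsub>cochain_space block_scale (one_dim_scale 0) 0\<^esub>
          c \<odot>\<^bsub>cochain_space block_scale (one_dim_scale 0) 0\<^esub> unit_cochain)"
    by (intro exI[of _ c] bexI[OF _ triv_zero_partial])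
      (simp add: cochain_space_def one_dim_scale_def)
qed

lemma triv_basic_cohomology_1:
  "has_dim (basic_cohomology block_scale block_bracket (one_dim_scale 0) zero_act 1) 0"
  unfolding basic_cohomology_def
proof (rule triv.basic.has_dim_cohomology_0I, rule subsetI)
  fix \<gamma> assume "\<gamma> \<in> cocycles (cochain_space block_scale (one_dim_scale 0)) triv_d 1"
  then have g: "\<gamma> \<in> triv_cochains 1" and d: "triv_d 1 \<gamma> = (\<lambda>as ls. 0)"
    by (simp_all add: cocycles_def cochain_space_def)
  have J: "\<gamma> [J j] [t] = 0" for j t
  proof -
    \<comment> \<open>Solves (j+1)l - (t - l) = 1, so that the differential at
      \<open>[J 0, J j]\<close> and \<open>[l, t - l]\<close> is exactly
      \<open>- \<gamma> [J j] [t]\<close>. Every 1-cocycle is thus zero.\<close>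
    define l where "l = (t + 1) / (of_nat j + 2)"
    have j: "of_nat j + 2 \<noteq> (0 :: complex)"
      using of_nat_eq_0_iff[of "j + 2", where ?'a = complex] by (simp add: add.commute)
    have "(of_nat j + 1) * l - (of_nat 0 + 1) * (t - l) = (of_nat j + 2) * l - t"
      by (simp add: algebra_simps)
    also have "\<dots> = 1" using j by (simp add: l_def)
    finally have c: "(of_nat j + 1) * l - (of_nat 0 + 1) * (t - l) = (1 :: complex)" .
    have "triv.dif \<gamma> [J 0, J j] [l, t - l] = 0"
      using d[unfolded triv.differential_cochain[OF g]] by (simp only:)
    then show ?thesis
      using triv_bracket_hd[OF g, of l 0 j "[]" "t - l" "[]", unfolded c] by (simp add: triv_dif_1 del: triv.dif.simps)
  qed
  have "\<gamma> as ls = 0" for as ls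
  proof (cases "length ls = 1")
    case True
    show ?thesis
    proof (rule triv_cochain_eq_0[OF g])
      fix "is" :: "nat list" assume "length is = 1"
      then show "\<gamma> (map J is) ls = 0" using True J by (auto simp: length_Suc_conv)
    qed
  next
    case False
    then show ?thesis using triv.cochains_eq_0[OF g] by simp
  qed
  then have "\<gamma> = \<zero>\<^bsub>cochain_space block_scale (one_dim_scale 0) 1\<^esub>"
    by (simp add: cochain_space_def fun_eq_iff)
  then show "\<gamma> \<in> coboundaries (cochain_space block_scale (one_dim_scale 0)) triv_d 1"
    using triv.basic.coboundaries_closed(1) by (simp only:)
qed

text \<open>If \<open>d\<gamma>\<close> vanishes for \<open>\<lambda>\<^sub>1 + \<lambda>\<^sub>2 = 0\<close>, then so does \<open>\<gamma>\<close> for \<open>\<lambda> = 0\<close>.\<close>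

lemma triv_1_partial:
  assumes g: "\<gamma> \<in> triv_cochains 1"
    and d: "\<And>j. triv.dif \<gamma> [J 0, J j] [1, - 1] = 0"
  shows "\<gamma> \<in> triv_partials 1"
proof -
  have J: "\<gamma> [J j] [0] = 0" for j
  proof -
    \<comment> \<open>At the parameters 1 and -1 the bracket of \<open>J 0\<close> and
      \<open>J j\<close> has coefficient (j+1) + 1.\<close>
    have "of_nat j + 2 \<noteq> (0 :: complex)"
      using of_nat_eq_0_iff[of "j + 2", where ?'a = complex] by (simp add: add.commute)
    then show ?thesis
      using d[of j] triv_bracket_hd[OF g, of 1 0 j "[]" "- 1" "[]"]
      by (simp add: triv_dif_1 add.commute del: triv.dif.simps)
  qed
  have "\<gamma> as [0] = 0" for as
  proof (rule triv_cochain_eq_0[OF g])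
    fix "is" :: "nat list" assume "length is = 1"
    then show "\<gamma> (map J is) [0] = 0" using J by (auto simp: length_Suc_conv)
  qed
  then have "\<gamma> as ls = 0" if "length ls = 1" "sum_list ls = 0" for as ls
    using that by (auto simp: length_Suc_conv)
  then show ?thesis using triv_partialsI[of \<gamma> 0] g by simp
qed

lemma triv_reduced_cohomology_1:
  "has_dim (reduced_cohomology block_scale block_bracket (one_dim_scale 0) zero_act 1) 0"
  unfolding triv.reduced_cohomology_eq
proof (rule triv.basic.has_dim_quotient_cohomology_0I)
  fix \<gamma> assume "\<gamma> \<in> carrier (cochain_space block_scale (one_dim_scale 0) 1)"
    and d: "triv_d 1 \<gamma> \<in> triv_partials (Suc 1)"
  then have g: "\<gamma> \<in> triv_cochains 1" by (simp add: cochain_space_def)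
  have "triv.dif \<gamma> as [1, - 1] = 0" for as
    using d unfolding triv.differential_cochain[OF g]
    by (auto simp: partial_cochains_def triv_partial_apply)
  then have w: "\<gamma> \<in> triv_partials 1" by (intro triv_1_partial g)
  have "\<zero>\<^bsub>cochain_space block_scale (one_dim_scale 0) 1\<^esub> \<in>
      coboundaries (cochain_space block_scale (one_dim_scale 0)) triv_d 1"
    by (rule triv.basic.coboundaries_closed)
  with w show "\<exists>w\<in>triv_partials 1.
      \<exists>b\<in>coboundaries (cochain_space block_scale (one_dim_scale 0)) triv_d 1.
        \<gamma> = w \<oplus>\<^bsub>cochain_space block_scale (one_dim_scale 0) 1\<^esub> b"
    by (intro bexI[of _ \<gamma>] bexI[of _ "\<zero>\<^bsub>cochain_space block_scale (one_dim_scale 0) 1\<^esub>"])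
      (auto simp: cochain_space_def)
qed

subsection \<open>Degree two\<close>

lemma triv_basic_cohomology_2:
  "has_dim (basic_cohomology block_scale block_bracket (one_dim_scale 0) zero_act 2) 0"
  unfolding basic_cohomology_def
proof (rule triv.basic.has_dim_cohomology_0I, rule subsetI)
  fix \<gamma> assume "\<gamma> \<in> cocycles (cochain_space block_scale (one_dim_scale 0)) triv_d 2"
  then have g: "\<gamma> \<in> triv_cochains 2" and d: "triv_d 2 \<gamma> = (\<lambda>as ls. 0)"
    by (simp_all add: cocycles_def cochain_space_def)
  let ?\<psi> = "triv.contr (J 0) 0 \<gamma>"
  have psi: "?\<psi> \<in> triv_cochains 1"
    using triv.cochains_contr[of \<gamma> 1] g by (simp add: numeral_2_eq_2)
  have cartan: "sum_list ls * \<gamma> as ls = triv.dif ?\<psi> as ls" if "length as = length ls" for as ls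
  proof -
    have "triv.dif \<gamma> (J 0 # as) (0 # ls) = 0"
      using d[unfolded triv.differential_cochain[OF g]] by (simp only:)
    moreover have "triv.lie (J 0) 0 \<gamma> as ls = sum_list ls * \<gamma> as ls"
      using triv.lie_partial_element[of "J 0" 0 as ls \<gamma>] that triv.cochains_sesquilinear[OF g]
      by (simp add: block_bracket_J_0 zero_act_def one_dim_scale_def)
    ultimately show ?thesis by simp
  qed
  have "triv.dif ?\<psi> [J 0, J j] [1, - 1] = 0" for j
    using cartan[of "[J 0, J j]" "[1, - 1]"] by simp
  \<comment> \<open>By \<open>cartan\<close>, d\<psi> vanishes where the two parameters sum to zero,
    hence \<psi> = \<partial>\<delta>. As d commutes with \<partial>, \<gamma> and d\<delta> agree
    after multiplication by the sum of the parameters, which is then cancelled.\<close>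
  then obtain \<delta> where del: "\<delta> \<in> triv_cochains 1" "?\<psi> = cochain_partial (one_dim_scale 0) \<delta>"
    using triv_1_partial[OF psi] by (auto simp: partial_cochains_def)
  have dd: "triv_d 1 \<delta> \<in> triv_cochains 2"
    using triv.differential_cochains[OF del(1)] by (simp add: numeral_2_eq_2)
  have "\<gamma> as ls = triv_d 1 \<delta> as ls" for as ls
  proof (cases "length as = 2 \<and> length ls = 2")
    case True
    have e: "sum_list ks * \<gamma> as ks = sum_list ks * triv_d 1 \<delta> as ks" if "length ks = 2" for ks
    proof -
      have "sum_list ks * \<gamma> as ks = triv_d 1 (cochain_partial (one_dim_scale 0) \<delta>) as ks"
        using cartan[of as ks] that True triv.differential_cochain[OF psi] del(2) by simp
      also have "\<dots> = sum_list ks * triv_d 1 \<delta> as ks"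
        unfolding triv.differential_partial[OF del(1)] triv_partial_apply ..
      finally show ?thesis .
    qed
    show ?thesis
      by (rule polynomial_fun_one_dim_unique[where a = 0 and n = 1])
        (use triv.cochains_polynomial[OF g] triv.cochains_polynomial[OF dd] True e
          in \<open>auto simp: numeral_2_eq_2\<close>)
  next
    case False
    then have "\<gamma> as ls = 0" "triv_d 1 \<delta> as ls = 0"
      using triv.cochains_eq_0[OF g, of as ls] triv.cochains_eq_0[OF dd, of as ls] by auto
    then show ?thesis by simp
  qed
  then have "\<gamma> = triv_d 1 \<delta>" by (simp add: fun_eq_iff)
  then show "\<gamma> \<in> coboundaries (cochain_space block_scale (one_dim_scale 0)) triv_d 2"
    using del(1) by (simp add: numeral_2_eq_2 cochain_space_def)
qed

section \<open>The functional equation for the components with first index zero\<close>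

lemma mult_power2_le_power3: "(Suc k + 4) * 2 ^ (Suc k + 3) \<le> (3 :: nat) ^ (Suc k + 3)"
proof (induction k)
  case 0
  show ?case by simp
next
  case (Suc k)
  have "(Suc (Suc k) + 4) * 2 ^ (Suc (Suc k) + 3) = (2 * Suc (Suc k) + 8) * (2 :: nat) ^ (Suc k + 3)"
    by (simp only: add_Suc power_Suc) (simp add: algebra_simps)
  also have "\<dots> \<le> 3 * ((Suc k + 4) * 2 ^ (Suc k + 3))" by simp
  also have "\<dots> \<le> 3 * 3 ^ (Suc k + 3)" using Suc by simp
  also have "\<dots> = 3 ^ (Suc (Suc k) + 3)" by (simp only: add_Suc power_Suc)
  finally show ?case .
qed

text \<open>Differentiating the equation with respect to \<open>\<mu>\<close> at \<open>\<mu> = 0\<close> yields an Euler equation whose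
  polynomial solutions are spanned by \<open>t\<close> and \<open>t\<^bsup>k+3\<^esup>\<close>; the values \<open>\<lambda> = 1\<close>, \<open>\<mu> = 2\<close> exclude the latter
  unless \<open>k = 0\<close>.\<close>

lemma block_functional_equation:
  fixes H :: "complex poly" and k :: nat
  assumes eq: "\<And>l m. (l - m) * poly H (l + m) + ((of_nat k + 2) * l + m) * poly H m
    - ((of_nat k + 2) * m + l) * poly H l = 0"
  shows "\<exists>c e. (k \<noteq> 0 \<longrightarrow> e = 0) \<and> (\<forall>t. poly H t = c * t + e * t ^ 3)"
proof -
  let ?k = "of_nat k + 2 :: complex"
  have k: "?k \<noteq> 0"
    using of_nat_eq_0_iff[of "k + 2", where ?'a = complex] by (simp add: add.commute)
  have H0: "poly H 0 = 0" using eq[of 1 0] k by simp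
  have ode: "t * poly (pderiv H) t = (?k + 1) * poly H t - ?k * t * poly (pderiv H) 0" for t
  proof -
    \<comment> \<open>The equation with l = t, written as a polynomial in m so that it can be
      differentiated formally.\<close>
    have "[:t, - 1:] * pcompose H [:t, 1:] + [:?k * t, 1:] * H - [:t * poly H t, ?k * poly H t:] = 0"
      by (rule complex_poly_eqI) (use eq[of t] in \<open>simp add: poly_pcompose algebra_simps\<close>)
    then have "poly (pderiv ([:t, - 1:] * pcompose H [:t, 1:] + [:?k * t, 1:] * H -
        [:t * poly H t, ?k * poly H t:])) 0 = 0" by simp
    then show ?thesis
      by (simp add: pderiv_mult pderiv_add pderiv_diff pderiv_smult pderiv_pcompose pderiv_pCons poly_pcompose H0 algebra_simps)
  qed
  define c where "c = coeff H 1"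
  define e where "e = coeff H (k + 3)"
  have ode': "[:0, 1:] * pderiv H = Polynomial.smult (?k + 1) H - [:0, ?k * poly (pderiv H) 0:]"
    by (rule complex_poly_eqI) (use ode in \<open>simp add: algebra_simps\<close>)
  \<comment> \<open>Comparing coefficients in tH' = (k+3)H - (k+2)H'(0)t gives (n - (k+3)) h_n = 0
    for n at least 2.\<close>
  have co: "coeff H n = 0" if n: "n \<ge> 2" "n \<noteq> k + 3" for n
  proof -
    obtain n' where n': "n = Suc (Suc n')" using n(1) by (metis add_2_eq_Suc le_Suc_ex)
    have "coeff ([:0, 1:] * pderiv H) n = of_nat n * coeff H n"
      by (simp add: n' coeff_pderiv)
    moreover have "coeff (Polynomial.smult (?k + 1) H - [:0, ?k * poly (pderiv H) 0:]) n = (?k + 1) * coeff H n"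
      by (simp add: n')
    ultimately have "(of_nat n - (?k + 1)) * coeff H n = 0"
      unfolding ode' by (simp add: algebra_simps)
    moreover have "of_nat n - (?k + 1) \<noteq> 0"
    proof
      assume "of_nat n - (?k + 1) = 0"
      then have "of_nat n = (of_nat (k + 3) :: complex)" by (simp add: algebra_simps)
      with n(2) show False by (simp only: of_nat_eq_iff)
    qed
    ultimately show ?thesis by simp
  qed
  have "H = monom c 1 + monom e (k + 3)"
  proof (rule poly_eqI)
    fix n
    consider "n = 0" | "n = 1" | "n = k + 3" | "n \<ge> 2" "n \<noteq> k + 3" by linarith
    then show "coeff H n = coeff (monom c 1 + monom e (k + 3)) n"
      by cases (use H0 co in \<open>auto simp: c_def e_def poly_0_coeff_0\<close>)
  qed
  then have Ht: "poly H t = c * t + e * t ^ (k + 3)" for t by (simp add: poly_monom)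
  show ?thesis
  proof (cases k)
    case 0
    then show ?thesis using Ht by (intro exI[of _ c] exI[of _ e]) (simp add: eval_nat_numeral)
  next
    case (Suc k')
    \<comment> \<open>The linear part of H satisfies the equation identically, so at l = 1, m = 2
      only e remains. For k > 0 its factor is negative by \<open>mult_power2_le_power3\<close>,
      whereas for k = 0 it would be 32 - 32.\<close>
    have "e * (of_nat ((k + 4) * 2 ^ (k + 3)) - of_nat (3 ^ (k + 3) + 2 * k + 5)) = 0"
      using eq[of 1 2] by (simp add: Ht algebra_simps)
    moreover have "of_nat ((k + 4) * 2 ^ (k + 3)) \<noteq> (of_nat (3 ^ (k + 3) + 2 * k + 5) :: complex)"
      unfolding of_nat_eq_iff using mult_power2_le_power3[of k', folded Suc] by linarith
    ultimately have "e = 0" by (simp only: mult_eq_0_iff right_minus_eq) simp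
    then show ?thesis using Ht by (intro exI[of _ c] exI[of _ 0]) simp
  qed
qed

text \<open>The sesquilinear extension of J_i \<mapsto> c_i, with values on the basis constant in
  \<lambda>. Modulo \<partial> only the value at \<lambda> = 0 matters, so these represent all
  reduced 1-cochains.\<close>

definition linear_cochain :: "(nat \<Rightarrow> complex) \<Rightarrow> block list \<Rightarrow> complex list \<Rightarrow> complex" where
  "linear_cochain c as ls = (if length as = 1 \<and> length ls = 1 then
     \<Sum>i\<in>Poly_Mapping.keys (hd as). poly (Poly_Mapping.lookup (hd as) i) (- hd ls) * c i else 0)"

lemma linear_cochain_superset:
  assumes "finite K" "Poly_Mapping.keys x \<subseteq> K"
  shows "linear_cochain c [x] [l] = (\<Sum>i\<in>K. poly (Poly_Mapping.lookup x i) (- l) * c i)"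
  unfolding linear_cochain_def using assms
  by (simp, intro sum.mono_neutral_left) (auto simp: in_keys_iff)

lemma linear_cochain_J: "linear_cochain c [J i] [l] = c i"
  using linear_cochain_superset[of "{i}" "J i" c l] by (simp add: J_def)

lemma linear_cochain: "linear_cochain c \<in> triv_cochains 1"
proof (rule triv.cochainsI)
  have long: "linear_cochain c (as @ x # bs) (ls @ l # ms) =
      (if as = [] \<and> bs = [] \<and> ls = [] \<and> ms = [] then linear_cochain c [x] [l] else 0)" for as x bs ls l ms
    by (auto simp: linear_cochain_def)
  have add: "linear_cochain c [x + y] [l] = linear_cochain c [x] [l] + linear_cochain c [y] [l]" for x y l
  proof -
    let ?K = "Poly_Mapping.keys x \<union> Poly_Mapping.keys y"
    have "Poly_Mapping.keys (x + y) \<subseteq> ?K" by (rule Poly_Mapping.keys_add)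
    then show ?thesis
      by (simp add: linear_cochain_superset[of ?K] lookup_add distrib_right sum.distrib)
  qed
  have scale: "linear_cochain c [block_scale p x] [l] = poly p (- l) * linear_cochain c [x] [l]" for p x l
  proof -
    have "Poly_Mapping.keys (block_scale p x) \<subseteq> Poly_Mapping.keys x"
      by (auto simp: in_keys_iff lookup_block_scale)
    then show ?thesis
      by (simp add: linear_cochain_superset[of "Poly_Mapping.keys x"] lookup_block_scale sum_distrib_left mult.assoc)
  qed
  show "triv.multiadditive (linear_cochain c)"
    unfolding triv.multiadditive_def long by (simp add: add)
  show "triv.sesquilinear (linear_cochain c)"
    unfolding triv.sesquilinear_def long by (simp add: scale one_dim_scale_def)
  show "triv.skew (linear_cochain c)"
    by (simp add: triv.skew_def linear_cochain_def)
  show "polynomial_fun (one_dim_scale 0) 1 (linear_cochain c as)" if "length as = 1" for as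
  proof (rule polynomial_fun_one_dimI)
    let ?p = "\<lambda>ls. \<Sum>i\<in>Poly_Mapping.keys (hd as).
      poly (pcompose (Poly_Mapping.lookup (hd as) i) [:0, - 1:]) (ls ! 0) * c i"
    show "poly_expr 1 ?p"
      by (intro poly_expr_sum poly_expr_mult poly_expr_poly poly_expr_const poly_expr_nth) simp
    show "linear_cochain c as ls = ?p ls" if l: "length ls = 1" for ls
    proof -
      have "hd ls = ls ! 0" using l by (cases ls) auto
      then show ?thesis using l \<open>length as = 1\<close> by (simp add: linear_cochain_def poly_pcompose)
    qed
  qed
qed (auto simp: linear_cochain_def)

text \<open>Cochains pulled back along the projection onto the Virasoro algebra \<open>\<complex>[\<partial>]J\<^sub>0\<close>.\<close>

definition vir_cochain :: "nat \<Rightarrow> (complex list \<Rightarrow> complex) \<Rightarrow> block list \<Rightarrow> complex list \<Rightarrow> complex" where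
  "vir_cochain n P as ls = (if length as = n \<and> length ls = n then
     prod_list (map2 (\<lambda>a l. poly (Poly_Mapping.lookup a 0) (- l)) as ls) * P ls else 0)"

lemma vir_cochain:
  assumes P: "poly_expr n P"
    and skew: "\<And>ls l m ms. length ls + length ms + 2 = n \<Longrightarrow> P (ls @ l # m # ms) = - P (ls @ m # l # ms)"
  shows "vir_cochain n P \<in> triv_cochains n"
proof (rule triv.cochainsI)
  show "triv.multiadditive (vir_cochain n P)"
    unfolding triv.multiadditive_def by (auto simp: vir_cochain_def lookup_add algebra_simps)
  show "triv.sesquilinear (vir_cochain n P)"
    unfolding triv.sesquilinear_def by (auto simp: vir_cochain_def lookup_block_scale one_dim_scale_def)
  show "triv.skew (vir_cochain n P)"
    unfolding triv.skew_def
  proof (intro allI impI)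
    fix as bs :: "block list" and x y and ls ms :: "complex list" and l m
    assume "length as = length ls"
    then show "vir_cochain n P (as @ x # y # bs) (ls @ l # m # ms) =
        - vir_cochain n P (as @ y # x # bs) (ls @ m # l # ms)"
      using skew[of ls ms l m] by (auto simp: vir_cochain_def mult_ac)
  qed
  show "polynomial_fun (one_dim_scale 0) n (vir_cochain n P as)" if a: "length as = n" for as
  proof (rule polynomial_fun_one_dimI)
    let ?p = "\<lambda>ls. (\<Prod>i<n. poly (pcompose (Poly_Mapping.lookup (as ! i) 0) [:0, - 1:]) (ls ! i)) * P ls"
    show "poly_expr n ?p"
      by (intro poly_expr_prod poly_expr_mult poly_expr_poly poly_expr_nth P) simp
    show "vir_cochain n P as ls = ?p ls" if "length ls = n" for ls
      using that a
      by (simp add: vir_cochain_def prod.list_conv_set_nth atLeast0LessThan poly_pcompose)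
  qed
qed (auto simp: vir_cochain_def)

text \<open>A skew-symmetric lift of the Virasoro 2-cocycle: where the parameters are \<lambda> and
  -\<lambda>, its value on \<open>[J 0, J 0]\<close> is twice the cube of \<lambda>.\<close>

definition vir_cocycle :: "block list \<Rightarrow> complex list \<Rightarrow> complex" where
  "vir_cocycle = vir_cochain 2 (\<lambda>ls. ls ! 0 ^ 3 + - 1 * ls ! 1 ^ 3)"

lemma vir_cocycle: "vir_cocycle \<in> triv_cochains 2"
  unfolding vir_cocycle_def
proof (rule vir_cochain)
  show "poly_expr 2 (\<lambda>ls. ls ! 0 ^ 3 + - 1 * ls ! 1 ^ 3)"
    by (intro poly_expr_add poly_expr_mult poly_expr_power poly_expr_const poly_expr_nth) auto
qed auto

lemma vir_cocycle_apply:
  "vir_cocycle [x, y] [l, m] =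
    poly (Poly_Mapping.lookup x 0) (- l) * poly (Poly_Mapping.lookup y 0) (- m) * (l ^ 3 - m ^ 3)"
  by (simp add: vir_cocycle_def vir_cochain_def)

text \<open>On \<open>J 0\<close> the coboundary is an alternating polynomial of degree four in
  three variables, hence a Vandermonde product times a multiple of the sum of the variables.
  \<open>?P\<close> is that product, with the sign that makes the multiple equal to 1.\<close>

lemma vir_cocycle_closed: "triv_d 2 vir_cocycle \<in> triv_partials 3"
proof -
  let ?P = "\<lambda>ls. (ls ! 1 + - 1 * ls ! 0) * ((ls ! 1 + - 1 * ls ! 2) * (ls ! 0 + - 1 * ls ! 2)) :: complex"
  have b: "vir_cochain 3 ?P \<in> triv_cochains 3"
  proof (rule vir_cochain)
    show "poly_expr 3 ?P"
      by (intro poly_expr_add poly_expr_mult poly_expr_const poly_expr_nth) auto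
    fix ls ms :: "complex list" and l m
    assume "length ls + length ms + 2 = 3"
    then consider a where "ls = []" "ms = [a]" | a where "ls = [a]" "ms = []"
      by (cases ls; cases ms) auto
    then show "?P (ls @ l # m # ms) = - ?P (ls @ m # l # ms)"
      by cases (simp_all add: eval_nat_numeral algebra_simps)
  qed
  have "triv_d 2 vir_cocycle as ls = cochain_partial (one_dim_scale 0) (vir_cochain 3 ?P) as ls" for as ls
  proof (cases "length as = 3 \<and> length ls = 3")
    case True
    then obtain x y z l m k where s: "as = [x, y, z]" "ls = [l, m, k]"
      by (auto simp: eval_nat_numeral length_Suc_conv)
    have "triv_d 2 vir_cocycle as ls = poly (Poly_Mapping.lookup x 0) (- l) *
        poly (Poly_Mapping.lookup y 0) (- m) * poly (Poly_Mapping.lookup z 0) (- k) *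
        (- ((l - m) * ((l + m) ^ 3 - k ^ 3)) - (l - k) * (m ^ 3 - (l + k) ^ 3) + (m - k) * (l ^ 3 - (m + k) ^ 3))"
      unfolding triv.differential_cochain[OF vir_cocycle] s triv_dif_2 vir_cocycle_apply lookup_block_bracket_0
      by (simp add: poly_pcompose algebra_simps)
    also have "- ((l - m) * ((l + m) ^ 3 - k ^ 3)) - (l - k) * (m ^ 3 - (l + k) ^ 3) + (m - k) * (l ^ 3 - (m + k) ^ 3)
        = (l + m + k) * ((m - l) * ((m - k) * (l - k)))"
      by (simp add: power3_eq_cube algebra_simps)
    also have "poly (Poly_Mapping.lookup x 0) (- l) * poly (Poly_Mapping.lookup y 0) (- m) *
        poly (Poly_Mapping.lookup z 0) (- k) * ((l + m + k) * ((m - l) * ((m - k) * (l - k)))) =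
        cochain_partial (one_dim_scale 0) (vir_cochain 3 ?P) as ls"
      unfolding triv_partial_apply s vir_cochain_def by (simp add: eval_nat_numeral)
    finally show ?thesis .
  next
    case False
    then have "triv_d 2 vir_cocycle as ls = 0" "vir_cochain 3 ?P as ls = 0"
      using triv.cochains_eq_0[OF triv.differential_cochains[OF vir_cocycle], of as ls]
        triv.cochains_eq_0[OF b, of as ls] by (auto simp: eval_nat_numeral)
    then show ?thesis by (simp add: triv_partial_apply)
  qed
  then have "triv_d 2 vir_cocycle = cochain_partial (one_dim_scale 0) (vir_cochain 3 ?P)"
    by (intro ext)
  with b show ?thesis by (simp add: partial_cochains_def)
qed

section \<open>Reduced 2-cocycles modulo coboundaries and the Virasoro cocycle\<close>

lemma triv_dif_linear_cochain:
  "triv.dif (linear_cochain c) [J i, J j] [l, - l] = - ((of_nat (i + j) + 2) * l * c (i + j))"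
proof -
  have "triv.dif (linear_cochain c) [J i, J j] [l, - l] =
      - (((of_nat j + 1) * l - (of_nat i + 1) * - l) * linear_cochain c [J (i + j)] [l + - l])"
    unfolding triv_dif_1 triv_bracket_hd[OF linear_cochain] ..
  then show ?thesis by (simp add: linear_cochain_J algebra_simps del: triv.dif.simps)
qed

text \<open>With third parameter -(l + m), every bracket again leaves two parameters of sum zero.
  The equation thus involves only the restriction of \<gamma> to the line of pairs (t, -t).\<close>

lemma triv_reduced_2_cocycle_equation:
  assumes g: "\<gamma> \<in> triv_cochains 2"
    and d: "\<And>as l m. triv.dif \<gamma> as [l, m, - (l + m)] = 0"
  shows "((of_nat j + 1) * l - (of_nat i + 1) * m) * \<gamma> [J (i + j), J k] [l + m, - (l + m)]
    + ((of_nat (i + k) + 2) * l + (of_nat i + 1) * m) * \<gamma> [J j, J (i + k)] [m, - m]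
    - ((of_nat (j + k) + 2) * m + (of_nat j + 1) * l) * \<gamma> [J i, J (j + k)] [l, - l] = 0"
proof -
  have e: "l + - (l + m) = - m" "m + - (l + m) = - l" by simp_all
  show ?thesis
    using d[of "[J i, J j, J k]" l m]
    unfolding triv_dif_2 e triv_bracket_hd[OF g] triv_bracket_snd[OF g] by (simp add: algebra_simps)
qed

text \<open>Write \<phi>(l) for the value on \<open>[J j, J k]\<close> at \<open>[l, - l]\<close>.
  Once the components on \<open>J 0\<close> vanish, m = 0 in the cocycle equation makes \<phi>
  constant away from 0, l = m = 1 shows that this constant is zero, and m = 0 again gives \<phi>(0)
  = 0.\<close>

lemma triv_reduced_2_trivial:
  assumes g: "\<gamma> \<in> triv_cochains 2"
    and d: "\<And>as l m. triv.dif \<gamma> as [l, m, - (l + m)] = 0"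
    and z: "\<And>k l. \<gamma> [J 0, J k] [l, - l] = 0"
  shows "\<gamma> \<in> triv_partials 2"
proof -
  have J: "\<gamma> [J j, J k] [l, - l] = 0" for j k l
  proof -
    \<comment> \<open>With first index 0 the last term of the cocycle equation is a value on
      \<open>J 0\<close> and \<open>J (j + k)\<close>, which vanishes by \<open>z\<close>; the other
      two terms involve only \<open>J j\<close> and \<open>J k\<close>.\<close>
    have eq: "((of_nat j + 1) * l - m) * \<gamma> [J j, J k] [l + m, - (l + m)]
        + ((of_nat k + 2) * l + m) * \<gamma> [J j, J k] [m, - m] = 0" for l m
      using triv_reduced_2_cocycle_equation[OF g d, of j l 0 m k] z by simp
    have n: "of_nat j + 1 \<noteq> (0 :: complex)" "of_nat k + 2 \<noteq> (0 :: complex)" "of_nat (j + k) + 3 \<noteq> (0 :: complex)"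
      using of_nat_eq_0_iff[of "j + 1", where ?'a = complex] of_nat_eq_0_iff[of "k + 2", where ?'a = complex]
        of_nat_eq_0_iff[of "j + k + 3", where ?'a = complex] by (simp_all add: add_ac)
    have c: "(of_nat j + 1) * \<gamma> [J j, J k] [l, - l] = - ((of_nat k + 2) * \<gamma> [J j, J k] [0, 0])" if "l \<noteq> 0" for l
    proof -
      have "l * ((of_nat j + 1) * \<gamma> [J j, J k] [l, - l] + (of_nat k + 2) * \<gamma> [J j, J k] [0, 0]) = 0"
        using eq[of l 0] by (simp add: algebra_simps)
      with that show ?thesis by (simp add: eq_neg_iff_add_eq_0)
    qed
    have "(of_nat j + 1) * \<gamma> [J j, J k] [1, - 1] = (of_nat j + 1) * \<gamma> [J j, J k] [2, - 2]"
      using c[of 1] c[of 2] by simp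
    then have "\<gamma> [J j, J k] [2, - 2] = \<gamma> [J j, J k] [1, - 1]" using n by simp
    with eq[of 1 1] have "(of_nat (j + k) + 3) * \<gamma> [J j, J k] [1, - 1] = 0"
      by (simp add: algebra_simps)
    then have "\<gamma> [J j, J k] [1, - 1] = 0" using n by simp
    with c[of 1] n have z0: "\<gamma> [J j, J k] [0, 0] = 0" by simp
    show ?thesis
    proof (cases "l = 0")
      case True
      then show ?thesis using z0 by simp
    next
      case False
      then show ?thesis using c[OF False] n z0 by simp
    qed
  qed
  have "\<gamma> as ls = 0" if len: "length ls = 2" and sum: "sum_list ls = 0" for as ls
  proof -
    obtain l m where "ls = [l, m]" using len by (auto simp: numeral_2_eq_2 length_Suc_conv)
    moreover from this have "m = - l" using sum by (simp add: eq_neg_iff_add_eq_0 add.commute)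
    ultimately have ls: "ls = [l, - l]" by simp
    show ?thesis unfolding ls
    proof (rule triv_cochain_eq_0[OF g])
      fix "is" :: "nat list" assume "length is = 2"
      then show "\<gamma> (map J is) [l, - l] = 0" using J by (auto simp: numeral_2_eq_2 length_Suc_conv)
    qed
  qed
  then show ?thesis using triv_partialsI[of \<gamma> 1] g by (simp add: numeral_2_eq_2)
qed

lemma triv_partials_dif_0:
  assumes "\<gamma> \<in> triv_cochains n" "triv_d n \<gamma> \<in> triv_partials (Suc n)" "sum_list ls = 0"
  shows "triv.dif \<gamma> as ls = 0"
  using assms(2,3) unfolding triv.differential_cochain[OF assms(1)]
  by (auto simp: partial_cochains_def triv_partial_apply)

lemma triv_reduced_cohomology_2:
  "has_dim (reduced_cohomology block_scale block_bracket (one_dim_scale 0) zero_act 2) 1"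
  unfolding triv.reduced_cohomology_eq
proof (rule triv.basic.has_dim_quotient_cohomology_1I[of vir_cocycle])
  show "vir_cocycle \<in> carrier (cochain_space block_scale (one_dim_scale 0) 2)"
    using vir_cocycle by (simp add: cochain_space_def)
  show vd: "triv_d 2 vir_cocycle \<in> triv_partials (Suc 2)"
    using vir_cocycle_closed by (simp add: eval_nat_numeral)
  fix w b assume w: "w \<in> triv_partials 2"
    and "b \<in> coboundaries (cochain_space block_scale (one_dim_scale 0)) triv_d 2"
  then obtain \<delta> where del: "\<delta> \<in> triv_cochains 1" "b = triv_d 1 \<delta>"
    by (auto simp: numeral_2_eq_2 cochain_space_def)
  have w0: "w as [l, - l] = 0" for as l
    using w by (auto simp: partial_cochains_def triv_partial_apply)
  have bl: "b [J 0, J 0] [l, - l] = - (2 * l * \<delta> [J 0] [0])" for l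
    using triv_bracket_hd[OF del(1), of l 0 0 "[]" "- l" "[]"]
    unfolding del(2) triv.differential_cochain[OF del(1)] triv_dif_1 by simp
  show "vir_cocycle \<noteq> w \<oplus>\<^bsub>cochain_space block_scale (one_dim_scale 0) 2\<^esub> b"
  proof
    assume "vir_cocycle = w \<oplus>\<^bsub>cochain_space block_scale (one_dim_scale 0) 2\<^esub> b"
    then have "vir_cocycle = (\<lambda>as ls. w as ls + b as ls)" by (simp add: cochain_space_def)
    then have "vir_cocycle [J 0, J 0] [l, - l] = w [J 0, J 0] [l, - l] + b [J 0, J 0] [l, - l]" for l
      by (rule fun_cong[OF fun_cong])
    \<comment> \<open>On pairs (l, -l) the partial \<open>w\<close> vanishes and the coboundary
      \<open>b\<close> is linear in l, while the Virasoro cocycle is cubic. The values at l = 1 and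
      l = 2 are incompatible.\<close>
    then have eq: "2 * l ^ 3 = - (2 * l * \<delta> [J 0] [0])" for l
      unfolding vir_cocycle_apply w0 bl by (simp add: lookup_J)
    have "16 = 2 * - (2 * \<delta> [J 0] [0])" using eq[of 2] by simp
    also have "- (2 * \<delta> [J 0] [0]) = 2" using eq[of 1] by simp
    finally show False by simp
  qed
next
  let ?C = "cochain_space block_scale (one_dim_scale 0) 2"
  fix \<gamma> assume "\<gamma> \<in> carrier ?C" and dg: "triv_d 2 \<gamma> \<in> triv_partials (Suc 2)"
  then have g: "\<gamma> \<in> triv_cochains 2" by (simp add: cochain_space_def)
  have d0: "triv.dif \<gamma> as [l, m, - (l + m)] = 0" for as l m
    by (rule triv_partials_dif_0[OF g dg]) simp
  have vd: "triv_d 2 vir_cocycle \<in> triv_partials (Suc 2)"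
    using vir_cocycle_closed by (simp add: eval_nat_numeral)
  have v0: "triv.dif vir_cocycle as [l, m, - (l + m)] = 0" for as l m
    by (rule triv_partials_dif_0[OF vir_cocycle vd]) simp
  have "\<exists>c e. (k \<noteq> 0 \<longrightarrow> e = 0) \<and> (\<forall>t. \<gamma> [J 0, J k] [t, - t] = c * t + e * t ^ 3)" for k
  proof -
    obtain H where H: "\<And>t. \<gamma> [J 0, J k] [t, - t] = poly H t"
      using polynomial_fun_one_dim_line[OF triv.cochains_polynomial[OF g, of "[J 0, J k]"],
          of "[[:0, 1:], [:0, - 1:]]"] by auto
    show ?thesis unfolding H
    proof (rule block_functional_equation)
      fix l m
      \<comment> \<open>The cocycle equation with its first two indices 0 involves only the
        component on \<open>J 0\<close> and \<open>J k\<close>.\<close>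
      show "(l - m) * poly H (l + m) + ((of_nat k + 2) * l + m) * poly H m
          - ((of_nat k + 2) * m + l) * poly H l = 0"
        using triv_reduced_2_cocycle_equation[OF g d0, of 0 l 0 m k, unfolded add_0 H] by simp
    qed
  qed
  then obtain c e where ce: "\<And>k. k \<noteq> 0 \<Longrightarrow> e k = 0"
    "\<And>k t. \<gamma> [J 0, J k] [t, - t] = c k * t + e k * t ^ 3" by metis
  \<comment> \<open>By \<open>triv_dif_linear_cochain\<close>, the coboundary on
    \<open>[J 0, J k]\<close> multiplies the k-th coefficient by -(k+2)l; this choice makes it c_k
    l.\<close>
  define \<delta> where "\<delta> = linear_cochain (\<lambda>k. - c k / (of_nat k + 2))"
  have del: "\<delta> \<in> triv_cochains 1" unfolding \<delta>_def by (rule linear_cochain)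
  have dd: "triv_d 1 \<delta> \<in> triv_cochains 2"
    using triv.differential_cochains[OF del] by (simp add: numeral_2_eq_2)
  \<comment> \<open>The factor 1/2 compensates for the value 2t^3 of \<open>vir_cocycle\<close> at
    \<open>[t, - t]\<close>; for k > 0 there is no cubic term to remove.\<close>
  let ?v = "\<lambda>as ls. one_dim_scale 0 [:e 0 / 2:] (vir_cocycle as ls)"
  have v: "?v \<in> triv_cochains 2" by (rule triv.cochains_const[OF vir_cocycle])
  let ?b = "\<lambda>as ls. triv_d 1 \<delta> as ls + ?v as ls"
  have b: "?b \<in> triv_cochains 2" by (rule triv.cochains_add[OF dd v])
  define w where "w = (\<lambda>as ls. \<gamma> as ls - ?b as ls)"
  have "w \<in> triv_partials 2"
  proof (rule triv_reduced_2_trivial)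
    show "w \<in> triv_cochains 2" unfolding w_def by (rule triv.cochains_diff[OF g b])
    fix as l m
    have "triv.dif (triv_d 1 \<delta>) as [l, m, - (l + m)] = 0"
      using triv.differential_differential[OF del] triv.differential_cochain[OF dd]
      by (simp add: numeral_2_eq_2 fun_eq_iff del: triv.dif.simps)
    then show "triv.dif w as [l, m, - (l + m)] = 0"
      unfolding w_def triv.dif_diff triv.dif_add triv.dif_const d0 v0 by simp
  next
    fix k l
    have k: "of_nat k + 2 \<noteq> (0 :: complex)"
      using of_nat_eq_0_iff[of "k + 2", where ?'a = complex] by (simp add: add.commute)
    have "triv_d 1 \<delta> [J 0, J k] [l, - l] = c k * l"
      unfolding triv.differential_cochain[OF del] unfolding \<delta>_def triv_dif_linear_cochain
      using k by simp
    moreover have "?v [J 0, J k] [l, - l] = e k * l ^ 3"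
      using ce(1)[of k] by (cases "k = 0") (simp_all add: vir_cocycle_apply lookup_J one_dim_scale_def)
    ultimately show "w [J 0, J k] [l, - l] = 0"
      by (simp add: w_def ce(2))
  qed
  moreover have "triv_d 1 \<delta> \<in> coboundaries (cochain_space block_scale (one_dim_scale 0)) triv_d 2"
    using del by (simp add: numeral_2_eq_2 cochain_space_def)
  moreover have "\<gamma> = w \<oplus>\<^bsub>?C\<^esub> (triv_d 1 \<delta> \<oplus>\<^bsub>?C\<^esub> (e 0 / 2) \<odot>\<^bsub>?C\<^esub> vir_cocycle)"
    by (simp add: cochain_space_def w_def)
  ultimately show "\<exists>c. \<exists>w\<in>triv_partials 2.
      \<exists>b\<in>coboundaries (cochain_space block_scale (one_dim_scale 0)) triv_d 2.
        \<gamma> = w \<oplus>\<^bsub>?C\<^esub> (b \<oplus>\<^bsub>?C\<^esub> c \<odot>\<^bsub>?C\<^esub> vir_cocycle)"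
    by blast
qed

theorem theorem4p6:
  shows
    "has_dim (basic_cohomology block_scale block_bracket (one_dim_scale 0) zero_act 0) 1 \<and>
     has_dim (basic_cohomology block_scale block_bracket (one_dim_scale 0) zero_act 1) 0 \<and>
     has_dim (basic_cohomology block_scale block_bracket (one_dim_scale 0) zero_act 2) 0 \<and>
     has_dim (reduced_cohomology block_scale block_bracket (one_dim_scale 0) zero_act 0) 1 \<and>
     has_dim (reduced_cohomology block_scale block_bracket (one_dim_scale 0) zero_act 1) 0 \<and>
     has_dim (reduced_cohomology block_scale block_bracket (one_dim_scale 0) zero_act 2) 1 \<and>
     (\<forall>a::complex. a \<noteq> 0 \<longrightarrow>
        (\<forall>q. has_dim (reduced_cohomology block_scale block_bracket (one_dim_scale a) zero_act q) 0)) \<and>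
     (\<forall>\<Delta> \<alpha> :: complex. \<alpha> \<noteq> 0 \<longrightarrow>
        (\<forall>q. has_dim (reduced_cohomology block_scale block_bracket M_scale (M_act \<Delta> \<alpha>) q) 0))"
  by (intro conjI allI impI triv_basic_cohomology_0 triv_basic_cohomology_1 triv_basic_cohomology_2
      triv_reduced_cohomology_0 triv_reduced_cohomology_1 triv_reduced_cohomology_2
      reduced_cohomology_one_dim reduced_cohomology_M)

end
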